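(* Let $0<\varepsilon<1/6$ and let $\mathcal{R}$ be a set of items that can be packed into the $N\times N$ knapsack (rotations allowed). Then there exists an $\varepsilon$-granular container packing with $O_\varepsilon(1)$ containers of a subset $\mathcal{R}'\subseteq\mathcal{R}$ into the $N\times N$ knapsack, with $90^\circ$ rotations allowed, such that $p(\mathcal{R}')\ge(2/3-O(\varepsilon))\,p(\mathcal{R})$.
   Context: Items are axis-parallel rectangles with positive width, height and profit; $p(\cdot)$ is total profit. A packing into the $N\times N$ knapsack places items axis-parallel inside $[0,N]^2$ with pairwise disjoint interiors, each possibly rotated by $90^\circ$. A container is an axis-parallel box with a set of items packed inside, of type horizontal (every horizontal line meets at most one packed item), vertical (every vertical line meets at most one packed item), or $\varepsilon$-granular area container of size $w\times h$ (every packed item has width at most $\varepsilon w$ and height at most $\varepsilon h$). An $\varepsilon$-granular container packing is one where containers have pairwise disjoint interiors and every packed item lies in some container respecting its type. $O_\varepsilon(1)$ depends only on $\varepsilon$. *)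

theory Defs
  imports "HOL-Analysis.Analysis"
begin

text \<open>The label allows a set of items to contain several items with the same
  width, height and profit. Since the label type is fixed, the constants of an
  asymptotic statement cannot depend on it.\<close>

record item =
  item_label :: nat
  item_width :: real
  item_height :: real
  item_profit :: real

definition valid_item :: "item \<Rightarrow> bool" where
  "valid_item i \<longleftrightarrow> 0 < item_width i \<and> 0 < item_height i \<and> 0 < item_profit i"

definition profit :: "item set \<Rightarrow> real" where
  "profit R = (\<Sum>i\<in>R. item_profit i)"

record placement =
  corner_x :: real
  corner_y :: real
  rotated :: bool

definition placed_width :: "(item \<Rightarrow> placement) \<Rightarrow> item \<Rightarrow> real" where
  "placed_width \<phi> i = (if rotated (\<phi> i) then item_height i else item_width i)"

definition placed_height :: "(item \<Rightarrow> placement) \<Rightarrow> item \<Rightarrow> real" where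
  "placed_height \<phi> i = (if rotated (\<phi> i) then item_width i else item_height i)"

definition rectangle :: "real \<Rightarrow> real \<Rightarrow> real \<Rightarrow> real \<Rightarrow> (real \<times> real) set" where
  "rectangle x y w h = cbox (x, y) (x + w, y + h)"

definition placed_item :: "(item \<Rightarrow> placement) \<Rightarrow> item \<Rightarrow> (real \<times> real) set" where
  "placed_item \<phi> i =
     rectangle (corner_x (\<phi> i)) (corner_y (\<phi> i)) (placed_width \<phi> i) (placed_height \<phi> i)"

definition knapsack :: "real \<Rightarrow> (real \<times> real) set" where
  "knapsack N = rectangle 0 0 N N"

definition packing :: "real \<Rightarrow> item set \<Rightarrow> (item \<Rightarrow> placement) \<Rightarrow> bool" where
  "packing N R \<phi> \<longleftrightarrow>
     (\<forall>i\<in>R. placed_item \<phi> i \<subseteq> knapsack N) \<and>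
     disjoint_family_on (\<lambda>i. interior (placed_item \<phi> i)) R"

datatype container_type = Horizontal | Vertical | Area

record container =
  container_type :: container_type
  container_x :: real
  container_y :: real
  container_width :: real
  container_height :: real
  contents :: "item set"

definition container_box :: "container \<Rightarrow> (real \<times> real) set" where
  "container_box c =
     rectangle (container_x c) (container_y c) (container_width c) (container_height c)"

text \<open>A line meets an item if it meets its interior: items stacked on top of
  each other in a horizontal container may share boundary points.\<close>

definition respects_type :: "real \<Rightarrow> (item \<Rightarrow> placement) \<Rightarrow> container \<Rightarrow> bool" where
  "respects_type \<epsilon> \<phi> c \<longleftrightarrow>
     (case container_type c of
        Horizontal \<Rightarrow>
          \<forall>y. \<exists>\<^sub>\<le>\<^sub>1 i. i \<in> contents c \<and> interior (placed_item \<phi> i) \<inter> (UNIV \<times> {y}) \<noteq> {}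
      | Vertical \<Rightarrow>
          \<forall>x. \<exists>\<^sub>\<le>\<^sub>1 i. i \<in> contents c \<and> interior (placed_item \<phi> i) \<inter> ({x} \<times> UNIV) \<noteq> {}
      | Area \<Rightarrow>
          \<forall>i\<in>contents c. placed_width \<phi> i \<le> \<epsilon> * container_width c \<and>
                          placed_height \<phi> i \<le> \<epsilon> * container_height c)"

definition granular_container ::
  "real \<Rightarrow> (item \<Rightarrow> placement) \<Rightarrow> container \<Rightarrow> bool" where
  "granular_container \<epsilon> \<phi> c \<longleftrightarrow>
     0 < container_width c \<and> 0 < container_height c \<and>
     (\<forall>i\<in>contents c. placed_item \<phi> i \<subseteq> container_box c) \<and>
     respects_type \<epsilon> \<phi> c"

definition granular_container_packing ::
  "real \<Rightarrow> real \<Rightarrow> item set \<Rightarrow> (item \<Rightarrow> placement) \<Rightarrow> container set \<Rightarrow> bool" where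
  "granular_container_packing \<epsilon> N R \<phi> \<C> \<longleftrightarrow>
     packing N R \<phi> \<and>
     finite \<C> \<and>
     (\<forall>c\<in>\<C>. granular_container \<epsilon> \<phi> c \<and> container_box c \<subseteq> knapsack N) \<and>
     disjoint_family_on (\<lambda>c. interior (container_box c)) \<C> \<and>
     (\<Union>c\<in>\<C>. contents c) = R"

end

theory Submission
  imports Defs
begin

text \<open>
  Starting from the empty set \<open>L\<close>, repeatedly add to \<open>L\<close> all items that are both tall relative to
  some row and wide relative to some column they meet, where rows and columns are spanned by the
  edges of the items in \<open>L\<close>. In some round the added items are cheap; drop them. Up to these, every
  item outside \<open>L\<close> is tall relative to a row (class \<open>V\<close>), or wide relative to a column (class \<open>H\<close>), or
  neither, and \<open>L\<close> has bounded size.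

  If \<open>V\<close> has at most a third of the profit, drop it: the rest splits into the items of \<open>L\<close> and
  boundedly many boxes in which all items are flat. Flat boxes are almost entirely packable into
  boundedly many containers, by linear grouping of the wide items and shelves for the narrow ones.
  If \<open>H\<close> has at most a third, argue symmetrically. Otherwise \<open>L\<close> has less than a third of the profit,
  and so has the cheaper one of the sets of tall items touching the top and the bottom of the knapsack
  (or of the wide items touching the left and the right side). Removing it frees a strip, and with a
  free strip everything can be rearranged into flat boxes and (transposed) narrow boxes: items that
  cross box boundaries have small total thickness and are rotated, if necessary, into the strip.
\<close>

text \<open>Two obstacles shape the argument. A flat box must be flat relative to its own height,
  and the rows of a grid may be arbitrarily thin. Hence tallness is measured against rows and not
  against \<open>N\<close>, and \<open>L\<close> grows in rounds because each enlargement refines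
  the grid. The sets added in different rounds are disjoint, so one of about
  \<open>1 / \<epsilon>\<close> rounds is cheap.

  The other obstacle is a tall item that touches both the top and the bottom, since then the cheaper
  side may cost more than half of the tall items. If such an item lies outside the side margins,
  every other item touching both left and right lies in the bottom or top margin, and the argument
  can be transposed. The exception is an item that spans both directions; it belongs to
  \<open>L\<close> and is worth less than a third. Half is enough because no item of
  \<open>H\<close> is tall: the tall items have less than two thirds of the profit.

  All scales come from a finite set that is fixed before the instance. Minima and maxima over this
  set make the constants uniform.\<close>

type_synonym rbox = "real \<times> real \<times> real \<times> real"

section \<open>Separation, containment and symmetries of axis-parallel boxes\<close>

fun xsep :: "rbox \<Rightarrow> rbox \<Rightarrow> bool" where
  "xsep (x, y, w, h) (x', y', w', h') \<longleftrightarrow> x + w \<le> x' \<or> x' + w' \<le> x"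

fun ysep :: "rbox \<Rightarrow> rbox \<Rightarrow> bool" where
  "ysep (x, y, w, h) (x', y', w', h') \<longleftrightarrow> y + h \<le> y' \<or> y' + h' \<le> y"

text \<open>A form of disjoint interiors suited to linear arithmetic. For boxes with positive sides
  the two notions agree, by \<open>interior_rectangle_disjoint\<close> and
  \<open>apart_if_interior_disjoint\<close>.\<close>

definition apart :: "rbox \<Rightarrow> rbox \<Rightarrow> bool" where
  "apart b b' \<longleftrightarrow> xsep b b' \<or> ysep b b'"

fun boxin :: "rbox \<Rightarrow> rbox \<Rightarrow> bool" where
  "boxin (x, y, w, h) (x', y', w', h') \<longleftrightarrow>
     x' \<le> x \<and> x + w \<le> x' + w' \<and> y' \<le> y \<and> y + h \<le> y' + h'"

fun shift_box :: "real \<Rightarrow> real \<Rightarrow> rbox \<Rightarrow> rbox" where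
  "shift_box a b (x, y, w, h) = (x + a, y + b, w, h)"

fun flip_box :: "rbox \<Rightarrow> rbox" where
  "flip_box (x, y, w, h) = (y, x, h, w)"

lemma xsep_sym: "xsep b b' \<longleftrightarrow> xsep b' b" by (cases b; cases b') auto
lemma ysep_sym: "ysep b b' \<longleftrightarrow> ysep b' b" by (cases b; cases b') auto
lemma apart_sym: "apart b b' \<longleftrightarrow> apart b' b" by (auto simp: apart_def xsep_sym[of b] ysep_sym[of b])

lemma xsep_shift [simp]: "xsep (shift_box a b p) (shift_box a b q) = xsep p q"
  by (cases p; cases q) auto
lemma ysep_shift [simp]: "ysep (shift_box a b p) (shift_box a b q) = ysep p q"
  by (cases p; cases q) auto
lemma apart_shift [simp]: "apart (shift_box a b p) (shift_box a b q) = apart p q"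
  by (auto simp: apart_def)
lemma boxin_shift [simp]: "boxin (shift_box a b p) (shift_box a b q) = boxin p q"
  by (cases p; cases q) auto
lemma xsep_flip [simp]: "xsep (flip_box p) (flip_box q) = ysep p q"
  by (cases p; cases q) auto
lemma ysep_flip [simp]: "ysep (flip_box p) (flip_box q) = xsep p q"
  by (cases p; cases q) auto
lemma apart_flip [simp]: "apart (flip_box p) (flip_box q) = apart p q"
  by (auto simp: apart_def)
lemma boxin_flip [simp]: "boxin (flip_box p) (flip_box q) = boxin p q"
  by (cases p; cases q) auto

lemma boxin_trans: "boxin p q \<Longrightarrow> boxin q r \<Longrightarrow> boxin p r"
  by (cases p; cases q; cases r) auto

lemma boxin_refl [simp]: "boxin p p"
  by (cases p) auto

lemma xsep_boxin: "xsep p q \<Longrightarrow> boxin p' p \<Longrightarrow> boxin q' q \<Longrightarrow> xsep p' q'"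
  by (cases p; cases q; cases p'; cases q') auto

lemma ysep_boxin: "ysep p q \<Longrightarrow> boxin p' p \<Longrightarrow> boxin q' q \<Longrightarrow> ysep p' q'"
  by (cases p; cases q; cases p'; cases q') auto

lemma apart_boxin: "apart p q \<Longrightarrow> boxin p' p \<Longrightarrow> boxin q' q \<Longrightarrow> apart p' q'"
  unfolding apart_def using xsep_boxin ysep_boxin by blast

subsection \<open>Placements\<close>

definition pbox :: "(item \<Rightarrow> placement) \<Rightarrow> item \<Rightarrow> rbox" where
  "pbox \<phi> i = (corner_x (\<phi> i), corner_y (\<phi> i), placed_width \<phi> i, placed_height \<phi> i)"

definition shift_placement :: "real \<Rightarrow> real \<Rightarrow> placement \<Rightarrow> placement" where
  "shift_placement a b p = p\<lparr>corner_x := corner_x p + a, corner_y := corner_y p + b\<rparr>"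

text \<open>Reflection in the main diagonal. Toggling \<open>rotated\<close> exchanges placed width
  and height, so each result about rows yields one about columns.\<close>

definition flip_placement :: "placement \<Rightarrow> placement" where
  "flip_placement p = \<lparr>corner_x = corner_y p, corner_y = corner_x p, rotated = (\<not> rotated p)\<rparr>"

abbreviation flip :: "(item \<Rightarrow> placement) \<Rightarrow> item \<Rightarrow> placement" where
  "flip \<phi> \<equiv> (\<lambda>i. flip_placement (\<phi> i))"

lemma pbox_flip [simp]: "pbox (flip \<phi>) i = flip_box (pbox \<phi> i)"
  by (auto simp: pbox_def flip_placement_def placed_width_def placed_height_def)

lemma placed_flip [simp]:
  "placed_width (flip \<phi>) i = placed_height \<phi> i" "placed_height (flip \<phi>) i = placed_width \<phi> i"
  "corner_x (flip_placement p) = corner_y p" "corner_y (flip_placement p) = corner_x p"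
  "rotated (flip_placement p) = (\<not> rotated p)"
  by (auto simp: flip_placement_def placed_width_def placed_height_def)

lemma placed_shift [simp]:
  "corner_x (shift_placement a b p) = corner_x p + a"
  "corner_y (shift_placement a b p) = corner_y p + b"
  "rotated (shift_placement a b p) = rotated p"
  by (auto simp: shift_placement_def)

lemma pbox_cong: "\<phi> i = \<psi> i \<Longrightarrow> pbox \<phi> i = pbox \<psi> i"
  by (simp add: pbox_def placed_width_def placed_height_def)

lemma placed_cong: "rotated (\<phi> i) = rotated (\<psi> i) \<Longrightarrow> placed_width \<phi> i = placed_width \<psi> i"
   "rotated (\<phi> i) = rotated (\<psi> i) \<Longrightarrow> placed_height \<phi> i = placed_height \<psi> i"
  by (simp_all add: placed_width_def placed_height_def)

lemma pbox_shift: "\<phi> i = shift_placement a b (\<psi> i) \<Longrightarrow> pbox \<phi> i = shift_box a b (pbox \<psi> i)"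
  by (auto simp: pbox_def placed_width_def placed_height_def)

lemma placed_pos:
  assumes "valid_item i"
  shows "0 < placed_width \<phi> i" "0 < placed_height \<phi> i"
  using assms by (auto simp: valid_item_def placed_width_def placed_height_def)

definition fits :: "(item \<Rightarrow> placement) \<Rightarrow> item set \<Rightarrow> real \<Rightarrow> real \<Rightarrow> bool" where
  "fits \<phi> S W Z \<longleftrightarrow> (\<forall>i\<in>S. boxin (pbox \<phi> i) (0, 0, W, Z)) \<and>
     pairwise (\<lambda>i j. apart (pbox \<phi> i) (pbox \<phi> j)) S"

definition valid :: "item set \<Rightarrow> bool" where
  "valid S \<longleftrightarrow> finite S \<and> (\<forall>i\<in>S. valid_item i)"

lemma valid_subset: "valid S \<Longrightarrow> T \<subseteq> S \<Longrightarrow> valid T"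
  by (auto simp: valid_def finite_subset)

lemma fits_subset: "fits \<phi> S W Z \<Longrightarrow> T \<subseteq> S \<Longrightarrow> fits \<phi> T W Z"
  unfolding fits_def by (meson pairwise_subset subsetD)

lemma fits_flip: "fits \<phi> S W Z \<Longrightarrow> fits (flip \<phi>) S Z W"
proof -
  have "boxin (flip_box (pbox \<phi> i)) (0, 0, Z, W)" if "boxin (pbox \<phi> i) (0, 0, W, Z)" for i
    using boxin_flip[of "pbox \<phi> i" "(0,0,W,Z)"] that by simp
  then show "fits \<phi> S W Z \<Longrightarrow> fits (flip \<phi>) S Z W"
    by (auto simp: fits_def)
qed

lemma interior_rectangle: "interior (rectangle x y w h) = {x<..<x + w} \<times> {y<..<y + h}"
  by (simp add: rectangle_def interior_cbox box_prod)

lemma interior_rectangle_disjoint: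
  "apart (x, y, w, h) (x', y', w', h') \<Longrightarrow>
    interior (rectangle x y w h) \<inter> interior (rectangle x' y' w' h') = {}"
  by (auto simp: interior_rectangle apart_def)

lemma apart_if_interior_disjoint:
  assumes "interior (rectangle x y w h) \<inter> interior (rectangle x' y' w' h') = {}"
    and "0 < w" "0 < h" "0 < w'" "0 < h'"
  shows "apart (x, y, w, h) (x', y', w', h')"
proof (rule ccontr)
  assume "\<not> ?thesis"
  then have a: "x' < x + w" "x < x' + w'" "y' < y + h" "y < y' + h'"
    by (auto simp: apart_def)
  have "max x x' < min (x + w) (x' + w')" "max y y' < min (y + h) (y' + h')"
    using a assms by auto
  then obtain p q where "max x x' < p" "p < min (x + w) (x' + w')" "max y y' < q" "q < min (y + h) (y' + h')"
    using dense by meson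
  then have "(p, q) \<in> interior (rectangle x y w h) \<inter> interior (rectangle x' y' w' h')"
    by (auto simp: interior_rectangle)
  then show False using assms(1) by auto
qed

lemma rectangle_subset_iff:
  assumes "0 \<le> w" "0 \<le> h"
  shows "rectangle x y w h \<subseteq> rectangle x' y' w' h' \<longleftrightarrow> boxin (x, y, w, h) (x', y', w', h')"
proof
  assume s: "rectangle x y w h \<subseteq> rectangle x' y' w' h'"
  have "(x, y) \<in> rectangle x y w h" "(x + w, y + h) \<in> rectangle x y w h"
    using assms by (auto simp: rectangle_def cbox_Pair_eq)
  then have "(x, y) \<in> rectangle x' y' w' h'" "(x + w, y + h) \<in> rectangle x' y' w' h'"
    using s by auto
  then show "boxin (x, y, w, h) (x', y', w', h')"
    by (auto simp: rectangle_def cbox_Pair_eq)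
qed (auto simp: rectangle_def cbox_Pair_eq)

lemma packing_fits:
  assumes "packing N R \<phi>" "valid R"
  shows "fits \<phi> R N N"
proof -
  have pos: "0 < placed_width \<phi> i" "0 < placed_height \<phi> i" if "i \<in> R" for i
    using placed_pos assms(2) that by (auto simp: valid_def)
  have "boxin (pbox \<phi> i) (0, 0, N, N)" if "i \<in> R" for i
    using assms(1) that pos[OF that] rectangle_subset_iff[of "placed_width \<phi> i" "placed_height \<phi> i"]
    unfolding packing_def placed_item_def knapsack_def pbox_def by auto
  moreover have "apart (pbox \<phi> i) (pbox \<phi> j)" if "i \<in> R" "j \<in> R" "i \<noteq> j" for i j
    unfolding pbox_def
    by (rule apart_if_interior_disjoint)
      (use assms(1) that pos in \<open>auto simp: packing_def disjoint_family_on_def placed_item_def\<close>)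
  ultimately show ?thesis by (auto simp: fits_def pairwise_def)
qed

subsection \<open>Container packings in coordinates\<close>

definition cbx :: "container \<Rightarrow> rbox" where
  "cbx c = (container_x c, container_y c, container_width c, container_height c)"

text \<open>Pairwise separation replaces the condition on lines in \<open>respects_type\<close>. It
  is visibly stable under shifts and flips, and it implies the condition on lines because separated
  items have no common line through their interiors.\<close>

definition cont_ok :: "real \<Rightarrow> (item \<Rightarrow> placement) \<Rightarrow> container \<Rightarrow> bool" where
  "cont_ok \<epsilon> \<phi> c \<longleftrightarrow> 0 < container_width c \<and> 0 < container_height c \<and>
     (\<forall>i\<in>contents c. boxin (pbox \<phi> i) (cbx c)) \<and>
     (case container_type c of
        Horizontal \<Rightarrow> pairwise (\<lambda>i j. ysep (pbox \<phi> i) (pbox \<phi> j)) (contents c)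
      | Vertical \<Rightarrow> pairwise (\<lambda>i j. xsep (pbox \<phi> i) (pbox \<phi> j)) (contents c)
      | Area \<Rightarrow> \<forall>i\<in>contents c. placed_width \<phi> i \<le> \<epsilon> * container_width c \<and>
                          placed_height \<phi> i \<le> \<epsilon> * container_height c)"

definition cpack :: "real \<Rightarrow> nat \<Rightarrow> real \<Rightarrow> real \<Rightarrow> item set \<Rightarrow> (item \<Rightarrow> placement) \<Rightarrow> container set \<Rightarrow> bool"
  where "cpack \<epsilon> K W Z S \<phi> \<C> \<longleftrightarrow>
     pairwise (\<lambda>i j. apart (pbox \<phi> i) (pbox \<phi> j)) S \<and>
     finite \<C> \<and> card \<C> \<le> K \<and>
     (\<forall>c\<in>\<C>. cont_ok \<epsilon> \<phi> c \<and> boxin (cbx c) (0, 0, W, Z)) \<and>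
     pairwise (\<lambda>c d. apart (cbx c) (cbx d)) \<C> \<and>
     (\<Union>c\<in>\<C>. contents c) = S"

text \<open>Hiding placement and containers lets packings be combined by rules that mention only box
  sizes and sets of items.\<close>

definition cpk :: "real \<Rightarrow> nat \<Rightarrow> real \<Rightarrow> real \<Rightarrow> item set \<Rightarrow> bool" where
  "cpk \<epsilon> K W Z S \<longleftrightarrow> (\<exists>\<phi> \<C>. cpack \<epsilon> K W Z S \<phi> \<C>)"

lemma cont_ok_respects_type:
  assumes "cont_ok \<epsilon> \<phi> c"
  shows "respects_type \<epsilon> \<phi> c"
proof (cases "container_type c")
  case Horizontal
  have s: "ysep (pbox \<phi> i) (pbox \<phi> j)" if "i \<in> contents c" "j \<in> contents c" "i \<noteq> j" for i j
    using assms Horizontal that by (auto simp: cont_ok_def pairwise_def)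
  have "i = j" if "i \<in> contents c" "j \<in> contents c"
    "interior (placed_item \<phi> i) \<inter> (UNIV \<times> {y}) \<noteq> {}" "interior (placed_item \<phi> j) \<inter> (UNIV \<times> {y}) \<noteq> {}"
    for i j y
    using s[OF that(1,2)] that(3,4) by (force simp: placed_item_def interior_rectangle pbox_def)
  then show ?thesis unfolding respects_type_def Horizontal Uniq_def container_type.case by blast
next
  case Vertical
  have s: "xsep (pbox \<phi> i) (pbox \<phi> j)" if "i \<in> contents c" "j \<in> contents c" "i \<noteq> j" for i j
    using assms Vertical that by (auto simp: cont_ok_def pairwise_def)
  have "i = j" if "i \<in> contents c" "j \<in> contents c"
    "interior (placed_item \<phi> i) \<inter> ({y} \<times> UNIV) \<noteq> {}" "interior (placed_item \<phi> j) \<inter> ({y} \<times> UNIV) \<noteq> {}"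
    for i j y
    using s[OF that(1,2)] that(3,4) by (force simp: placed_item_def interior_rectangle pbox_def)
  then show ?thesis unfolding respects_type_def Vertical Uniq_def container_type.case by blast
next
  case Area
  then show ?thesis using assms by (auto simp: respects_type_def cont_ok_def)
qed

lemma cpack_granular:
  assumes "cpack \<epsilon> K N N S \<phi> \<C>" "valid S"
  shows "granular_container_packing \<epsilon> N S \<phi> \<C>"
proof -
  note c = assms(1)[unfolded cpack_def]
  have pos: "0 < placed_width \<phi> i" "0 < placed_height \<phi> i" if "i \<in> S" for i
    using placed_pos assms(2) that by (auto simp: valid_def)
  have inc: "placed_item \<phi> i \<subseteq> container_box d" if "d \<in> \<C>" "i \<in> contents d" for d i
  proof -
    have "i \<in> S" using c that by auto
    then show ?thesis using c that pos[of i]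
      unfolding placed_item_def container_box_def
      by (subst rectangle_subset_iff) (auto simp: cont_ok_def pbox_def cbx_def)
  qed
  have ink: "container_box d \<subseteq> knapsack N" if "d \<in> \<C>" for d
    using c that unfolding container_box_def knapsack_def
    by (subst rectangle_subset_iff) (auto simp: cont_ok_def cbx_def)
  have "packing N S \<phi>"
    unfolding packing_def
  proof (intro conjI ballI)
    fix i assume "i \<in> S"
    then obtain d where "d \<in> \<C>" "i \<in> contents d" using c by auto
    then show "placed_item \<phi> i \<subseteq> knapsack N" using inc ink by blast
  next
    have "interior (placed_item \<phi> i) \<inter> interior (placed_item \<phi> j) = {}"
      if "i \<in> S" "j \<in> S" "i \<noteq> j" for i j
      unfolding placed_item_def
      by (rule interior_rectangle_disjoint) (use c that in \<open>auto simp: pairwise_def pbox_def\<close>)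
    then show "disjoint_family_on (\<lambda>i. interior (placed_item \<phi> i)) S"
      unfolding disjoint_family_on_def by auto
  qed
  moreover have "disjoint_family_on (\<lambda>c. interior (container_box c)) \<C>"
  proof -
    have "interior (container_box d) \<inter> interior (container_box e) = {}"
      if "d \<in> \<C>" "e \<in> \<C>" "d \<noteq> e" for d e
      unfolding container_box_def
      by (rule interior_rectangle_disjoint) (use c that in \<open>auto simp: pairwise_def cbx_def\<close>)
    then show ?thesis unfolding disjoint_family_on_def by auto
  qed
  moreover have "granular_container \<epsilon> \<phi> d" if "d \<in> \<C>" for d
    using c that inc cont_ok_respects_type unfolding granular_container_def
    by (auto simp: cont_ok_def)
  ultimately show ?thesis
    using c ink unfolding granular_container_packing_def by auto
qed

section \<open>Shifting, gluing and transposing container packings\<close>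

lemma cont_ok_transfer:
  assumes "cont_ok \<epsilon> \<psi> c" and "\<And>i. i \<in> contents c \<Longrightarrow> \<phi> i = shift_placement a b (\<psi> i)"
  shows "cont_ok \<epsilon> \<phi> (c\<lparr>container_x := container_x c + a, container_y := container_y c + b\<rparr>)"
proof -
  have s: "pbox \<phi> i = shift_box a b (pbox \<psi> i)" if "i \<in> contents c" for i
    using assms(2)[OF that] by (rule pbox_shift)
  have d: "placed_width \<phi> i = placed_width \<psi> i" "placed_height \<phi> i = placed_height \<psi> i"
    if "i \<in> contents c" for i
    using assms(2)[OF that] by (auto intro: placed_cong)
  have e: "cbx (c\<lparr>container_x := container_x c + a, container_y := container_y c + b\<rparr>) = shift_box a b (cbx c)"
    by (simp add: cbx_def)
  show ?thesis
    using assms(1) unfolding cont_ok_def e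
    by (cases "container_type c") (auto simp: s d pairwise_def)
qed

text \<open>Each class of \<open>\<kappa>\<close> is packed in the coordinates of its own box and
  then shifted to the corner of that box. The type of keys is left open because later keys carry the
  coordinates of their box, so that items with the same box fall into one class
  automatically.\<close>

lemma cpk_glue:
  fixes \<kappa> :: "item \<Rightarrow> 'k" and bx :: "'k \<Rightarrow> rbox"
  assumes fin: "finite Q"
    and sub: "\<And>j. j \<in> \<kappa> ` Q \<Longrightarrow> boxin (bx j) (0, 0, W, Z)"
    and ap: "\<And>j j'. j \<in> \<kappa> ` Q \<Longrightarrow> j' \<in> \<kappa> ` Q \<Longrightarrow> j \<noteq> j' \<Longrightarrow> apart (bx j) (bx j')"
    and cp: "\<And>j. j \<in> \<kappa> ` Q \<Longrightarrow>
       case bx j of (x, y, w, h) \<Rightarrow> cpk \<epsilon> K w h {i \<in> Q. \<kappa> i = j}"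
    and M: "card (\<kappa> ` Q) \<le> M"
  shows "cpk \<epsilon> (M * K) W Z Q"
proof -
  define X where "X j = fst (bx j)" for j
  define Y where "Y j = fst (snd (bx j))" for j
  define w where "w j = fst (snd (snd (bx j)))" for j
  define h where "h j = snd (snd (snd (bx j)))" for j
  have bx: "bx j = (X j, Y j, w j, h j)" for j
    by (simp add: X_def Y_def w_def h_def)
  have "\<forall>j\<in>\<kappa> ` Q. \<exists>\<phi> \<C>. cpack \<epsilon> K (w j) (h j) {i \<in> Q. \<kappa> i = j} \<phi> \<C>"
    using cp unfolding bx cpk_def by auto
  then obtain \<Phi> CC where c: "\<And>j. j \<in> \<kappa> ` Q \<Longrightarrow> cpack \<epsilon> K (w j) (h j) {i \<in> Q. \<kappa> i = j} (\<Phi> j) (CC j)"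
    by metis
  define \<phi> where "\<phi> i = shift_placement (X (\<kappa> i)) (Y (\<kappa> i)) (\<Phi> (\<kappa> i) i)" for i
  define T where "T j c = c\<lparr>container_x := container_x c + X j, container_y := container_y c + Y j\<rparr>"
    for j and c :: container
  define D where "D = (\<Union>j\<in>\<kappa> ` Q. T j ` CC j)"
  have cbxT: "cbx (T j c) = shift_box (X j) (Y j) (cbx c)" for j c
    by (simp add: T_def cbx_def)
  have conT: "contents (T j c) = contents c" for j c by (simp add: T_def)
  have shf: "boxin p (0, 0, w j, h j) \<Longrightarrow> boxin (shift_box (X j) (Y j) p) (bx j)" for p j
    using boxin_shift[of "X j" "Y j" p "(0,0,w j,h j)"] by (simp add: bx)
  have inS: "contents d \<subseteq> {i \<in> Q. \<kappa> i = j}" if "j \<in> \<kappa> ` Q" "d \<in> CC j" for j d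
    using c[OF that(1)] that(2) unfolding cpack_def by auto
  have pb: "pbox \<phi> i = shift_box (X (\<kappa> i)) (Y (\<kappa> i)) (pbox (\<Phi> (\<kappa> i)) i)" for i
    by (rule pbox_shift) (simp add: \<phi>_def)
  have itin: "boxin (pbox \<phi> i) (bx (\<kappa> i))" if "i \<in> Q" for i
  proof -
    have "i \<in> (\<Union>c\<in>CC (\<kappa> i). contents c)"
      using c[of "\<kappa> i"] that unfolding cpack_def by auto
    then obtain d where d: "d \<in> CC (\<kappa> i)" "i \<in> contents d" by auto
    then have "boxin (pbox (\<Phi> (\<kappa> i)) i) (cbx d)" "boxin (cbx d) (0, 0, w (\<kappa> i), h (\<kappa> i))"
      using c[of "\<kappa> i"] that unfolding cpack_def cont_ok_def by auto
    then show ?thesis unfolding pb using shf boxin_trans by blast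
  qed
  have 1: "pairwise (\<lambda>i j. apart (pbox \<phi> i) (pbox \<phi> j)) Q"
  proof (rule pairwiseI)
    fix i j assume ij: "i \<in> Q" "j \<in> Q" "i \<noteq> j"
    show "apart (pbox \<phi> i) (pbox \<phi> j)"
    proof (cases "\<kappa> i = \<kappa> j")
      case True
      then have "apart (pbox (\<Phi> (\<kappa> i)) i) (pbox (\<Phi> (\<kappa> i)) j)"
        using c[of "\<kappa> i"] ij unfolding cpack_def pairwise_def by auto
      then show ?thesis unfolding pb True[symmetric] by simp
    next
      case False
      then show ?thesis using ap[of "\<kappa> i" "\<kappa> j"] itin ij apart_boxin by blast
    qed
  qed
  have 2: "finite D" unfolding D_def using fin c by (auto simp: cpack_def)
  have "card D \<le> (\<Sum>j\<in>\<kappa> ` Q. card (T j ` CC j))"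
    unfolding D_def using fin by (intro card_UN_le) auto
  also have "\<dots> \<le> (\<Sum>j\<in>\<kappa> ` Q. K)"
    by (rule sum_mono) (meson c card_image_le cpack_def order_trans)
  also have "\<dots> \<le> M * K" using M by simp
  finally have 3: "card D \<le> M * K" .
  have 4: "cont_ok \<epsilon> \<phi> d \<and> boxin (cbx d) (0, 0, W, Z)" if dD: "d \<in> D" for d
  proof -
    obtain j c' where jc: "j \<in> \<kappa> ` Q" "c' \<in> CC j" "d = T j c'" using dD unfolding D_def by auto
    have "cont_ok \<epsilon> (\<Phi> j) c'" "boxin (cbx c') (0, 0, w j, h j)"
      using c[OF jc(1)] jc(2) unfolding cpack_def by auto
    moreover have "\<phi> i = shift_placement (X j) (Y j) (\<Phi> j i)" if "i \<in> contents c'" for i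
      using inS[OF jc(1,2)] that by (auto simp: \<phi>_def)
    ultimately show ?thesis
      using cont_ok_transfer[of \<epsilon> "\<Phi> j" c' \<phi> "X j" "Y j"] shf sub[OF jc(1)] boxin_trans cbxT
      unfolding jc(3) by (metis T_def)
  qed
  have 5: "pairwise (\<lambda>c d. apart (cbx c) (cbx d)) D"
  proof (rule pairwiseI)
    fix d e assume de: "d \<in> D" "e \<in> D" "d \<noteq> e"
    obtain j c' where jc: "j \<in> \<kappa> ` Q" "c' \<in> CC j" "d = T j c'" using de unfolding D_def by auto
    obtain k c'' where kc: "k \<in> \<kappa> ` Q" "c'' \<in> CC k" "e = T k c''" using de unfolding D_def by auto
    show "apart (cbx d) (cbx e)"
    proof (cases "j = k")
      case True
      then have "c' \<noteq> c''" using de jc kc by auto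
      then show ?thesis using c[OF jc(1)] jc kc True unfolding cpack_def pairwise_def
        by (auto simp: cbxT)
    next
      case False
      have "boxin (cbx d) (bx j)" "boxin (cbx e) (bx k)"
        using c[OF jc(1)] c[OF kc(1)] jc kc shf unfolding cpack_def by (auto simp: cbxT)
      then show ?thesis using ap[OF jc(1) kc(1) False] apart_boxin by blast
    qed
  qed
  have 6: "(\<Union>c\<in>D. contents c) = Q"
  proof
    show "(\<Union>c\<in>D. contents c) \<subseteq> Q" using inS unfolding D_def by (fastforce simp: conT)
    show "Q \<subseteq> (\<Union>c\<in>D. contents c)"
    proof
      fix i assume i: "i \<in> Q"
      then have "i \<in> (\<Union>c\<in>CC (\<kappa> i). contents c)"
        using c[of "\<kappa> i"] unfolding cpack_def by auto
      then show "i \<in> (\<Union>c\<in>D. contents c)" using i unfolding D_def by (force simp: conT)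
    qed
  qed
  show ?thesis unfolding cpk_def cpack_def using 1 2 3 4 5 6 by blast
qed

fun flip_type :: "container_type \<Rightarrow> container_type" where
  "flip_type Horizontal = Vertical" | "flip_type Vertical = Horizontal" | "flip_type Area = Area"

lemma cpk_flip:
  assumes "cpk \<epsilon> K W Z S"
  shows "cpk \<epsilon> K Z W S"
proof -
  obtain \<phi> \<C> where c: "cpack \<epsilon> K W Z S \<phi> \<C>" using assms by (auto simp: cpk_def)
  define T where "T c = \<lparr>container_type = flip_type (container_type c), container_x = container_y c,
     container_y = container_x c, container_width = container_height c,
     container_height = container_width c, contents = contents c\<rparr>" for c :: container
  have cT: "cbx (T c) = flip_box (cbx c)" "contents (T c) = contents c" for c
    by (auto simp: T_def cbx_def)
  have ok: "cont_ok \<epsilon> (flip \<phi>) (T c)" if "cont_ok \<epsilon> \<phi> c" for c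
    using that unfolding cont_ok_def cT
    by (cases "container_type c") (auto simp: T_def pairwise_def)
  have "boxin (cbx (T c)) (0, 0, Z, W)" if "boxin (cbx c) (0, 0, W, Z)" for c
    unfolding cT using boxin_flip[of "cbx c" "(0,0,W,Z)"] that by simp
  moreover have "card (T ` \<C>) \<le> K" using c card_image_le unfolding cpack_def by (meson le_trans)
  moreover have "pairwise (\<lambda>c d. apart (cbx c) (cbx d)) (T ` \<C>)"
    using c unfolding cpack_def pairwise_def by (auto simp: cT)
  ultimately have "cpack \<epsilon> K Z W S (flip \<phi>) (T ` \<C>)"
    using c ok unfolding cpack_def by (auto simp: cT)
  then show ?thesis by (auto simp: cpk_def)
qed

lemma cpk_mono:
  assumes "cpk \<epsilon> K W Z S" "K \<le> K'" "W \<le> W'" "Z \<le> Z'"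
  shows "cpk \<epsilon> K' W' Z' S"
proof -
  have "boxin b (0,0,W,Z) \<Longrightarrow> boxin b (0,0,W',Z')" for b
    using assms by (cases b) auto
  moreover obtain \<phi> \<C> where "cpack \<epsilon> K W Z S \<phi> \<C>" using assms by (auto simp: cpk_def)
  ultimately have "cpack \<epsilon> K' W' Z' S \<phi> \<C>" using assms(2) by (auto simp: cpack_def)
  then show ?thesis by (auto simp: cpk_def)
qed

lemma cpk_empty [simp]: "cpk \<epsilon> K W Z {}"
  unfolding cpk_def cpack_def by (rule exI, rule exI[of _ "{}"]) auto

section \<open>Stacks, piles and single containers\<close>

lemma stack_positions:
  fixes z :: "'a \<Rightarrow> real"
  assumes "finite J" "\<forall>j\<in>J. 0 \<le> z j"
  shows "\<exists>f. (\<forall>j\<in>J. 0 \<le> f j \<and> f j + z j \<le> sum z J) \<and>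
     (\<forall>j\<in>J. \<forall>k\<in>J. j \<noteq> k \<longrightarrow> f j + z j \<le> f k \<or> f k + z k \<le> f j)"
  using assms
proof (induction J rule: finite_induct)
  case empty
  then show ?case by simp
next
  case (insert a J)
  then obtain f where f: "\<forall>j\<in>J. 0 \<le> f j \<and> f j + z j \<le> sum z J"
     "\<forall>j\<in>J. \<forall>k\<in>J. j \<noteq> k \<longrightarrow> f j + z j \<le> f k \<or> f k + z k \<le> f j" by auto
  have n: "0 \<le> sum z J" "0 \<le> z a" using insert by (auto simp: sum_nonneg)
  define g where "g = f(a := sum z J)"
  have ga: "g a = sum z J" and gJ: "\<And>j. j \<in> J \<Longrightarrow> g j = f j"
    using insert.hyps by (auto simp: g_def)
  have "0 \<le> g j \<and> g j + z j \<le> sum z (insert a J)" if "j \<in> insert a J" for j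
  proof (cases "j = a")
    case False
    then have "j \<in> J" using that by simp
    then show ?thesis using f(1) gJ[of j] n insert.hyps by fastforce
  qed (use ga n insert.hyps in simp)
  moreover have "g j + z j \<le> g k \<or> g k + z k \<le> g j"
    if jk: "j \<in> insert a J" "k \<in> insert a J" "j \<noteq> k" for j k
  proof -
    consider "j = a" "k \<in> J" | "k = a" "j \<in> J" | "j \<in> J" "k \<in> J" using jk by auto
    then show ?thesis using f ga gJ jk(3) by cases auto
  qed
  ultimately show ?case by blast
qed

text \<open>\<open>J\<close> lists the reserved slices; it may exceed the set of keys that occur, as
  some slices stay empty.\<close>

lemma cpk_vstack:
  fixes \<kappa> :: "item \<Rightarrow> 'k" and z :: "'k \<Rightarrow> real"
  assumes fin: "finite Q" and J: "finite J" "\<kappa> ` Q \<subseteq> J"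
    and z: "\<And>j. j \<in> J \<Longrightarrow> 0 \<le> z j" "sum z J \<le> Z"
    and cp: "\<And>j. j \<in> J \<Longrightarrow> cpk \<epsilon> K W (z j) {i \<in> Q. \<kappa> i = j}"
    and M: "card J \<le> M"
  shows "cpk \<epsilon> (M * K) W Z Q"
proof -
  have zz: "\<forall>j\<in>J. 0 \<le> z j" using z(1) by simp
  obtain f where f: "\<forall>j\<in>J. 0 \<le> f j \<and> f j + z j \<le> sum z J"
     "\<forall>j\<in>J. \<forall>k\<in>J. j \<noteq> k \<longrightarrow> f j + z j \<le> f k \<or> f k + z k \<le> f j"
    using stack_positions[OF J(1) zz] by (elim exE conjE) (rule that; assumption)
  show ?thesis
  proof (rule cpk_glue[where \<kappa> = \<kappa> and bx = "\<lambda>j. (0, f j, W, z j)"])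
    show "card (\<kappa> ` Q) \<le> M" using card_mono[OF J] M by simp
  next
    fix j assume "j \<in> \<kappa> ` Q"
    then show "boxin (0, f j, W, z j) (0, 0, W, Z)" using f J z by force
  next
    fix j assume "j \<in> \<kappa> ` Q"
    then show "case (0::real, f j, W, z j) of (x, y, w, h) \<Rightarrow> cpk \<epsilon> K w h {i \<in> Q. \<kappa> i = j}"
      using cp J by auto
  next
    fix j k assume "j \<in> \<kappa> ` Q" "k \<in> \<kappa> ` Q" "j \<noteq> k"
    then have "f j + z j \<le> f k \<or> f k + z k \<le> f j" using f J by blast
    then show "apart (0, f j, W, z j) (0, f k, W, z k)" by (auto simp: apart_def)
  qed (use fin in auto)
qed

lemma cpk_hstack:
  fixes \<kappa> :: "item \<Rightarrow> 'k" and z :: "'k \<Rightarrow> real"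
  assumes fin: "finite Q" and J: "finite J" "\<kappa> ` Q \<subseteq> J"
    and z: "\<And>j. j \<in> J \<Longrightarrow> 0 \<le> z j" "sum z J \<le> W"
    and cp: "\<And>j. j \<in> J \<Longrightarrow> cpk \<epsilon> K (z j) Z {i \<in> Q. \<kappa> i = j}"
    and M: "card J \<le> M"
  shows "cpk \<epsilon> (M * K) W Z Q"
proof -
  have "cpk \<epsilon> (M * K) Z W Q"
    by (rule cpk_vstack[where \<kappa> = \<kappa> and z = z and J = J]) (use assms cpk_flip in auto)
  then show ?thesis by (rule cpk_flip)
qed

text \<open>\<open>\<phi>\<close> supplies the orientations. The items are stacked anew, flush left,
  in a single horizontal container.\<close>

lemma cpk_pile:
  assumes S: "valid S" and W: "0 < W" "0 < Z"
    and w: "\<And>i. i \<in> S \<Longrightarrow> placed_width \<phi> i \<le> W"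
    and h: "(\<Sum>i\<in>S. placed_height \<phi> i) \<le> Z"
  shows "cpk \<epsilon> 1 W Z S"
proof -
  have pos: "0 < placed_height \<phi> i" if "i \<in> S" for i
    using placed_pos S that by (auto simp: valid_def)
  have pp: "finite S" "\<forall>j\<in>S. 0 \<le> placed_height \<phi> j" using S less_imp_le[OF pos] by (auto simp: valid_def)
  obtain f where f: "\<forall>j\<in>S. 0 \<le> f j \<and> f j + placed_height \<phi> j \<le> sum (placed_height \<phi>) S"
     "\<forall>j\<in>S. \<forall>k\<in>S. j \<noteq> k \<longrightarrow> f j + placed_height \<phi> j \<le> f k \<or> f k + placed_height \<phi> k \<le> f j"
    using stack_positions[OF pp] by (elim exE conjE) (rule that; assumption)
  define \<psi> where "\<psi> i = \<lparr>corner_x = 0, corner_y = f i, rotated = rotated (\<phi> i)\<rparr>" for i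
  have d: "placed_width \<psi> i = placed_width \<phi> i" "placed_height \<psi> i = placed_height \<phi> i" for i
    by (auto intro: placed_cong simp: \<psi>_def)
  have p: "pbox \<psi> i = (0, f i, placed_width \<phi> i, placed_height \<phi> i)" for i
    by (simp add: pbox_def d) (simp add: \<psi>_def)
  define c where "c = \<lparr>container_type = Horizontal, container_x = 0, container_y = 0,
     container_width = W, container_height = Z, contents = S\<rparr>"
  have "cpack \<epsilon> 1 W Z S \<psi> {c}"
    unfolding cpack_def
  proof (intro conjI ballI)
    fix d assume "d \<in> {c}"
    then have dc: "d = c" by simp
    show "boxin (cbx d) (0, 0, W, Z)" by (simp add: dc c_def cbx_def)
    have "boxin (pbox \<psi> i) (0, 0, W, Z)" if "i \<in> S" for i
      using f w[OF that] h that by (auto simp: p)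
    then show "cont_ok \<epsilon> \<psi> d" using W f unfolding dc cont_ok_def
      by (auto simp: c_def cbx_def pairwise_def p)
  qed (use f in \<open>auto simp: pairwise_def apart_def p c_def\<close>)
  then show ?thesis by (auto simp: cpk_def)
qed

lemma cpk_single:
  assumes "valid_item i"
  shows "cpk \<epsilon> 1 (placed_width \<phi> i) (placed_height \<phi> i) {i}"
  by (rule cpk_pile[where \<phi> = \<phi>]) (use assms placed_pos in \<open>auto simp: valid_def\<close>)

lemma cpk_area:
  assumes "fits \<phi> S W Z" "0 < W" "0 < Z"
    and "\<And>i. i \<in> S \<Longrightarrow> placed_width \<phi> i \<le> \<epsilon> * W \<and> placed_height \<phi> i \<le> \<epsilon> * Z"
  shows "cpk \<epsilon> 1 W Z S"
proof -
  define c where "c = \<lparr>container_type = Area, container_x = 0, container_y = 0,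
     container_width = W, container_height = Z, contents = S\<rparr>"
  have "cpack \<epsilon> 1 W Z S \<phi> {c}"
    using assms unfolding cpack_def cont_ok_def fits_def by (auto simp: c_def cbx_def)
  then show ?thesis by (auto simp: cpk_def)
qed

subsection \<open>Packability with bounded heights\<close>

text \<open>Flatness has to be relative to the box: \<open>flat_box\<close> produces containers once
  \<open>a\<close> is a small multiple of \<open>Z\<close>. Where only the packing matters, as in
  \<open>contract_at\<close>, the bound is set to the trivial value \<open>N\<close>.\<close>

definition fpk :: "real \<Rightarrow> real \<Rightarrow> real \<Rightarrow> item set \<Rightarrow> bool" where
  "fpk a W Z S \<longleftrightarrow> (\<exists>\<phi>. fits \<phi> S W Z \<and> (\<forall>i\<in>S. placed_height \<phi> i \<le> a))"

lemma fpk_mono: "fpk a W Z S \<Longrightarrow> a \<le> a' \<Longrightarrow> W \<le> W' \<Longrightarrow> Z \<le> Z' \<Longrightarrow> T \<subseteq> S \<Longrightarrow> fpk a' W' Z' T"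
proof -
  assume a: "fpk a W Z S" "a \<le> a'" "W \<le> W'" "Z \<le> Z'" "T \<subseteq> S"
  have "boxin b (0,0,W,Z) \<Longrightarrow> boxin b (0,0,W',Z')" for b using a by (cases b) auto
  moreover obtain \<phi> where p: "fits \<phi> S W Z" "\<forall>i\<in>S. placed_height \<phi> i \<le> a" using a by (auto simp: fpk_def)
  ultimately have "fits \<phi> T W' Z'" using a(5) pairwise_subset unfolding fits_def by blast
  then show ?thesis using a p unfolding fpk_def by force
qed

lemma fpk_shiftI:
  assumes "pairwise (\<lambda>i j. apart (pbox \<phi> i) (pbox \<phi> j)) S"
    and "\<And>i. i \<in> S \<Longrightarrow> boxin (pbox \<phi> i) (x, y, W, Z)"
    and "\<And>i. i \<in> S \<Longrightarrow> placed_height \<phi> i \<le> a"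
  shows "fpk a W Z S"
proof -
  define \<psi> where "\<psi> i = shift_placement (- x) (- y) (\<phi> i)" for i
  have p: "pbox \<psi> i = shift_box (- x) (- y) (pbox \<phi> i)" for i
    by (rule pbox_shift) (simp add: \<psi>_def)
  have "boxin (pbox \<psi> i) (0, 0, W, Z)" if "i \<in> S" for i
    using boxin_shift[of "-x" "-y" "pbox \<phi> i" "(x, y, W, Z)"] assms(2)[OF that] by (simp add: p)
  moreover have "placed_height \<psi> i = placed_height \<phi> i" for i
    by (rule placed_cong) (simp add: \<psi>_def)
  ultimately show ?thesis using assms(1,3) unfolding fpk_def fits_def
    by (intro exI[of _ \<psi>]) (auto simp: p)
qed

lemma fpk_stack:
  assumes "fpk a W Z S" "fpk a W Z' T" "0 \<le> Z" "0 \<le> Z'"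
  shows "fpk a W (Z + Z') (S \<union> T)"
proof -
  obtain \<phi> where \<phi>: "fits \<phi> S W Z" "\<forall>i\<in>S. placed_height \<phi> i \<le> a" using assms by (auto simp: fpk_def)
  obtain \<psi> where \<psi>: "fits \<psi> T W Z'" "\<forall>i\<in>T. placed_height \<psi> i \<le> a" using assms by (auto simp: fpk_def)
  \<comment> \<open>An item of both sets keeps its place in the lower part.\<close>
  define \<theta> where "\<theta> i = (if i \<in> S then \<phi> i else shift_placement 0 Z (\<psi> i))" for i
  have p1: "pbox \<theta> i = pbox \<phi> i" if "i \<in> S" for i using that by (intro pbox_cong) (simp add: \<theta>_def)
  have p2: "pbox \<theta> i = shift_box 0 Z (pbox \<psi> i)" if "i \<notin> S" for i
    using that by (intro pbox_shift) (simp add: \<theta>_def)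
  have w1: "boxin (pbox \<theta> i) (0, 0, W, Z)" if "i \<in> S" for i using \<phi> that by (auto simp: p1 fits_def)
  have w2: "boxin (pbox \<theta> i) (0, Z, W, Z')" if "i \<in> T - S" for i
    using \<psi> that boxin_shift[of 0 Z "pbox \<psi> i" "(0,0,W,Z')"] by (auto simp: p2 fits_def)
  have ap: "apart (0, 0, W, Z) (0, Z, W, Z')" by (simp add: apart_def)
  have "apart (pbox \<theta> i) (pbox \<theta> j)" if ij: "i \<in> S \<union> T" "j \<in> S \<union> T" "i \<noteq> j" for i j
  proof -
    consider "i \<in> S" "j \<in> S" | "i \<in> S" "j \<in> T - S" | "i \<in> T - S" "j \<in> S" | "i \<in> T - S" "j \<in> T - S"
      using ij by auto
    then show ?thesis
    proof cases
      case 1 then show ?thesis using \<phi> ij by (auto simp: p1 fits_def pairwise_def)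
    next
      case 2 then show ?thesis using ap w1 w2 apart_boxin by blast
    next
      case 3 then show ?thesis using ap w1 w2 apart_boxin apart_sym by blast
    next
      case 4 then show ?thesis using \<psi> ij by (auto simp: p2 fits_def pairwise_def)
    qed
  qed
  moreover have "boxin (pbox \<theta> i) (0, 0, W, Z + Z')" if "i \<in> S \<union> T" for i
    using w1[of i] w2[of i] that assms by (cases "pbox \<theta> i"; cases "i \<in> S") auto
  moreover have "placed_height \<theta> i \<le> a" if "i \<in> S \<union> T" for i
    using \<phi> \<psi> that placed_cong(2)[of \<theta> i \<phi>] placed_cong(2)[of \<theta> i \<psi>] by (cases "i \<in> S") (auto simp: \<theta>_def)
  ultimately show ?thesis unfolding fpk_def fits_def pairwise_def by blast
qed

lemma fpk_empty [simp]: "fpk a W Z {}"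
  by (simp add: fpk_def fits_def)

lemma fpk_stack_family:
  fixes z :: real
  assumes "finite J" "\<And>j. j \<in> J \<Longrightarrow> fpk a W z (S j)" "0 \<le> z"
  shows "fpk a W (real (card J) * z) (\<Union>j\<in>J. S j)"
  using assms
proof (induction J rule: finite_induct)
  case (insert x F)
  have "fpk a W (z + real (card F) * z) (S x \<union> (\<Union>j\<in>F. S j))"
    by (rule fpk_stack) (use insert in auto)
  then show ?case using insert by (simp add: algebra_simps)
qed simp

subsection \<open>Profits\<close>

lemma profit_nonneg: "valid S \<Longrightarrow> 0 \<le> profit S"
  unfolding profit_def valid_def valid_item_def by (intro sum_nonneg) force

lemma profit_mono: "valid S \<Longrightarrow> T \<subseteq> S \<Longrightarrow> profit T \<le> profit S"
  unfolding profit_def valid_def valid_item_def by (intro sum_mono2) force+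

lemma profit_Diff: "finite S \<Longrightarrow> T \<subseteq> S \<Longrightarrow> profit (S - T) = profit S - profit T"
  unfolding profit_def by (rule sum_diff)

lemma profit_Un_disjoint: "finite S \<Longrightarrow> finite T \<Longrightarrow> S \<inter> T = {} \<Longrightarrow> profit (S \<union> T) = profit S + profit T"
  unfolding profit_def by (rule sum.union_disjoint)

lemma profit_Un_le: "valid S \<Longrightarrow> valid T \<Longrightarrow> profit (S \<union> T) \<le> profit S + profit T"
proof -
  assume a: "valid S" "valid T"
  have "profit (S \<union> T) = profit S + profit (T - S)"
    using profit_Un_disjoint[of S "T - S"] a by (simp add: valid_def)
  also have "profit (T - S) \<le> profit T" by (rule profit_mono) (use a in auto)
  finally show ?thesis by simp
qed

text \<open>Averaging: an item is counted for at most \<open>r\<close> of the \<open>m\<close>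
  indices, so the profits of all indices add up to at most \<open>r\<close> times the total. Cheap
  strips, cheap scales and the cheap round are all found in this way.\<close>

lemma cheap_index:
  assumes S: "valid S" and m: "0 < (m::nat)"
    and r: "\<And>i. i \<in> S \<Longrightarrow> card {t \<in> {..<m}. P t i} \<le> r"
  shows "\<exists>t<m. profit {i \<in> S. P t i} \<le> real r / real m * profit S"
proof (rule ccontr)
  assume "\<not> ?thesis"
  then have "\<forall>t\<in>{..<m}. profit {i \<in> S. P t i} > real r / real m * profit S" by (auto simp: not_le)
  then have "(\<Sum>t<m. real r / real m * profit S) < (\<Sum>t<m. profit {i \<in> S. P t i})"
    using m by (intro sum_strict_mono) auto
  also have "\<dots> = (\<Sum>t<m. \<Sum>i\<in>S. if P t i then item_profit i else 0)"
    unfolding profit_def using S by (intro sum.cong[OF refl] sum.inter_filter) (simp add: valid_def)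
  also have "\<dots> = (\<Sum>i\<in>S. \<Sum>t<m. if P t i then item_profit i else 0)"
    by (rule sum.swap)
  also have "\<dots> = (\<Sum>i\<in>S. real (card {t \<in> {..<m}. P t i}) * item_profit i)"
    by (intro sum.cong refl) (simp add: sum.inter_filter[symmetric])
  also have "\<dots> \<le> (\<Sum>i\<in>S. real r * item_profit i)"
    using S r by (intro sum_mono mult_right_mono) (auto simp: valid_def valid_item_def less_imp_le)
  also have "\<dots> = real r * profit S" by (simp add: profit_def sum_distrib_left)
  finally show False using m by simp
qed

section \<open>Packability up to a relative loss of profit\<close>

definition good :: "real \<Rightarrow> real \<Rightarrow> nat \<Rightarrow> real \<Rightarrow> real \<Rightarrow> item set \<Rightarrow> bool" where
  "good \<epsilon> \<eta> K W Z S \<longleftrightarrow> (\<exists>S'\<subseteq>S. cpk \<epsilon> K W Z S' \<and> profit S' \<ge> (1 - \<eta>) * profit S)"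

lemma good_flip: "good \<epsilon> \<eta> K W Z S \<Longrightarrow> good \<epsilon> \<eta> K Z W S"
  unfolding good_def using cpk_flip by blast

lemma good_mono:
  assumes "good \<epsilon> \<eta> K W Z S" "valid S" "\<eta> \<le> \<eta>'" "K \<le> K'" "W \<le> W'" "Z \<le> Z'"
  shows "good \<epsilon> \<eta>' K' W' Z' S"
proof -
  obtain S' where S: "S' \<subseteq> S" "cpk \<epsilon> K W Z S'" "profit S' \<ge> (1 - \<eta>) * profit S"
    using assms(1) unfolding good_def by blast
  have "(1 - \<eta>') * profit S \<le> (1 - \<eta>) * profit S"
    using assms profit_nonneg by (intro mult_right_mono) auto
  then have "(1 - \<eta>') * profit S \<le> profit S'" using S(3) by linarith
  then show ?thesis unfolding good_def using S(1) cpk_mono[OF S(2) assms(4-6)] by blast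
qed

text \<open>Losses add up because \<open>(1 - \<eta>) * (1 - \<eta>')\<close> is at least
  \<open>1 - (\<eta> + \<eta>')\<close>.\<close>

lemma good_subset:
  assumes "good \<epsilon> \<eta> K W Z T" "valid S" "T \<subseteq> S" "profit T \<ge> (1 - \<eta>') * profit S"
    "0 \<le> \<eta>" "0 \<le> \<eta>'" "\<eta> \<le> 1"
  shows "good \<epsilon> (\<eta> + \<eta>') K W Z S"
proof -
  obtain S' where S: "S' \<subseteq> T" "cpk \<epsilon> K W Z S'" "profit S' \<ge> (1 - \<eta>) * profit T"
    using assms(1) unfolding good_def by blast
  have "(1 - (\<eta> + \<eta>')) * profit S \<le> (1 - \<eta>) * (1 - \<eta>') * profit S"
    using assms profit_nonneg by (intro mult_right_mono) (auto simp: algebra_simps)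
  also have "\<dots> \<le> (1 - \<eta>) * profit T"
    using assms mult_left_mono[OF assms(4), of "1 - \<eta>"] by (simp add: mult.assoc)
  also have "\<dots> \<le> profit S'" by (rule S(3))
  finally show ?thesis unfolding good_def using S assms(3) by blast
qed

text \<open>The classes of \<open>\<kappa>\<close> partition the profit, so the same relative loss
  in every class is that relative loss in total. Hence the number of boxes affects the number of
  containers but not the profit.\<close>

lemma good_glue:
  fixes \<kappa> :: "item \<Rightarrow> 'k" and bx :: "'k \<Rightarrow> rbox"
  assumes Q: "valid Q"
    and sub: "\<And>j. j \<in> \<kappa> ` Q \<Longrightarrow> boxin (bx j) (0, 0, W, Z)"
    and ap: "\<And>j j'. j \<in> \<kappa> ` Q \<Longrightarrow> j' \<in> \<kappa> ` Q \<Longrightarrow> j \<noteq> j' \<Longrightarrow> apart (bx j) (bx j')"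
    and cp: "\<And>j. j \<in> \<kappa> ` Q \<Longrightarrow>
       case bx j of (x, y, w, h) \<Rightarrow> good \<epsilon> \<eta> K w h {i \<in> Q. \<kappa> i = j}"
    and M: "card (\<kappa> ` Q) \<le> M"
  shows "good \<epsilon> \<eta> (M * K) W Z Q"
proof -
  have fin: "finite Q" using Q by (simp add: valid_def)
  have "\<forall>j\<in>\<kappa> ` Q. \<exists>S'. S' \<subseteq> {i \<in> Q. \<kappa> i = j} \<and>
     cpk \<epsilon> K (fst (snd (snd (bx j)))) (snd (snd (snd (bx j)))) S' \<and>
     profit S' \<ge> (1 - \<eta>) * profit {i \<in> Q. \<kappa> i = j}"
    using cp unfolding good_def by (fastforce simp: case_prod_beta)
  from bchoice[OF this] obtain G where G0: "\<forall>j\<in>\<kappa> ` Q. G j \<subseteq> {i \<in> Q. \<kappa> i = j} \<and>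
     cpk \<epsilon> K (fst (snd (snd (bx j)))) (snd (snd (snd (bx j)))) (G j) \<and>
     profit (G j) \<ge> (1 - \<eta>) * profit {i \<in> Q. \<kappa> i = j}" ..
  have G: "G j \<subseteq> {i \<in> Q. \<kappa> i = j}"
     "cpk \<epsilon> K (fst (snd (snd (bx j)))) (snd (snd (snd (bx j)))) (G j)"
     "profit (G j) \<ge> (1 - \<eta>) * profit {i \<in> Q. \<kappa> i = j}" if "j \<in> \<kappa> ` Q" for j
    using bspec[OF G0 that] by simp_all
  have inG: "\<kappa> x = j" "x \<in> Q" if "j \<in> \<kappa> ` Q" "x \<in> G j" for j x
    using subsetD[OF G(1)[OF that(1)] that(2)] by simp_all
  define Q' where "Q' = (\<Union>j\<in>\<kappa> ` Q. G j)"
  have Q': "Q' \<subseteq> Q" unfolding Q'_def using inG(2) by (intro UN_least subsetI)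
  have cls: "{i \<in> Q'. \<kappa> i = j} = G j" if j: "j \<in> \<kappa> ` Q" for j
  proof (intro set_eqI iffI)
    fix x assume "x \<in> {i \<in> Q'. \<kappa> i = j}"
    then obtain k where "k \<in> \<kappa> ` Q" "x \<in> G k" "\<kappa> x = j" unfolding Q'_def by blast
    then show "x \<in> G j" using inG(1) by metis
  next
    fix x assume "x \<in> G j"
    then show "x \<in> {i \<in> Q'. \<kappa> i = j}" using inG(1)[OF j] j unfolding Q'_def by simp blast
  qed
  have im: "\<kappa> ` Q' \<subseteq> \<kappa> ` Q" using Q' by auto
  have "cpk \<epsilon> (M * K) W Z Q'"
  proof (rule cpk_glue[where \<kappa> = \<kappa> and bx = bx])
    show "finite Q'" using Q' fin finite_subset by blast
    show "card (\<kappa> ` Q') \<le> M" using card_mono[of "\<kappa> ` Q", OF _ im] fin M by (meson finite_imageI le_trans)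
    show "case bx j of (x, y, w, h) \<Rightarrow> cpk \<epsilon> K w h {i \<in> Q'. \<kappa> i = j}" if "j \<in> \<kappa> ` Q'" for j
    proof -
      have "j \<in> \<kappa> ` Q" using that im by blast
      then show ?thesis using G(2)[of j] cls[of j] by (cases "bx j") simp
    qed
    show "boxin (bx j) (0, 0, W, Z)" if "j \<in> \<kappa> ` Q'" for j
      by (rule sub) (use that im in blast)
    show "apart (bx j) (bx j')" if "j \<in> \<kappa> ` Q'" "j' \<in> \<kappa> ` Q'" "j \<noteq> j'" for j j'
      by (rule ap) (use that im in blast)+
  qed
  moreover have "profit Q' = (\<Sum>j\<in>\<kappa> ` Q. profit (G j))"
    unfolding Q'_def profit_def
  proof (rule sum.UNION_disjoint)
    show "\<forall>j\<in>\<kappa> ` Q. finite (G j)" using finite_subset[OF G(1)] fin by simp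
    show "\<forall>j\<in>\<kappa> ` Q. \<forall>k\<in>\<kappa> ` Q. j \<noteq> k \<longrightarrow> G j \<inter> G k = {}" using inG(1) by (metis disjoint_iff)
  qed (use fin in simp)
  moreover have "profit Q = (\<Sum>j\<in>\<kappa> ` Q. profit {i \<in> Q. \<kappa> i = j})"
    unfolding profit_def using fin by (rule sum.image_gen)
  moreover have "(1 - \<eta>) * (\<Sum>j\<in>\<kappa> ` Q. profit {i \<in> Q. \<kappa> i = j}) \<le> (\<Sum>j\<in>\<kappa> ` Q. profit (G j))"
    unfolding sum_distrib_left by (rule sum_mono) (rule G(3))
  ultimately have "cpk \<epsilon> (M * K) W Z Q'" "(1 - \<eta>) * profit Q \<le> profit Q'" by simp_all
  then show ?thesis unfolding good_def using Q' by blast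
qed

subsection \<open>Filling bins\<close>

text \<open>Filling each bin until the next item does not fit wastes at most one item size per bin.\<close>

lemma fill_one:
  fixes s :: "'a \<Rightarrow> real"
  assumes "finite I" "\<And>i. i \<in> I \<Longrightarrow> 0 \<le> s i \<and> s i \<le> \<beta>" "0 \<le> c"
  shows "\<exists>A\<subseteq>I. sum s A \<le> c \<and> (A = I \<or> sum s A > c - \<beta>)"
  using assms
proof (induction I rule: finite_induct)
  case empty
  then show ?case by auto
next
  case (insert x I)
  then obtain A where A: "A \<subseteq> I" "sum s A \<le> c" "A = I \<or> sum s A > c - \<beta>" by auto
  show ?case
  proof (cases "A = I \<and> sum s I + s x \<le> c")
    case True
    then show ?thesis using insert by (intro exI[of _ "insert x I"]) auto
  next
    case False
    have "sum s A > c - \<beta>"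
    proof (cases "A = I")
      case True
      then have "sum s I + s x > c" using False by simp
      then show ?thesis using insert.prems(1)[of x] True by auto
    qed (use A in auto)
    then show ?thesis using A by auto
  qed
qed

lemma fill_bins:
  fixes s :: "'a \<Rightarrow> real" and cap :: "'j \<Rightarrow> real"
  assumes "finite J" "finite I" "\<And>i. i \<in> I \<Longrightarrow> 0 \<le> s i \<and> s i \<le> \<beta>" "\<And>j. j \<in> J \<Longrightarrow> 0 \<le> cap j" "0 \<le> \<beta>"
  shows "\<exists>\<kappa>. (\<forall>j\<in>J. sum s {i \<in> I. \<kappa> i = Some j} \<le> cap j) \<and>
      (\<forall>i\<in>I. \<kappa> i \<in> insert None (Some ` J)) \<and>
      sum s {i \<in> I. \<kappa> i = None} \<le> max 0 (sum s I - sum cap J + real (card J) * \<beta>)"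
  using assms
proof (induction J arbitrary: I rule: finite_induct)
  case empty
  then show ?case by (intro exI[of _ "\<lambda>_. None"]) (auto simp: sum_nonneg)
next
  case (insert j J)
  have "\<exists>A\<subseteq>I. sum s A \<le> cap j \<and> (A = I \<or> sum s A > cap j - \<beta>)"
    by (rule fill_one) (use insert.prems in auto)
  then obtain A where A: "A \<subseteq> I" "sum s A \<le> cap j" "A = I \<or> sum s A > cap j - \<beta>" by blast
  have "\<exists>\<kappa>. (\<forall>j\<in>J. sum s {i \<in> I - A. \<kappa> i = Some j} \<le> cap j) \<and>
      (\<forall>i\<in>I - A. \<kappa> i \<in> Set.insert None (Some ` J)) \<and>
      sum s {i \<in> I - A. \<kappa> i = None} \<le> max 0 (sum s (I - A) - sum cap J + real (card J) * \<beta>)"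
    by (rule insert.IH) (use insert.prems in auto)
  then obtain \<kappa> where \<kappa>: "\<forall>j\<in>J. sum s {i \<in> I - A. \<kappa> i = Some j} \<le> cap j"
     "\<forall>i\<in>I - A. \<kappa> i \<in> Set.insert None (Some ` J)"
     "sum s {i \<in> I - A. \<kappa> i = None} \<le> max 0 (sum s (I - A) - sum cap J + real (card J) * \<beta>)"
    by (elim exE conjE) (rule that; assumption)
  define \<mu> where "\<mu> i = (if i \<in> A then Some j else \<kappa> i)" for i
  have m1: "{i \<in> I. \<mu> i = Some k} = {i \<in> I - A. \<kappa> i = Some k}" if "k \<in> J" for k
    using that insert.hyps by (auto simp: \<mu>_def)
  have "\<kappa> i \<noteq> Some j" if "i \<in> I - A" for i using \<kappa>(2) that insert.hyps by force
  then have m2: "{i \<in> I. \<mu> i = Some j} = A" using A(1) by (auto simp: \<mu>_def)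
  have m3: "{i \<in> I. \<mu> i = None} = {i \<in> I - A. \<kappa> i = None}" by (auto simp: \<mu>_def)
  have d: "sum s (I - A) = sum s I - sum s A" using insert.prems A by (intro sum_diff) auto
  \<comment> \<open>Either the bin is filled beyond \<open>cap j - \<beta>\<close>, which pays for
    its share of the bound, or no item remains; \<open>max 0\<close> covers the latter.\<close>
  have "max 0 (sum s (I - A) - sum cap J + real (card J) * \<beta>) \<le>
      max 0 (sum s I - sum cap (Set.insert j J) + real (card (Set.insert j J)) * \<beta>) \<or> A = I"
    using A(3) insert.hyps by (auto simp: d algebra_simps)
  moreover have "sum s {i \<in> I - A. \<kappa> i = None} = 0" if "A = I" using that by simp
  ultimately have "sum s {i \<in> I. \<mu> i = None} \<le> max 0 (sum s I - sum cap (Set.insert j J) + real (card (Set.insert j J)) * \<beta>)"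
    unfolding m3 using \<kappa>(3) by linarith
  moreover have "\<forall>k\<in>Set.insert j J. sum s {i \<in> I. \<mu> i = Some k} \<le> cap k"
    using m1 m2 A(2) \<kappa>(1) by auto
  moreover have "\<forall>i\<in>I. \<mu> i \<in> Set.insert None (Some ` Set.insert j J)"
    using \<kappa>(2) by (force simp: \<mu>_def)
  ultimately show ?case by blast
qed

text \<open>Consider the subsets of size at most \<open>c\<close> that omit no item with a larger
  key than one they contain, and take one of maximal cardinality. Adding the omitted item of largest
  key would keep the condition on keys, so it must exceed \<open>c\<close>.\<close>

lemma prefix_fill:
  fixes s key :: "'a \<Rightarrow> real"
  assumes fin: "finite I" and s: "\<And>i. i \<in> I \<Longrightarrow> s i \<le> \<beta>" and "0 \<le> c"
  shows "\<exists>A\<subseteq>I. sum s A \<le> c \<and> (\<forall>i\<in>A. \<forall>j\<in>I - A. key j \<le> key i) \<and> (A = I \<or> sum s A > c - \<beta>)"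
proof -
  define \<A> where "\<A> = {A. A \<subseteq> I \<and> sum s A \<le> c \<and> (\<forall>i\<in>A. \<forall>j\<in>I - A. key j \<le> key i)}"
  have e: "{} \<in> \<A>" using assms by (simp add: \<A>_def)
  have finA: "finite \<A>" using fin unfolding \<A>_def by auto
  then have "Max (card ` \<A>) \<in> card ` \<A>" using e by (intro Max_in) auto
  then obtain A where A0: "A \<in> \<A>" "card A = Max (card ` \<A>)" by force
  then have mx: "card B \<le> card A" if "B \<in> \<A>" for B using finA that by auto
  have A: "A \<subseteq> I" "sum s A \<le> c" "\<And>i j. i \<in> A \<Longrightarrow> j \<in> I - A \<Longrightarrow> key j \<le> key i"
    using A0(1) unfolding \<A>_def by auto
  have "sum s A > c - \<beta>" if "A \<noteq> I"
  proof (rule ccontr)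
    assume n: "\<not> sum s A > c - \<beta>"
    have fd: "finite (key ` (I - A))" "key ` (I - A) \<noteq> {}" using fin that A by auto
    obtain m where m: "m \<in> I - A" "key m = Max (key ` (I - A))" using Max_in[OF fd] by force
    have km: "key j \<le> key m" if "j \<in> I - A" for j using that fd m by simp
    have fA: "finite A" using A fin finite_subset by blast
    have "sum s (insert m A) \<le> c" using n m s[of m] fA by auto
    then have "insert m A \<in> \<A>" using A m km unfolding \<A>_def by auto
    then have "card (insert m A) \<le> card A" by (rule mx)
    then show False using m fA by auto
  qed
  then show ?thesis using A by blast
qed

subsection \<open>Next-fit decreasing height\<close>

lemma fits_row:
  assumes S: "valid S" and h: "\<And>i. i \<in> S \<Longrightarrow> placed_height \<phi> i \<le> Z" and w: "(\<Sum>i\<in>S. placed_width \<phi> i) \<le> W"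
  shows "\<exists>\<psi>. fits \<psi> S W Z \<and> (\<forall>i. rotated (\<psi> i) = rotated (\<phi> i))"
proof -
  have pp: "finite S" "\<forall>j\<in>S. 0 \<le> placed_width \<phi> j"
    using S placed_pos(1)[THEN less_imp_le] unfolding valid_def by auto
  obtain f where f: "\<forall>j\<in>S. 0 \<le> f j \<and> f j + placed_width \<phi> j \<le> sum (placed_width \<phi>) S"
     "\<forall>j\<in>S. \<forall>k\<in>S. j \<noteq> k \<longrightarrow> f j + placed_width \<phi> j \<le> f k \<or> f k + placed_width \<phi> k \<le> f j"
    using stack_positions[OF pp] by (elim exE conjE) (rule that; assumption)
  define \<psi> where "\<psi> i = \<lparr>corner_x = f i, corner_y = 0, rotated = rotated (\<phi> i)\<rparr>" for i
  have d: "placed_width \<psi> i = placed_width \<phi> i" "placed_height \<psi> i = placed_height \<phi> i" for i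
    by (auto intro: placed_cong simp: \<psi>_def)
  have p: "pbox \<psi> i = (f i, 0, placed_width \<phi> i, placed_height \<phi> i)" for i
    by (simp add: pbox_def d) (simp add: \<psi>_def)
  have "fits \<psi> S W Z"
    unfolding fits_def p using f w h by (force simp: pairwise_def apart_def)
  then show ?thesis by (intro exI[of _ \<psi>]) (simp add: \<psi>_def)
qed

text \<open>Every shelf but the last is filled up to width \<open>W - \<alpha>\<close> with items at least as high as
  the next shelf.\<close>

lemma shelf_packing:
  assumes "valid S" "\<alpha> < W" "0 \<le> x"
    and "\<And>i. i \<in> S \<Longrightarrow> placed_width \<phi> i \<le> \<alpha> \<and> placed_height \<phi> i \<le> \<beta>"
    and "(\<Sum>i\<in>S. placed_width \<phi> i * placed_height \<phi> i) \<le> (W - \<alpha>) * x" "0 \<le> \<beta>" "0 \<le> \<alpha>"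
  shows "\<exists>\<psi>. fits \<psi> S W (\<beta> + x) \<and> (\<forall>i. rotated (\<psi> i) = rotated (\<phi> i))"
  using assms
proof (induction "card S" arbitrary: S \<beta> x rule: less_induct)
  case less
  note S = less.prems(1)
  have fin: "finite S" using S by (simp add: valid_def)
  have pos: "0 < placed_width \<phi> i" "0 < placed_height \<phi> i" if "i \<in> S" for i
    using S placed_pos that by (auto simp: valid_def)
  show ?case
  proof (cases "sum (placed_width \<phi>) S \<le> W")
    case True
    have "\<exists>\<psi>. fits \<psi> S W \<beta> \<and> (\<forall>i. rotated (\<psi> i) = rotated (\<phi> i))"
      by (rule fits_row[OF S _ True]) (use less.prems(4) in simp)
    then obtain \<psi> where "fits \<psi> S W \<beta>" "\<forall>i. rotated (\<psi> i) = rotated (\<phi> i)" by blast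
    moreover have "boxin b (0,0,W,\<beta>) \<Longrightarrow> boxin b (0,0,W,\<beta> + x)" for b
      using less.prems by (cases b) auto
    ultimately show ?thesis unfolding fits_def by blast
  next
    case False
    have "\<exists>A\<subseteq>S. sum (placed_width \<phi>) A \<le> W \<and>
       (\<forall>i\<in>A. \<forall>j\<in>S - A. placed_height \<phi> j \<le> placed_height \<phi> i) \<and>
       (A = S \<or> sum (placed_width \<phi>) A > W - \<alpha>)"
      by (rule prefix_fill) (use fin less.prems(2,4,7) in auto)
    then obtain A where AS: "A \<subseteq> S" "sum (placed_width \<phi>) A \<le> W"
       "\<And>i j. i \<in> A \<Longrightarrow> j \<in> S - A \<Longrightarrow> placed_height \<phi> j \<le> placed_height \<phi> i"
       "A = S \<or> sum (placed_width \<phi>) A > W - \<alpha>" by blast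
    have ne: "S - A \<noteq> {}" using False AS by auto
    have big: "sum (placed_width \<phi>) A > W - \<alpha>" using AS(4) ne by auto
    \<comment> \<open>\<open>\<beta>'\<close> is the height of the next shelf. All items of
      \<open>A\<close> are at least that high, so \<open>A\<close> has area at least
      \<open>(W - \<alpha>) * \<beta>'\<close>, and the induction hypothesis applies to the rest
      with \<open>x - \<beta>'\<close>. The first shelf takes height \<open>\<beta>\<close>, the
      others take \<open>\<beta>' + (x - \<beta>') = x\<close>.\<close>
    define \<beta>' where "\<beta>' = Max (placed_height \<phi> ` (S - A))"
    have fd: "finite (placed_height \<phi> ` (S - A))" using fin by simp
    obtain m where m: "m \<in> S - A" "placed_height \<phi> m = \<beta>'"
      using Max_in[OF fd] ne unfolding \<beta>'_def by (metis (no_types, lifting) image_is_empty imageE)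
    have mx: "placed_height \<phi> j \<le> \<beta>'" if "j \<in> S - A" for j
      using that fd unfolding \<beta>'_def by simp
    have b0: "0 < \<beta>'" using m pos by force
    have fA: "finite A" using AS fin finite_subset by blast
    have An: "A \<noteq> {}" using big less.prems(2) by auto
    have "(W - \<alpha>) * \<beta>' \<le> sum (placed_width \<phi>) A * \<beta>'"
      using big b0 by (intro mult_right_mono) auto
    also have "\<dots> \<le> (\<Sum>i\<in>A. placed_width \<phi> i * placed_height \<phi> i)"
      unfolding sum_distrib_right
      using AS m pos by (intro sum_mono mult_left_mono) (auto simp: less_imp_le subset_iff)
    finally have a1: "(W - \<alpha>) * \<beta>' \<le> (\<Sum>i\<in>A. placed_width \<phi> i * placed_height \<phi> i)" .
    have sp: "(\<Sum>i\<in>S. placed_width \<phi> i * placed_height \<phi> i) =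
       (\<Sum>i\<in>S - A. placed_width \<phi> i * placed_height \<phi> i) + (\<Sum>i\<in>A. placed_width \<phi> i * placed_height \<phi> i)"
      using AS(1) fin by (rule sum.subset_diff)
    then have a2: "(\<Sum>i\<in>S - A. placed_width \<phi> i * placed_height \<phi> i) \<le> (W - \<alpha>) * (x - \<beta>')"
      using a1 less.prems(5) by (simp add: algebra_simps)
    have "0 \<le> (\<Sum>i\<in>S - A. placed_width \<phi> i * placed_height \<phi> i)"
      using pos by (intro sum_nonneg mult_nonneg_nonneg) (auto simp: less_imp_le)
    then have "0 \<le> (W - \<alpha>) * (x - \<beta>')" using a2 by linarith
    then have xb: "0 \<le> x - \<beta>'" using less.prems(2) by (simp add: zero_le_mult_iff)
    have "card (S - A) < card S" using An AS fin by (metis Diff_subset card_seteq double_diff leI Diff_cancel)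
    moreover have "valid (S - A)" "valid A" using S AS valid_subset by auto
    moreover have "placed_width \<phi> i \<le> \<alpha> \<and> placed_height \<phi> i \<le> \<beta>'" if "i \<in> S - A" for i
      using mx[OF that] less.prems(4)[of i] that by simp
    ultimately have "\<exists>\<psi>. fits \<psi> (S - A) W (\<beta>' + (x - \<beta>')) \<and> (\<forall>i. rotated (\<psi> i) = rotated (\<phi> i))"
      using xb a2 b0 less.prems(2,7) by (intro less.hyps) auto
    then obtain \<psi>1 where p1: "fits \<psi>1 (S - A) W (\<beta>' + (x - \<beta>'))" "\<forall>i. rotated (\<psi>1 i) = rotated (\<phi> i)"
      by blast
    have "\<exists>\<psi>. fits \<psi> A W \<beta> \<and> (\<forall>i. rotated (\<psi> i) = rotated (\<phi> i))"
      by (rule fits_row[OF \<open>valid A\<close> _ AS(2)]) (use less.prems(4) AS(1) in auto)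
    then obtain \<psi>2 where p2: "fits \<psi>2 A W \<beta>" "\<forall>i. rotated (\<psi>2 i) = rotated (\<phi> i)" by blast
    define \<theta> where "\<theta> i = (if i \<in> A then \<psi>2 i else shift_placement 0 \<beta> (\<psi>1 i))" for i
    have q2: "pbox \<theta> i = pbox \<psi>2 i" if "i \<in> A" for i using that by (intro pbox_cong) (simp add: \<theta>_def)
    have q1: "pbox \<theta> i = shift_box 0 \<beta> (pbox \<psi>1 i)" if "i \<notin> A" for i
      using that by (intro pbox_shift) (simp add: \<theta>_def)
    have w2: "boxin (pbox \<theta> i) (0, 0, W, \<beta>)" if "i \<in> A" for i using p2 that by (auto simp: q2 fits_def)
    have w1: "boxin (pbox \<theta> i) (0, \<beta>, W, x)" if "i \<in> S - A" for i
      using p1 that boxin_shift[of 0 \<beta> "pbox \<psi>1 i" "(0,0,W,x)"] by (auto simp: q1 fits_def)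
    have ap: "apart (0, 0, W, \<beta>) (0, \<beta>, W, x)" by (simp add: apart_def)
    have "apart (pbox \<theta> i) (pbox \<theta> j)" if ij: "i \<in> S" "j \<in> S" "i \<noteq> j" for i j
    proof -
      consider "i \<in> A" "j \<in> A" | "i \<in> A" "j \<in> S - A" | "i \<in> S - A" "j \<in> A" | "i \<in> S - A" "j \<in> S - A"
        using ij by auto
      then show ?thesis
      proof cases
        case 1 then show ?thesis using p2 ij by (auto simp: q2 fits_def pairwise_def)
      next
        case 2 then show ?thesis using ap w1 w2 apart_boxin by blast
      next
        case 3 then show ?thesis using ap w1 w2 apart_boxin apart_sym by blast
      next
        case 4 then show ?thesis using p1 ij by (auto simp: q1 fits_def pairwise_def)
      qed
    qed
    moreover have "boxin (pbox \<theta> i) (0, 0, W, \<beta> + x)" if "i \<in> S" for i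
      using w1[of i] w2[of i] that less.prems by (cases "pbox \<theta> i"; cases "i \<in> A") auto
    moreover have "rotated (\<theta> i) = rotated (\<phi> i)" for i using p1 p2 by (simp add: \<theta>_def)
    ultimately show ?thesis unfolding fits_def pairwise_def by blast
  qed
qed

text \<open>Shelves alone would need margins \<open>\<alpha>\<close> and \<open>\<beta>\<close>.
  Dividing them by \<open>\<epsilon>\<close> makes the same condition guarantee granularity:
  \<open>\<alpha> / \<epsilon> < W\<close> gives
  \<open>\<alpha> \<le> \<epsilon> * W\<close>.\<close>

lemma cpk_shelves:
  assumes "valid S" "0 < \<epsilon>" "\<epsilon> \<le> 1" "0 < \<alpha>" "0 < \<beta>" "\<alpha> / \<epsilon> < W" "\<beta> / \<epsilon> < Z"
    and d: "\<And>i. i \<in> S \<Longrightarrow> placed_width \<phi> i \<le> \<alpha> \<and> placed_height \<phi> i \<le> \<beta>"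
    and "(\<Sum>i\<in>S. placed_width \<phi> i * placed_height \<phi> i) \<le> (W - \<alpha> / \<epsilon>) * (Z - \<beta> / \<epsilon>)"
  shows "cpk \<epsilon> 1 W Z S"
proof -
  have a: "\<alpha> \<le> \<alpha> / \<epsilon>" "\<beta> \<le> \<beta> / \<epsilon>" using assms by (auto simp: field_simps)
  have "(W - \<alpha> / \<epsilon>) * (Z - \<beta> / \<epsilon>) \<le> (W - \<alpha>) * (Z - \<beta>)"
    using a assms by (intro mult_mono) auto
  then have "\<exists>\<psi>. fits \<psi> S W (\<beta> + (Z - \<beta>)) \<and> (\<forall>i. rotated (\<psi> i) = rotated (\<phi> i))"
    using a assms(1,4-9) by (intro shelf_packing[where \<alpha> = \<alpha>]) (auto intro: order_trans)
  then obtain \<psi> where p: "fits \<psi> S W Z" "\<forall>i. rotated (\<psi> i) = rotated (\<phi> i)" by auto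
  have "placed_width \<psi> i = placed_width \<phi> i" "placed_height \<psi> i = placed_height \<phi> i" for i
    using p(2) placed_cong by blast+
  moreover have "\<alpha> \<le> \<epsilon> * W" "\<beta> \<le> \<epsilon> * Z" using assms(2,6,7) by (auto simp: field_simps)
  moreover have "0 < W" "0 < Z" using a assms(4-7) by linarith+
  ultimately show ?thesis using order_trans d by (intro cpk_area[OF p(1)]) (simp_all, blast)
qed

subsection \<open>Choosing a scale\<close>

text \<open>The scales are the iterates of \<open>x \<mapsto> min (\<rho> x) (x / 2)\<close>; each parameter of an item lies between
  two consecutive ones at most once.\<close>

lemma scale_gap:
  fixes \<rho> :: "real \<Rightarrow> real"
  assumes \<rho>: "\<And>x. 0 < x \<Longrightarrow> 0 < \<rho> x" and e0: "0 < e0" and \<epsilon>: "0 < \<epsilon>"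
  shows "\<exists>E. finite E \<and> E \<noteq> {} \<and> E \<subseteq> {0<..e0} \<and>
    (\<forall>S fs N. valid S \<and> length fs \<le> r \<longrightarrow>
       (\<exists>a\<in>E. \<exists>b\<in>E. b \<le> \<rho> a \<and> b < a \<and>
          profit {i \<in> S. \<exists>f\<in>set fs. b * N < f i \<and> f i \<le> a * N} \<le> \<epsilon> * profit S))"
proof -
  define e where "e = rec_nat e0 (\<lambda>_ x. min (\<rho> x) (x / 2))"
  have e_Suc: "e (Suc n) = min (\<rho> (e n)) (e n / 2)" and e_0: "e 0 = e0" for n by (auto simp: e_def)
  have epos: "0 < e n" for n by (induction n) (auto simp: e_0 e_Suc e0 \<rho>)
  have dec: "e (Suc n) < e n" for n using epos[of n] by (simp add: e_Suc min_def)
  have anti: "m \<le> n \<Longrightarrow> e n \<le> e m" for m n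
    by (rule lift_Suc_antimono_le) (use dec less_imp_le in auto)
  \<comment> \<open>With more than \<open>r / \<epsilon>\<close> intervals between scales, averaging
    over them loses at most the share \<open>r / m < \<epsilon>\<close>.\<close>
  obtain m :: nat where m: "real r / \<epsilon> < real m" using reals_Archimedean2 by blast
  have m0: "0 < m" using m \<epsilon> by (metis divide_nonneg_pos gr_zeroI not_less of_nat_0 of_nat_0_le_iff)
  show ?thesis
  proof (intro exI[of _ "e ` {..m}"] conjI allI impI)
    show "e ` {..m} \<subseteq> {0<..e0}" using epos anti e_0 by fastforce
    fix S and fs :: "(item \<Rightarrow> real) list" and N :: real
    assume a: "valid S \<and> length fs \<le> r"
    define P where "P t i \<longleftrightarrow> (\<exists>f\<in>set fs. e (Suc t) * N < f i \<and> f i \<le> e t * N)" for t i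
    have "card {t \<in> {..<m}. P t i} \<le> r" for i
    proof -
      have sub: "{t \<in> {..<m}. P t i} \<subseteq> (\<Union>f\<in>set fs. {t. e (Suc t) * N < f i \<and> f i \<le> e t * N})"
        by (auto simp: P_def)
      have lt: False if v: "t < u" "e (Suc t) * N < v" "e (Suc u) * N < v" "v \<le> e u * N" for v t u
      proof -
        \<comment> \<open>The interval for \<open>u\<close> is nonempty and the scales decrease,
          which forces \<open>N\<close> to be positive.\<close>
        have "e (Suc u) * N < e u * N" using v by linarith
        then have N: "0 < N" using dec[of u] by (simp add: mult_less_cancel_right)
        have "e u * N \<le> e (Suc t) * N" using anti[of "Suc t" u] v N by auto
        then show False using v by linarith
      qed
      have uni: "t = u" if "e (Suc t) * N < v" "v \<le> e t * N" "e (Suc u) * N < v" "v \<le> e u * N" for v t u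
        using lt[of t u v] lt[of u t v] that by (cases t u rule: linorder_cases) auto
      have fc: "finite {t. e (Suc t) * N < v \<and> v \<le> e t * N} \<and> card {t. e (Suc t) * N < v \<and> v \<le> e t * N} \<le> 1"
        (is "finite ?X \<and> _") for v
      proof -
        have "\<forall>x\<in>?X. \<forall>y\<in>?X. x = y" using uni by blast
        then have "?X = {} \<or> (\<exists>x. ?X = {x})" by blast
        then show ?thesis by (elim disjE exE) (simp_all only: finite.intros card.empty card_insert_disjoint, simp_all)
      qed
      have "card {t \<in> {..<m}. P t i} \<le> card (\<Union>f\<in>set fs. {t. e (Suc t) * N < f i \<and> f i \<le> e t * N})"
        by (rule card_mono[OF _ sub]) (use fc in auto)
      also have "\<dots> \<le> (\<Sum>f\<in>set fs. card {t. e (Suc t) * N < f i \<and> f i \<le> e t * N})"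
        by (rule card_UN_le) simp
      also have "\<dots> \<le> (\<Sum>f\<in>set fs. 1)" by (rule sum_mono) (use fc in auto)
      also have "\<dots> \<le> r" using a card_length[of fs] by simp
      finally show ?thesis .
    qed
    then obtain t where t: "t < m" "profit {i \<in> S. P t i} \<le> real r / real m * profit S"
      using cheap_index[of S m P r] a m0 by blast
    have "real r / real m * profit S \<le> \<epsilon> * profit S"
      using a m m0 \<epsilon> profit_nonneg by (intro mult_right_mono) (auto simp: field_simps)
    then show "\<exists>a\<in>e ` {..m}. \<exists>b\<in>e ` {..m}. b \<le> \<rho> a \<and> b < a \<and>
          profit {i \<in> S. \<exists>f\<in>set fs. b * N < f i \<and> f i \<le> a * N} \<le> \<epsilon> * profit S"
    proof (intro bexI conjI)
      show "e (Suc t) \<le> \<rho> (e t)" "e (Suc t) < e t" using dec[of t] by (auto simp: e_Suc)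
      show "profit {i \<in> S. \<exists>f\<in>set fs. e (Suc t) * N < f i \<and> f i \<le> e t * N} \<le> \<epsilon> * profit S"
        using t(2) \<open>real r / real m * profit S \<le> \<epsilon> * profit S\<close> unfolding P_def by linarith
    qed (use t in auto)
  qed auto
qed

subsection \<open>Cutting out a cheap strip\<close>

lemma card_le_2_if_close:
  assumes "finite T" "\<And>s t :: nat. s \<in> T \<Longrightarrow> t \<in> T \<Longrightarrow> t \<le> s + 1"
  shows "card T \<le> 2"
proof (cases "T = {}")
  case False
  then have "T \<subseteq> {Min T, Min T + 1}"
  proof -
    have "t = Min T \<or> t = Min T + 1" if "t \<in> T" for t
      using assms(2)[OF Min_in[OF assms(1) False] that] Min_le[OF assms(1) that] by linarith
    then show ?thesis by blast
  qed
  then have "card T \<le> card {Min T, Min T + 1}" by (intro card_mono) auto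
  then show ?thesis by simp
qed simp

text \<open>The band of height \<open>A\<close> above \<open>y0\<close> is divided into
  \<open>k\<close> strips. An item no higher than a strip meets at most two of them, so by averaging
  some strip is met by items of at most a \<open>2 / k\<close> share of the profit. These are
  removed, and everything above the strip moves down.\<close>

lemma cut_strip:
  assumes S: "valid S" and f: "fits \<phi> S W Z" and A: "0 < A" and k: "0 < (k::nat)"
    and flat: "\<And>i. i \<in> S \<Longrightarrow> corner_y (\<phi> i) < y0 + A \<Longrightarrow> y0 < corner_y (\<phi> i) + placed_height \<phi> i \<Longrightarrow>
       placed_height \<phi> i \<le> A / k"
    and y0: "0 \<le> y0" "y0 + A \<le> Z"
  shows "\<exists>S'\<subseteq>S. \<exists>\<psi>. fits \<psi> S' W (Z - A / k) \<and> (\<forall>i. rotated (\<psi> i) = rotated (\<phi> i)) \<and>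
     profit S' \<ge> (1 - 2 / k) * profit S"
proof -
  define a where "a = A / k"
  have a: "0 < a" "a * k = A" using A k by (auto simp: a_def)
  define Y where "Y i = corner_y (\<phi> i)" for i
  define H where "H i = placed_height \<phi> i" for i
  have pos: "0 < H i" if "i \<in> S" for i using S that placed_pos unfolding valid_def H_def by blast
  define P where "P t i \<longleftrightarrow> Y i < y0 + (real t + 1) * a \<and> y0 + real t * a < Y i + H i" for t i
  have "card {t \<in> {..<k}. P t i} \<le> 2" if i: "i \<in> S" for i
  proof (rule card_le_2_if_close)
    fix s t assume st: "s \<in> {t \<in> {..<k}. P t i}" "t \<in> {t \<in> {..<k}. P t i}"
    have "(real s + 1) * a \<le> real k * a" using st a by (intro mult_right_mono) auto
    then have "Y i < y0 + A" "y0 < Y i + H i" using st a pos[OF i] unfolding P_def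
      by (auto simp: algebra_simps intro: le_less_trans[of y0 "y0 + a * real s"])
    then have "H i \<le> a" using flat[OF i] by (simp add: Y_def H_def a_def)
    moreover have "Y i < y0 + (real s + 1) * a" "y0 + real t * a < Y i + H i" using st by (auto simp: P_def)
    ultimately have "real t * a < (real s + 2) * a" by (simp add: algebra_simps)
    then have "real t < real s + 2" using a by simp
    then show "t \<le> s + 1" by linarith
  qed simp
  then obtain t where t: "t < k" "profit {i \<in> S. P t i} \<le> real 2 / real k * profit S"
    using cheap_index[OF S k, of P 2] by blast
  define S' where "S' = S - {i \<in> S. P t i}"
  define z where "z = y0 + real t * a"
  have z: "0 \<le> z" "z + a \<le> Z"
  proof -
    have "(real t + 1) * a \<le> real k * a" using t a by (intro mult_right_mono) auto
    then show "0 \<le> z" "z + a \<le> Z" using a y0 by (auto simp: z_def algebra_simps)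
  qed
  have cs: "Y i + H i \<le> z \<or> z + a \<le> Y i" if "i \<in> S'" for i
    using that by (auto simp: S'_def P_def z_def algebra_simps not_less)
  define \<psi> where "\<psi> i = shift_placement 0 (if z + a \<le> Y i then - a else 0) (\<phi> i)" for i
  have pb: "pbox \<psi> i = shift_box 0 (if z + a \<le> Y i then - a else 0) (pbox \<phi> i)" for i
    by (rule pbox_shift) (simp add: \<psi>_def)
  have pf: "pbox \<phi> i = (corner_x (\<phi> i), Y i, placed_width \<phi> i, H i)" for i
    by (simp add: pbox_def Y_def H_def)
  have inb: "boxin (pbox \<phi> i) (0, 0, W, Z)" if "i \<in> S'" for i using f that by (auto simp: fits_def S'_def)
  have "boxin (pbox \<psi> i) (0, 0, W, Z - a)" if i: "i \<in> S'" for i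
    using inb[OF i] cs[OF i] z a pos[of i] i by (auto simp: pb pf S'_def)
  moreover have "apart (pbox \<psi> i) (pbox \<psi> j)" if ij: "i \<in> S'" "j \<in> S'" "i \<noteq> j" for i j
  proof -
    have ap: "apart (pbox \<phi> i) (pbox \<phi> j)" using f ij by (auto simp: fits_def S'_def pairwise_def)
    show ?thesis
    proof (cases "(z + a \<le> Y i) = (z + a \<le> Y j)")
      case True
      then show ?thesis using ap by (simp add: pb)
    next
      case False
      then show ?thesis using cs[OF ij(1)] cs[OF ij(2)] by (auto simp: pb pf apart_def)
    qed
  qed
  ultimately have "fits \<psi> S' W (Z - a)" unfolding fits_def pairwise_def by blast
  moreover have "profit S' = profit S - profit {i \<in> S. P t i}"
    unfolding S'_def using S by (intro profit_Diff) (auto simp: valid_def)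
  then have "profit S' \<ge> (1 - 2 / k) * profit S" using t(2) by (simp add: algebra_simps)
  moreover have "S' \<subseteq> S" by (auto simp: S'_def)
  moreover have "\<forall>i. rotated (\<psi> i) = rotated (\<phi> i)" by (simp add: \<psi>_def)
  ultimately show ?thesis unfolding a_def by blast
qed

subsection \<open>Slicing\<close>

text \<open>Half-open intervals are disjoint even if they share an endpoint, so their lengths add up
  to the measure of a subset of \<open>{0..W}\<close>.\<close>

lemma separated_intervals_sum_le:
  fixes x w :: "'a \<Rightarrow> real"
  assumes "finite A" "\<And>i. i \<in> A \<Longrightarrow> 0 \<le> w i \<and> 0 \<le> x i \<and> x i + w i \<le> W"
    "\<And>i j. i \<in> A \<Longrightarrow> j \<in> A \<Longrightarrow> i \<noteq> j \<Longrightarrow> x i + w i \<le> x j \<or> x j + w j \<le> x i" "0 \<le> W"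
  shows "sum w A \<le> W"
proof -
  have "measure lborel (\<Union>i\<in>A. {x i..<x i + w i}) = (\<Sum>i\<in>A. measure lborel {x i..<x i + w i})"
  proof (rule measure_finite_Union)
    have "{x i..<x i + w i} \<inter> {x j..<x j + w j} = {}" if "i \<in> A" "j \<in> A" "i \<noteq> j" for i j
      using assms(3)[OF that] by auto
    then show "disjoint_family_on (\<lambda>i. {x i..<x i + w i}) A" unfolding disjoint_family_on_def by blast
  qed (use assms in auto)
  also have "\<dots> = sum w A" using assms by (intro sum.cong) auto
  finally have "sum w A = measure lborel (\<Union>i\<in>A. {x i..<x i + w i})" by simp
  also have "\<dots> \<le> measure lborel {0..W}"
  proof (rule measure_mono_fmeasurable)
    show "(\<Union>i\<in>A. {x i..<x i + w i}) \<subseteq> {0..W}"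
    proof
      fix z assume "z \<in> (\<Union>i\<in>A. {x i..<x i + w i})"
      then obtain i where "i \<in> A" "x i \<le> z" "z < x i + w i" by auto
      then show "z \<in> {0..W}" using assms(2)[of i] by simp
    qed
  qed (use assms in \<open>auto simp: fmeasurable_def\<close>)
  finally show ?thesis using assms by simp
qed

text \<open>\<open>\<mu> A\<close> is the measure of the set of levels at which a horizontal line meets exactly the items of \<open>A\<close>.\<close>

lemma slicing:
  assumes S: "valid S" and f: "fits \<phi> S W Z" and W: "0 \<le> W" "0 \<le> Z"
  shows "\<exists>\<mu>. (\<forall>A. 0 \<le> \<mu> A) \<and> (\<forall>A\<in>Pow S. \<mu> A \<noteq> 0 \<longrightarrow> (\<Sum>i\<in>A. placed_width \<phi> i) \<le> W) \<and>
     sum \<mu> (Pow S) = Z \<and> (\<forall>i\<in>S. sum \<mu> {A \<in> Pow S. i \<in> A} = placed_height \<phi> i)"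
proof -
  have fin: "finite S" using S by (simp add: valid_def)
  define I where "I i = {corner_y (\<phi> i)..<corner_y (\<phi> i) + placed_height \<phi> i}" for i
  define M where "M A = {y \<in> {0..<Z}. {i \<in> S. y \<in> I i} = A}" for A
  define \<mu> where "\<mu> A = measure lborel (M A)" for A
  have box: "0 \<le> corner_x (\<phi> i)" "corner_x (\<phi> i) + placed_width \<phi> i \<le> W"
     "0 \<le> corner_y (\<phi> i)" "corner_y (\<phi> i) + placed_height \<phi> i \<le> Z" if "i \<in> S" for i
    using f that by (auto simp: fits_def pbox_def)
  have pos: "0 < placed_width \<phi> i" "0 < placed_height \<phi> i" if "i \<in> S" for i
    using S that placed_pos unfolding valid_def by blast+
  have "M A \<in> sets borel" if "A \<in> Pow S" for A
  proof -
    have "M A = {0..<Z} \<inter> (\<Inter>i\<in>S. (if i \<in> A then I i else - I i))"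
      using that by (auto simp: M_def split: if_splits)
    also have "\<dots> \<in> sets borel"
    proof (cases "S = {}")
      case False
      then show ?thesis using fin by (intro sets.Int sets.finite_INT) (auto simp: I_def)
    qed simp
    finally show ?thesis .
  qed
  then have Mm: "M ` B \<subseteq> sets lborel" if "B \<subseteq> Pow S" for B using that by auto
  have Mf: "emeasure lborel (M A) \<noteq> \<infinity>" for A
  proof -
    have "emeasure lborel (M A) \<le> emeasure lborel {0..<Z}" by (rule emeasure_mono) (auto simp: M_def)
    also have "\<dots> < \<infinity>" using W by simp
    finally show ?thesis by simp
  qed
  have dj: "disjoint_family_on M B" for B by (auto simp: disjoint_family_on_def M_def)
  have sm: "sum \<mu> B = measure lborel (\<Union>A\<in>B. M A)" if "B \<subseteq> Pow S" for B
    unfolding \<mu>_def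
  proof (rule measure_finite_Union[symmetric])
    show "finite B" by (rule finite_subset[OF that]) (use fin in simp)
  qed (use Mm[OF that] Mf dj in \<open>simp_all\<close>)
  have "(\<Union>A\<in>Pow S. M A) = {0..<Z}" 
  proof (intro equalityI subsetI)
    fix y assume "y \<in> (\<Union>A\<in>Pow S. M A)"
    then show "y \<in> {0..<Z}" unfolding M_def by blast
  next
    fix y assume "y \<in> {0..<Z}"
    then have "y \<in> M {i \<in> S. y \<in> I i}" by (simp add: M_def)
    then show "y \<in> (\<Union>A\<in>Pow S. M A)" by (rule UN_I[rotated]) simp
  qed
  then have 1: "sum \<mu> (Pow S) = Z" using sm[of "Pow S"] W by simp
  have 2: "sum \<mu> {A \<in> Pow S. i \<in> A} = placed_height \<phi> i" if "i \<in> S" for i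
  proof -
    have sub: "I i \<subseteq> {0..<Z}" using box[OF that] by (auto simp: I_def)
    have "(\<Union>A\<in>{A \<in> Pow S. i \<in> A}. M A) = I i"
    proof (intro equalityI subsetI)
      fix y assume y: "y \<in> I i"
      then have "y \<in> M {i \<in> S. y \<in> I i}" using sub by (auto simp: M_def)
      then show "y \<in> (\<Union>A\<in>{A \<in> Pow S. i \<in> A}. M A)" by (rule UN_I[rotated]) (use y that in simp)
    next
      fix y assume "y \<in> (\<Union>A\<in>{A \<in> Pow S. i \<in> A}. M A)"
      then obtain A where "i \<in> A" "{i \<in> S. y \<in> I i} = A" unfolding M_def by blast
      then show "y \<in> I i" by blast
    qed
    then show ?thesis using sm[of "{A \<in> Pow S. i \<in> A}"] pos[OF that] by (auto simp: I_def)
  qed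
  have 3: "(\<Sum>i\<in>A. placed_width \<phi> i) \<le> W" if A: "A \<in> Pow S" "\<mu> A \<noteq> 0" for A
  proof -
    \<comment> \<open>Nonzero measure provides a level \<open>y\<close> at which exactly the items
      of \<open>A\<close> are met. They overlap vertically at \<open>y\<close>, so being apart they
      are separated horizontally.\<close>
    have "M A \<noteq> {}" using A by (auto simp: \<mu>_def)
    then obtain y where y: "A = {i \<in> S. y \<in> I i}" by (auto simp: M_def)
    show ?thesis
    proof (rule separated_intervals_sum_le[where x = "\<lambda>i. corner_x (\<phi> i)"])
      fix i j assume ij: "i \<in> A" "j \<in> A" "i \<noteq> j"
      then have "apart (pbox \<phi> i) (pbox \<phi> j)" "y \<in> I i" "y \<in> I j"
        using f y by (auto simp: fits_def pairwise_def)
      then show "corner_x (\<phi> i) + placed_width \<phi> i \<le> corner_x (\<phi> j) \<or>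
         corner_x (\<phi> j) + placed_width \<phi> j \<le> corner_x (\<phi> i)"
        by (auto simp: apart_def pbox_def I_def)
    next
      show "0 \<le> placed_width \<phi> i \<and> 0 \<le> corner_x (\<phi> i) \<and> corner_x (\<phi> i) + placed_width \<phi> i \<le> W" if "i \<in> A" for i
        using that y pos(1)[of i] box[of i] by auto
      show "finite A" by (rule finite_subset[OF _ fin]) (use A in simp)
    qed (rule W(1))
  qed
  have "0 \<le> \<mu> A" for A by (simp add: \<mu>_def)
  then show ?thesis using 1 2 3 by (intro exI[of _ \<mu>] conjI ballI allI impI) simp_all
qed

text \<open>Double counting of levels and the items they meet. With widths for \<open>f\<close> this
  yields areas, with \<open>1\<close> the total height of a group.\<close>

lemma sum_slices:
  fixes \<mu> :: "item set \<Rightarrow> real"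
  assumes "finite S" "T \<subseteq> S"
  shows "(\<Sum>A\<in>Pow S. \<mu> A * (\<Sum>i\<in>A \<inter> T. f i)) = (\<Sum>i\<in>T. f i * sum \<mu> {A \<in> Pow S. i \<in> A})"
proof -
  have fT: "finite T" using assms finite_subset by blast
  have "(\<Sum>A\<in>Pow S. \<mu> A * (\<Sum>i\<in>A \<inter> T. f i)) = (\<Sum>A\<in>Pow S. \<Sum>i\<in>T. if i \<in> A then f i * \<mu> A else 0)"
  proof (rule sum.cong[OF refl])
    fix A
    have "A \<inter> T = {i \<in> T. i \<in> A}" by auto
    then show "\<mu> A * (\<Sum>i\<in>A \<inter> T. f i) = (\<Sum>i\<in>T. if i \<in> A then f i * \<mu> A else 0)"
      using fT by (simp add: sum.inter_filter[symmetric] sum_distrib_left mult.commute)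
  qed
  also have "\<dots> = (\<Sum>i\<in>T. \<Sum>A\<in>Pow S. if i \<in> A then f i * \<mu> A else 0)" by (rule sum.swap)
  also have "\<dots> = (\<Sum>i\<in>T. f i * sum \<mu> {A \<in> Pow S. i \<in> A})"
  proof (rule sum.cong[OF refl])
    fix i
    have fp: "finite (Pow S)" using assms by simp
    show "(\<Sum>A\<in>Pow S. if i \<in> A then f i * \<mu> A else 0) = f i * sum \<mu> {A \<in> Pow S. i \<in> A}"
      unfolding sum_distrib_left by (rule sum.inter_filter[OF fp, symmetric])
  qed
  finally show ?thesis .
qed

subsection \<open>Linear grouping\<close>

text \<open>Prefixes by decreasing key are split off repeatedly, so group \<open>0\<close> has the
  largest keys. All groups before an occupied one are nearly full. This bounds the number of groups,
  and it lets group \<open>t + 1\<close> take the place of group \<open>t\<close> up to an excess of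
  \<open>\<beta>\<close>.\<close>

lemma linear_grouping:
  fixes s key :: "'a \<Rightarrow> real"
  assumes "finite I" "\<And>i. i \<in> I \<Longrightarrow> s i \<le> \<beta>" "\<beta> \<le> \<theta>" "0 \<le> \<theta>"
  shows "\<exists>g :: 'a \<Rightarrow> nat. (\<forall>i\<in>I. \<forall>j\<in>I. g i < g j \<longrightarrow> key j \<le> key i) \<and>
     (\<forall>t. sum s {i \<in> I. g i = t} \<le> \<theta>) \<and> (\<forall>i\<in>I. \<forall>t<g i. sum s {i \<in> I. g i = t} > \<theta> - \<beta>)"
  using assms
proof (induction "card I" arbitrary: I rule: less_induct)
  case less
  have "\<exists>A\<subseteq>I. sum s A \<le> \<theta> \<and> (\<forall>i\<in>A. \<forall>j\<in>I - A. key j \<le> key i) \<and> (A = I \<or> sum s A > \<theta> - \<beta>)"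
    by (rule prefix_fill) (use less.prems in auto)
  then obtain A where A: "A \<subseteq> I" "sum s A \<le> \<theta>" "\<And>i j. i \<in> A \<Longrightarrow> j \<in> I - A \<Longrightarrow> key j \<le> key i"
    "A = I \<or> sum s A > \<theta> - \<beta>" by blast
  show ?case
  proof (cases "A = I")
    case True
    have "sum s {i \<in> I. 0 = t} \<le> \<theta>" for t :: nat
      using A(2) True less.prems(4) by (cases t) auto
    then show ?thesis by (intro exI[of _ "\<lambda>_. 0"]) simp
  next
    case False
    then have big: "sum s A > \<theta> - \<beta>" using A by auto
    then have "A \<noteq> {}" using less.prems(3) by auto
    then have "I - A \<subset> I" using A(1) by auto
    then have "card (I - A) < card I" using less.prems(1) by (rule psubset_card_mono[rotated])
    then have "\<exists>g :: 'a \<Rightarrow> nat. (\<forall>i\<in>I - A. \<forall>j\<in>I - A. g i < g j \<longrightarrow> key j \<le> key i) \<and>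
       (\<forall>t. sum s {i \<in> I - A. g i = t} \<le> \<theta>) \<and> (\<forall>i\<in>I - A. \<forall>t<g i. sum s {i \<in> I - A. g i = t} > \<theta> - \<beta>)"
      by (rule less.hyps) (use less.prems in auto)
    then obtain g :: "'a \<Rightarrow> nat" where g: "\<And>i j. i \<in> I - A \<Longrightarrow> j \<in> I - A \<Longrightarrow> g i < g j \<Longrightarrow> key j \<le> key i"
      "\<And>t. sum s {i \<in> I - A. g i = t} \<le> \<theta>"
      "\<And>i t. i \<in> I - A \<Longrightarrow> t < g i \<Longrightarrow> sum s {i \<in> I - A. g i = t} > \<theta> - \<beta>" by blast
    define g' where "g' i = (if i \<in> A then 0 else Suc (g i))" for i
    have e0: "{i \<in> I. g' i = 0} = A" using A(1) by (auto simp: g'_def)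
    have eS: "{i \<in> I. g' i = Suc t} = {i \<in> I - A. g i = t}" for t by (auto simp: g'_def)
    have "key j \<le> key i" if "i \<in> I" "j \<in> I" "g' i < g' j" for i j
      using that A(3)[of i j] g(1)[of i j] by (auto simp: g'_def split: if_splits)
    moreover have "sum s {i \<in> I. g' i = t} \<le> \<theta>" for t
      by (cases t) (simp_all only: e0 eS A(2) g(2))
    moreover have "sum s {i \<in> I. g' i = t} > \<theta> - \<beta>" if "i \<in> I" "t < g' i" for i t
    proof (cases t)
      case 0
      then show ?thesis using big by (simp only: e0)
    next
      case (Suc u)
      then have "i \<in> I - A" "u < g i" using that by (auto simp: g'_def split: if_splits)
      then show ?thesis unfolding Suc eS by (rule g(3))
    qed
    ultimately show ?thesis by blast
  qed
qed

section \<open>Area bound and configurations of wide items\<close>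

lemma area_le:
  assumes S: "valid S" and f: "fits \<phi> S W Z" and W: "0 \<le> W" "0 \<le> Z"
  shows "(\<Sum>i\<in>S. placed_width \<phi> i * placed_height \<phi> i) \<le> W * Z"
proof -
  have fin: "finite S" using S by (simp add: valid_def)
  obtain \<mu> where m: "\<forall>A. 0 \<le> \<mu> A" "\<forall>A\<in>Pow S. \<mu> A \<noteq> 0 \<longrightarrow> (\<Sum>i\<in>A. placed_width \<phi> i) \<le> W"
     "sum \<mu> (Pow S) = Z" "\<forall>i\<in>S. sum \<mu> {A \<in> Pow S. i \<in> A} = placed_height \<phi> i"
    using slicing[OF assms] by (elim exE conjE) (rule that; assumption)
  have "(\<Sum>i\<in>S. placed_width \<phi> i * placed_height \<phi> i) = (\<Sum>i\<in>S. placed_width \<phi> i * sum \<mu> {A \<in> Pow S. i \<in> A})"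
    by (rule sum.cong) (use m(4) in simp_all)
  also have "\<dots> = (\<Sum>A\<in>Pow S. \<mu> A * (\<Sum>i\<in>A \<inter> S. placed_width \<phi> i))"
    using sum_slices[OF fin subset_refl, of \<mu> "placed_width \<phi>"] by simp
  also have "\<dots> \<le> (\<Sum>A\<in>Pow S. \<mu> A * W)"
  proof (rule sum_mono)
    fix A assume A: "A \<in> Pow S"
    then have "A \<inter> S = A" by auto
    then show "\<mu> A * (\<Sum>i\<in>A \<inter> S. placed_width \<phi> i) \<le> \<mu> A * W"
      using m(1,2) A by (cases "\<mu> A = 0") (auto intro: mult_left_mono)
  qed
  also have "\<dots> = W * Z" using m(3) by (simp add: sum_distrib_right[symmetric])
  finally show ?thesis .
qed

text \<open>A configuration records how many items of each group a level meets, and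
  \<open>\<Lambda> C\<close> is the measure of the levels with configuration \<open>C\<close>. A
  level has no room for more than \<open>n\<close> wide items, whence the bound on the number of
  configurations. The clause about nonempty groups ensures later that every reserved slot has
  positive width.\<close>

lemma config_slots:
  assumes S: "valid S" and f: "fits \<phi> S W Z" and W: "0 < W" "0 \<le> Z"
    and T: "T \<subseteq> S" and g: "\<And>i. i \<in> T \<Longrightarrow> g i < (q::nat)"
    and wide: "\<And>i. i \<in> T \<Longrightarrow> \<omega> * W < placed_width \<phi> i" and \<omega>: "0 < \<omega>" "1 / \<omega> < real n + 1"
    and a: "\<And>i. i \<in> T \<Longrightarrow> a (g i) \<le> placed_width \<phi> i" "\<And>t. 0 \<le> a t"
  shows "\<exists>(CS :: nat list set) \<Lambda>. finite CS \<and> card CS \<le> (n + 1) ^ q \<and>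
     (\<forall>C\<in>CS. length C = q \<and> 0 \<le> \<Lambda> C \<and> (\<forall>t<q. C ! t \<le> n \<and> (C ! t \<noteq> 0 \<longrightarrow> {i \<in> T. g i = t} \<noteq> {})) \<and>
        (\<Sum>t<q. real (C ! t) * a t) \<le> W) \<and>
     sum \<Lambda> CS = Z \<and> (\<forall>t<q. (\<Sum>C\<in>CS. \<Lambda> C * real (C ! t)) = (\<Sum>i\<in>{i \<in> T. g i = t}. placed_height \<phi> i))"
proof -
  have fin: "finite S" using S by (simp add: valid_def)
  have pos: "0 < placed_width \<phi> i" if "i \<in> S" for i
    using S that placed_pos unfolding valid_def by blast
  obtain \<mu> where m: "\<forall>A. 0 \<le> \<mu> A" "\<forall>A\<in>Pow S. \<mu> A \<noteq> 0 \<longrightarrow> (\<Sum>i\<in>A. placed_width \<phi> i) \<le> W"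
     "sum \<mu> (Pow S) = Z" "\<forall>i\<in>S. sum \<mu> {A \<in> Pow S. i \<in> A} = placed_height \<phi> i"
    using slicing[OF S f less_imp_le[OF W(1)] W(2)] by (elim exE conjE) (rule that; assumption)
  define G where "G t = {i \<in> T. g i = t}" for t
  define P where "P = {A \<in> Pow S. \<mu> A \<noteq> 0}"
  define conf where "conf A = map (\<lambda>t. card (A \<inter> G t)) [0..<q]" for A
  define CS where "CS = conf ` P"
  define \<Lambda> where "\<Lambda> C = sum \<mu> {A \<in> P. conf A = C}" for C
  have finP: "finite P" using fin by (simp add: P_def)
  have nth: "conf A ! t = card (A \<inter> G t)" if "t < q" for A t using that by (simp add: conf_def)
  have finA: "finite A" if "A \<in> P" for A
    by (rule finite_subset[OF _ fin]) (use that in \<open>simp add: P_def\<close>)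
  have PS: "A \<subseteq> S" if "A \<in> P" for A using that by (simp add: P_def)
  have cnt: "(\<Sum>i\<in>A \<inter> T. placed_width \<phi> i) \<le> W" if A: "A \<in> P" for A
  proof -
    have "(\<Sum>i\<in>A \<inter> T. placed_width \<phi> i) \<le> (\<Sum>i\<in>A. placed_width \<phi> i)"
      using finA[OF A] PS[OF A] pos by (intro sum_mono2) (auto intro: less_imp_le)
    also have "\<dots> \<le> W" using A m(2) by (simp add: P_def)
    finally show ?thesis .
  qed
  have cn: "card (A \<inter> G t) \<le> n" if A: "A \<in> P" for A t
  proof -
    have fAT: "finite (A \<inter> T)" using finA[OF A] by simp
    have "real (card (A \<inter> T)) * (\<omega> * W) \<le> (\<Sum>i\<in>A \<inter> T. placed_width \<phi> i)"
      using wide by (intro sum_bounded_below) (auto intro: less_imp_le)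
    also have "\<dots> \<le> W" by (rule cnt[OF A])
    finally have "real (card (A \<inter> T)) * \<omega> \<le> 1" using W(1) by (simp add: mult.assoc[symmetric])
    then have "real (card (A \<inter> T)) \<le> 1 / \<omega>" using \<omega>(1) by (simp add: field_simps)
    then have "card (A \<inter> T) \<le> n" using \<omega>(2) by linarith
    moreover have "card (A \<inter> G t) \<le> card (A \<inter> T)" by (rule card_mono[OF fAT]) (auto simp: G_def)
    ultimately show ?thesis by simp
  qed
  \<comment> \<open>The levels are regrouped by configuration, so that sums over configurations
    become sums over slices.\<close>
  have gen: "(\<Sum>C\<in>CS. \<Lambda> C * F C) = (\<Sum>A\<in>Pow S. \<mu> A * F (conf A))" for F :: "nat list \<Rightarrow> real"
  proof -
    have "(\<Sum>C\<in>CS. \<Lambda> C * F C) = (\<Sum>C\<in>CS. \<Sum>A\<in>{A \<in> P. conf A = C}. \<mu> A * F (conf A))"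
      unfolding \<Lambda>_def sum_distrib_right by (intro sum.cong) auto
    also have "\<dots> = (\<Sum>A\<in>P. \<mu> A * F (conf A))"
      by (rule sum.group) (use finP in \<open>simp_all add: CS_def\<close>)
    also have "\<dots> = (\<Sum>A\<in>Pow S. \<mu> A * F (conf A))"
      using fin by (intro sum.mono_neutral_left) (auto simp: P_def)
    finally show ?thesis .
  qed
  have "CS \<subseteq> {C. set C \<subseteq> {..n} \<and> length C = q}"
    using cn by (auto simp: CS_def conf_def)
  then have "card CS \<le> card {C. set C \<subseteq> {..n} \<and> length C = q}"
    by (rule card_mono[rotated]) (simp add: finite_lists_length_eq)
  then have 2: "card CS \<le> (n + 1) ^ q" by (simp add: card_lists_length_eq)
  have 3: "(\<Sum>t<q. real (C ! t) * a t) \<le> W" if C: "C \<in> CS" for C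
  proof -
    obtain A where A: "A \<in> P" "C = conf A" using C by (auto simp: CS_def)
    have "(\<Sum>t<q. real (C ! t) * a t) = (\<Sum>t<q. \<Sum>i\<in>A \<inter> G t. a t)"
      by (rule sum.cong) (simp_all add: A(2) nth)
    also have "\<dots> \<le> (\<Sum>t<q. \<Sum>i\<in>A \<inter> G t. placed_width \<phi> i)"
      using a(1) by (intro sum_mono) (auto simp: G_def)
    also have "\<dots> = (\<Sum>t<q. \<Sum>i\<in>{i \<in> A \<inter> T. g i = t}. placed_width \<phi> i)"
      by (intro sum.cong) (auto simp: G_def)
    also have "\<dots> = (\<Sum>i\<in>A \<inter> T. placed_width \<phi> i)"
      by (rule sum.group) (use finA[OF A(1)] g in auto)
    also have "\<dots> \<le> W" by (rule cnt[OF A(1)])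
    finally show ?thesis .
  qed
  have 4: "sum \<Lambda> CS = Z" using gen[of "\<lambda>_. 1"] m(3) by simp
  have 5: "(\<Sum>C\<in>CS. \<Lambda> C * real (C ! t)) = (\<Sum>i\<in>{i \<in> T. g i = t}. placed_height \<phi> i)" if t: "t < q" for t
  proof -
    have GS: "G t \<subseteq> S" using T by (auto simp: G_def)
    have "(\<Sum>C\<in>CS. \<Lambda> C * real (C ! t)) = (\<Sum>A\<in>Pow S. \<mu> A * (\<Sum>i\<in>A \<inter> G t. 1))"
      unfolding gen[of "\<lambda>C. real (C ! t)"] nth[OF t] by simp
    also have "\<dots> = (\<Sum>i\<in>G t. 1 * sum \<mu> {A \<in> Pow S. i \<in> A})"
      by (rule sum_slices[OF fin GS])
    also have "\<dots> = (\<Sum>i\<in>G t. placed_height \<phi> i)"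
      using m(4) GS by (intro sum.cong) auto
    finally show ?thesis by (simp only: G_def)
  qed
  have 6: "length C = q \<and> 0 \<le> \<Lambda> C \<and> (\<forall>t<q. C ! t \<le> n \<and> (C ! t \<noteq> 0 \<longrightarrow> {i \<in> T. g i = t} \<noteq> {})) \<and>
        (\<Sum>t<q. real (C ! t) * a t) \<le> W" if C: "C \<in> CS" for C
  proof -
    obtain A where A: "A \<in> P" "C = conf A" using C by (auto simp: CS_def)
    have "C ! t \<le> n \<and> (C ! t \<noteq> 0 \<longrightarrow> {i \<in> T. g i = t} \<noteq> {})" if "t < q" for t
    proof -
      have "G t \<noteq> {}" if "card (A \<inter> G t) \<noteq> 0" using that by auto
      then show ?thesis using cn[OF A(1), of t] unfolding A(2) nth[OF that] G_def[symmetric] by blast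
    qed
    moreover have "0 \<le> \<Lambda> C" using m(1) by (simp add: \<Lambda>_def sum_nonneg)
    moreover have "length C = q" by (simp add: A(2) conf_def)
    ultimately show ?thesis using 3[OF C] by blast
  qed
  have 1: "finite CS" using finP by (simp add: CS_def)
  show ?thesis
    by (rule exI[of _ CS], rule exI[of _ \<Lambda>]) (use 1 2 4 5 6 in simp)
qed

text \<open>Slicing gives a fractional packing of the wide items: a block of height
  \<open>\<Lambda> C\<close> for each configuration, cut into slots. Shifting the groups by one
  makes it integral, narrow items go to the unreserved part of each block, and all leftovers fit
  into the free strip of height \<open>\<eta> * Z\<close>.\<close>

lemma flat_core:
  fixes \<epsilon> \<eta> \<omega> :: real
  assumes \<epsilon>: "0 < \<epsilon>" "\<epsilon> \<le> 1" and \<eta>: "0 < \<eta>" "\<eta> \<le> 1" and \<omega>: "0 < \<omega>"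
  shows "\<exists>\<rho>>0. \<exists>K. \<forall>W Z S \<phi> c \<omega>'. 0 < W \<and> 0 < Z \<and> valid S \<and> fits \<phi> S W ((1 - \<eta>) * Z) \<and>
     0 < \<omega>' \<and> \<omega>' \<le> \<rho> \<and> 0 < c \<and> c \<le> \<rho> \<and>
     (\<forall>i\<in>S. placed_height \<phi> i \<le> c * Z \<and> (\<omega> * W < placed_width \<phi> i \<or> placed_width \<phi> i \<le> \<omega>' * W)) \<longrightarrow>
     cpk \<epsilon> K W Z S"
proof -
  \<comment> \<open>\<open>n\<close> bounds the wide items on a level. \<open>q\<close> bounds the
    groups: the wide items have total height at most \<open>Z / \<omega>\<close>, and each full
    group has more than \<open>\<theta> / 2 = \<eta> * Z / 16\<close>. \<open>Nc\<close> bounds the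
    configurations, and \<open>(D - 1) * c * Z\<close> the height of the leftover wide items. The
    divisor \<open>24\<close> makes each of several error terms at most
    \<open>\<eta> / 24\<close>.\<close>
  define n where "n = nat \<lfloor>1 / \<omega>\<rfloor>"
  define q where "q = nat \<lfloor>16 / (\<omega> * \<eta>)\<rfloor> + 1"
  define Nc where "Nc = (n + 1) ^ q"
  define D where "D = 1 + real q * (1 + real Nc * real n)"
  define \<rho> where "\<rho> = \<epsilon> * \<eta> / (24 * real Nc * D)"
  have n: "1 / \<omega> < real n + 1" using \<omega> by (simp add: n_def)
  have q: "16 / (\<omega> * \<eta>) < real q" using \<omega> \<eta> unfolding q_def by (simp, linarith)
  have Nc1: "1 \<le> real Nc" by (simp add: Nc_def)
  have D1: "1 \<le> D" by (simp add: D_def)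
  have \<rho>0: "0 < \<rho>" using \<epsilon> \<eta> Nc1 D1 by (simp add: \<rho>_def)
  have r1: "real Nc * D * \<rho> = \<epsilon> * \<eta> / 24" using Nc1 D1 by (simp add: \<rho>_def)
  have rN: "real Nc * \<rho> \<le> \<epsilon> * \<eta> / 24"
  proof -
    have "real Nc * \<rho> * 1 \<le> real Nc * \<rho> * D" using D1 Nc1 \<rho>0 by (intro mult_left_mono) auto
    then show ?thesis using r1 by (simp add: mult_ac)
  qed
  have rD: "D * \<rho> \<le> \<epsilon> * \<eta> / 24"
  proof -
    have "1 * (D * \<rho>) \<le> real Nc * (D * \<rho>)" using D1 Nc1 \<rho>0 by (intro mult_right_mono) auto
    then show ?thesis using r1 by (simp add: mult_ac)
  qed
  have "\<epsilon> * \<eta> \<le> 1 * \<eta>" using \<epsilon> \<eta> by (intro mult_right_mono) auto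
  then have e\<eta>: "\<epsilon> * \<eta> \<le> \<eta>" by simp
  have rr: "\<rho> \<le> \<epsilon> * \<eta> / 24" using rN mult_right_mono[OF Nc1 less_imp_le[OF \<rho>0]] by linarith
  \<comment> \<open>\<open>Nc\<close> blocks and the two halves of the free strip; a block has at
    most \<open>q * n\<close> slots and one part for narrow items, each a single container.\<close>
  define K where "K = (Nc + 2) * ((q * n + 1) * 1)"
  have main: "cpk \<epsilon> K W Z S"
    if W: "0 < W" "0 < Z" and S: "valid S" and f: "fits \<phi> S W ((1 - \<eta>) * Z)"
      and \<omega>': "0 < \<omega>'" "\<omega>' \<le> \<rho>" and c: "0 < c" "c \<le> \<rho>"
      and dim: "\<forall>i\<in>S. placed_height \<phi> i \<le> c * Z \<and> (\<omega> * W < placed_width \<phi> i \<or> placed_width \<phi> i \<le> \<omega>' * W)"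
    for W Z S \<phi> c \<omega>'
  proof -
    define pw where "pw = placed_width \<phi>"
    define ph where "ph = placed_height \<phi>"
    define Z' where "Z' = (1 - \<eta>) * Z"
    have Z': "0 \<le> Z'" "Z' + \<eta> * Z = Z" "Z' \<le> Z" using \<eta> W by (auto simp: Z'_def algebra_simps)
    have fin: "finite S" using S by (simp add: valid_def)
    have pos: "0 < pw i" "0 < ph i" if "i \<in> S" for i
      using S that placed_pos unfolding valid_def pw_def ph_def by blast+
    define T where "T = {i \<in> S. \<omega> * W < pw i}"
    define U where "U = S - T"
    have TS: "T \<subseteq> S" "U \<subseteq> S" by (auto simp: T_def U_def)
    have finT: "finite T" "finite U" using fin TS finite_subset by auto
    have Uw: "pw i \<le> \<omega>' * W" if "i \<in> U" for i
      using dim that by (auto simp: U_def T_def pw_def)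
    have hc: "ph i \<le> c * Z" if "i \<in> S" for i using dim that by (simp add: ph_def)
    define \<beta> where "\<beta> = c * Z"
    define \<theta> where "\<theta> = \<eta> * Z / 8"
    have \<beta>0: "0 < \<beta>" using c W by (simp add: \<beta>_def)
    have c\<eta>: "c \<le> \<eta> / 24" using c rr e\<eta> by linarith
    have \<beta>\<theta>: "\<beta> \<le> \<theta> / 2"
    proof -
      have "c * Z \<le> \<eta> / 24 * Z" using c\<eta> W by (intro mult_right_mono) auto
      moreover have "0 \<le> \<eta> * Z" using \<eta> W by simp
      ultimately show ?thesis by (simp add: \<beta>_def \<theta>_def)
    qed
    have \<theta>0: "0 < \<theta>" using \<eta> W by (simp add: \<theta>_def)
    have area: "(\<Sum>i\<in>S. pw i * ph i) \<le> W * Z'"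
      unfolding pw_def ph_def Z'_def by (rule area_le[OF S f]) (use W \<eta> in auto)
    have areaT: "(\<Sum>i\<in>S. pw i * ph i) = (\<Sum>i\<in>T. pw i * ph i) + (\<Sum>i\<in>U. pw i * ph i)"
      unfolding U_def using sum.subset_diff[OF TS(1) fin, of "\<lambda>i. pw i * ph i"] by simp
    have areaU0: "0 \<le> (\<Sum>i\<in>U. pw i * ph i)"
      using pos[THEN less_imp_le] TS by (intro sum_nonneg mult_nonneg_nonneg) auto
    have hT: "sum ph T \<le> Z / \<omega>"
    proof -
      have "\<omega> * W * sum ph T \<le> (\<Sum>i\<in>T. pw i * ph i)"
        unfolding sum_distrib_left using pos by (intro sum_mono mult_right_mono) (auto simp: T_def intro: less_imp_le)
      also have "\<dots> \<le> W * Z" using area areaT areaU0 Z' W mult_left_mono[of Z' Z W] by linarith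
      finally have "W * (\<omega> * sum ph T) \<le> W * Z" by (simp add: mult_ac)
      then have "\<omega> * sum ph T \<le> Z" using W by simp
      then show ?thesis using \<omega> by (simp add: field_simps)
    qed
    have "\<exists>g :: item \<Rightarrow> nat. (\<forall>i\<in>T. \<forall>j\<in>T. g i < g j \<longrightarrow> pw j \<le> pw i) \<and>
       (\<forall>t. sum ph {i \<in> T. g i = t} \<le> \<theta>) \<and> (\<forall>i\<in>T. \<forall>t<g i. sum ph {i \<in> T. g i = t} > \<theta> - \<beta>)"
      by (rule linear_grouping) (use finT hc TS \<beta>\<theta> \<theta>0 in \<open>auto simp: \<beta>_def\<close>)
    then obtain g :: "item \<Rightarrow> nat" where g: "\<forall>i\<in>T. \<forall>j\<in>T. g i < g j \<longrightarrow> pw j \<le> pw i"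
       "\<forall>t. sum ph {i \<in> T. g i = t} \<le> \<theta>" "\<forall>i\<in>T. \<forall>t<g i. sum ph {i \<in> T. g i = t} > \<theta> - \<beta>"
      by (elim exE conjE) (rule that; assumption)
    define G where "G t = {i \<in> T. g i = t}" for t
    define H where "H t = sum ph (G t)" for t
    have GT: "G t \<subseteq> T" and finG: "finite (G t)" for t using finT by (auto simp: G_def)
    have H0: "0 \<le> H t" for t unfolding H_def using pos TS GT by (intro sum_nonneg) (force intro: less_imp_le)
    have H\<theta>: "H t \<le> \<theta>" for t using g(2) by (simp add: H_def G_def)
    have gq: "g i < q" if i: "i \<in> T" for i
    proof -
      have "real (g i) * (\<theta> / 2) = (\<Sum>t<g i. \<theta> / 2)" by simp
      also have "\<dots> \<le> (\<Sum>t<g i. H t)"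
      proof (rule sum_mono)
        fix t assume "t \<in> {..<g i}"
        then have "H t > \<theta> - \<beta>" using g(3) i by (simp add: H_def G_def)
        then show "\<theta> / 2 \<le> H t" using \<beta>\<theta> by linarith
      qed
      also have "\<dots> = sum ph {j \<in> T. g j < g i}"
      proof -
        have "(\<Sum>t<g i. H t) = (\<Sum>t<g i. sum ph {j \<in> {j \<in> T. g j < g i}. g j = t})"
          unfolding H_def by (intro sum.cong) (auto simp: G_def)
        also have "\<dots> = sum ph {j \<in> T. g j < g i}" by (rule sum.group) (use finT in auto)
        finally show ?thesis .
      qed
      also have "\<dots> \<le> sum ph T" using finT pos TS by (intro sum_mono2) (auto intro: less_imp_le)
      also have "\<dots> \<le> Z / \<omega>" by (rule hT)
      finally have "real (g i) * (\<eta> * Z / 16) \<le> Z / \<omega>" by (simp add: \<theta>_def)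
      then have "real (g i) * \<eta> * \<omega> \<le> 16" using W \<omega> by (simp add: field_simps)
      then have "real (g i) \<le> 16 / (\<omega> * \<eta>)" using \<omega> \<eta> by (simp add: field_simps)
      then show ?thesis using q by linarith
    qed
    \<comment> \<open>A slot is as narrow as the narrowest item of its group, so that configurations
      stay within \<open>W\<close>. The default \<open>0\<close> keeps \<open>a\<close> nonnegative;
      no slot belongs to an empty group.\<close>
    define a where "a t = (if G t = {} then 0 else Min (pw ` G t))" for t
    have a_le: "a t \<le> pw i" if "i \<in> G t" for i t using that finG by (auto simp: a_def)
    have a_pos: "0 < a t" if "G t \<noteq> {}" for t
    proof -
      have "Min (pw ` G t) \<in> pw ` G t" using that finG by (intro Min_in) auto
      then show ?thesis using that pos TS GT by (force simp: a_def)
    qed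
    have a0: "0 \<le> a t" for t using a_pos[of t] by (cases "G t = {}") (auto simp: a_def)
    have a_next: "pw i \<le> a t" if i: "i \<in> G (Suc t)" and ne: "G t \<noteq> {}" for i t
    proof -
      have "Min (pw ` G t) \<in> pw ` G t" using ne finG by (intro Min_in) auto
      then obtain j where "j \<in> G t" "a t = pw j" using ne by (auto simp: a_def)
      then show ?thesis using g(1) i by (auto simp: G_def)
    qed
    have "\<exists>(CS :: nat list set) \<Lambda>. finite CS \<and> card CS \<le> (n + 1) ^ q \<and>
       (\<forall>C\<in>CS. length C = q \<and> 0 \<le> \<Lambda> C \<and> (\<forall>t<q. C ! t \<le> n \<and> (C ! t \<noteq> 0 \<longrightarrow> {i \<in> T. g i = t} \<noteq> {})) \<and>
          (\<Sum>t<q. real (C ! t) * a t) \<le> W) \<and>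
       sum \<Lambda> CS = Z' \<and> (\<forall>t<q. (\<Sum>C\<in>CS. \<Lambda> C * real (C ! t)) = (\<Sum>i\<in>{i \<in> T. g i = t}. placed_height \<phi> i))"
    proof (rule config_slots[OF S f[folded Z'_def] W(1) Z'(1) TS(1) gq])
      show "a (g i) \<le> placed_width \<phi> i" if "i \<in> T" for i
        using a_le[of i "g i"] that by (simp add: G_def pw_def)
    qed (use n \<omega> a0 in \<open>auto simp: T_def pw_def\<close>)
    then obtain CS :: "nat list set" and \<Lambda> where CS: "finite CS" "card CS \<le> (n + 1) ^ q"
       and CS2: "\<forall>C\<in>CS. length C = q \<and> 0 \<le> \<Lambda> C \<and> (\<forall>t<q. C ! t \<le> n \<and> (C ! t \<noteq> 0 \<longrightarrow> {i \<in> T. g i = t} \<noteq> {})) \<and>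
          (\<Sum>t<q. real (C ! t) * a t) \<le> W"
       and CS3: "sum \<Lambda> CS = Z'" "\<forall>t<q. (\<Sum>C\<in>CS. \<Lambda> C * real (C ! t)) = (\<Sum>i\<in>{i \<in> T. g i = t}. placed_height \<phi> i)"
      by (elim exE conjE) (rule that; assumption)
    have L0: "0 \<le> \<Lambda> C" if "C \<in> CS" for C using CS2 that by simp
    have Cn: "C ! t \<le> n" "C ! t \<noteq> 0 \<Longrightarrow> G t \<noteq> {}" if "C \<in> CS" "t < q" for C t
      using CS2 that by (auto simp: G_def)
    have Cw: "(\<Sum>t<q. real (C ! t) * a t) \<le> W" if "C \<in> CS" for C using CS2 that by simp
    have CH: "(\<Sum>C\<in>CS. \<Lambda> C * real (C ! t)) = H t" if "t < q" for t
      using CS3(2) that by (simp add: H_def G_def ph_def)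
    have LZ: "\<Lambda> C \<le> Z" if "C \<in> CS" for C
      using member_le_sum[OF that _ CS(1), of \<Lambda>] L0 CS3(1) Z' by auto
    have cardCS: "real (card CS) \<le> real Nc" using CS(2) by (simp add: Nc_def del: of_nat_power of_nat_add)
    (* An item of group t + 1 is no wider than a_t, so it fits into the slots that the configurations
       reserve for group t; group 0 and the leftovers go into the free strip. *)
    define Sl where "Sl t = Sigma CS (\<lambda>C. {..<C ! t})" for t
    have finSl: "finite (Sl t)" for t using CS(1) by (simp add: Sl_def)
    have cardSl: "real (card (Sl t)) \<le> real Nc * real n" if "t < q" for t
    proof -
      have "card (Sl t) = (\<Sum>C\<in>CS. C ! t)" using CS(1) by (simp add: Sl_def)
      also have "\<dots> \<le> (\<Sum>C\<in>CS. n)" using Cn(1) that by (intro sum_mono) auto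
      also have "\<dots> \<le> Nc * n" using CS(2) by (simp add: Nc_def)
      finally show ?thesis by (metis of_nat_le_iff of_nat_mult)
    qed
    have capSl: "(\<Sum>p\<in>Sl t. \<Lambda> (fst p)) = H t" if "t < q" for t
    proof -
      have "(\<Sum>p\<in>Sl t. \<Lambda> (fst p)) = (\<Sum>C\<in>CS. \<Sum>k<C ! t. \<Lambda> C)"
        unfolding Sl_def using CS(1) by (subst sum.Sigma) (auto intro: sum.cong)
      also have "\<dots> = H t" using CH[OF that] by (simp add: mult.commute)
      finally show ?thesis .
    qed
    have "\<forall>t. \<exists>\<kappa>. (\<forall>p\<in>Sl t. sum ph {i \<in> G (Suc t). \<kappa> i = Some p} \<le> \<Lambda> (fst p)) \<and>
        (\<forall>i\<in>G (Suc t). \<kappa> i \<in> insert None (Some ` Sl t)) \<and>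
        sum ph {i \<in> G (Suc t). \<kappa> i = None} \<le>
          max 0 (sum ph (G (Suc t)) - (\<Sum>p\<in>Sl t. \<Lambda> (fst p)) + real (card (Sl t)) * \<beta>)"
    proof
      fix t
      show "\<exists>\<kappa>. (\<forall>p\<in>Sl t. sum ph {i \<in> G (Suc t). \<kappa> i = Some p} \<le> \<Lambda> (fst p)) \<and>
        (\<forall>i\<in>G (Suc t). \<kappa> i \<in> insert None (Some ` Sl t)) \<and>
        sum ph {i \<in> G (Suc t). \<kappa> i = None} \<le>
          max 0 (sum ph (G (Suc t)) - (\<Sum>p\<in>Sl t. \<Lambda> (fst p)) + real (card (Sl t)) * \<beta>)"
      proof (rule fill_bins)
        show "0 \<le> ph i \<and> ph i \<le> \<beta>" if "i \<in> G (Suc t)" for i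
        proof -
          have "i \<in> S" using that GT TS by blast
          then show ?thesis using hc[of i] pos[of i] by (simp add: \<beta>_def less_imp_le)
        qed
        show "0 \<le> \<Lambda> (fst p)" if "p \<in> Sl t" for p using that L0 by (auto simp: Sl_def)
      qed (use finSl finG \<beta>0 in auto)
    qed
    from choice[OF this] obtain F where F:
      "\<And>t p. p \<in> Sl t \<Longrightarrow> sum ph {i \<in> G (Suc t). F t i = Some p} \<le> \<Lambda> (fst p)"
      "\<And>t i. i \<in> G (Suc t) \<Longrightarrow> F t i \<in> insert None (Some ` Sl t)"
      "\<And>t. sum ph {i \<in> G (Suc t). F t i = None} \<le>
          max 0 (sum ph (G (Suc t)) - (\<Sum>p\<in>Sl t. \<Lambda> (fst p)) + real (card (Sl t)) * \<beta>)"
      by blast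
    \<comment> \<open>If group \<open>t + 1\<close> is occupied, group \<open>t\<close> is nearly
      full, so the former exceeds the slots of the latter by at most \<open>\<beta>\<close>. Each
      slot wastes at most another \<open>\<beta>\<close>.\<close>
    have left: "sum ph {i \<in> G (Suc t). F t i = None} \<le> (1 + real Nc * real n) * \<beta>" if t: "t < q" for t
    proof -
      have "H (Suc t) - H t \<le> \<beta>"
      proof (cases "G (Suc t) = {}")
        case True
        then show ?thesis using H0[of t] \<beta>0 by (simp add: H_def)
      next
        case False
        then obtain i where "i \<in> T" "g i = Suc t" by (auto simp: G_def)
        then have "H t > \<theta> - \<beta>" using g(3) by (auto simp: H_def G_def)
        then show ?thesis using H\<theta>[of "Suc t"] by linarith
      qed
      moreover have "real (card (Sl t)) * \<beta> \<le> real Nc * real n * \<beta>"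
        using cardSl[OF t] \<beta>0 by (intro mult_right_mono) auto
      moreover have "0 \<le> real Nc * real n * \<beta>" using \<beta>0 by simp
      ultimately have "max 0 (sum ph (G (Suc t)) - (\<Sum>p\<in>Sl t. \<Lambda> (fst p)) + real (card (Sl t)) * \<beta>)
         \<le> (1 + real Nc * real n) * \<beta>"
        using \<beta>0 unfolding capSl[OF t] H_def[symmetric] by (simp only: distrib_right)
      then show ?thesis using F(3)[of t] by linarith
    qed
    define \<alpha>' where "\<alpha>' = \<omega>' * W / \<epsilon>"
    define \<beta>' where "\<beta>' = c * Z / \<epsilon>"
    \<comment> \<open>\<open>b C\<close> is the unreserved width of the block of \<open>C\<close>,
      and \<open>cap C\<close> is the area of narrow items that \<open>cpk_shelves\<close> accepts
      there, set to \<open>0\<close> if that part is too small for shelves.\<close>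
    define b where "b C = W - (\<Sum>t<q. real (C ! t) * a t)" for C
    define cap where "cap C = (if \<alpha>' < b C \<and> \<beta>' < \<Lambda> C then (b C - \<alpha>') * (\<Lambda> C - \<beta>') else 0)" for C
    have ab: "0 < \<alpha>'" "0 < \<beta>'" using \<omega>' c W \<epsilon> by (auto simp: \<alpha>'_def \<beta>'_def)
    have b0: "0 \<le> b C" "b C \<le> W" if "C \<in> CS" for C
      using Cw[OF that] a0 by (auto simp: b_def intro: sum_nonneg)
    have cap0: "0 \<le> cap C" for C by (simp add: cap_def)
    have cap_ge: "cap C \<ge> b C * \<Lambda> C - (\<alpha>' * Z + \<beta>' * W)" if C: "C \<in> CS" for C
    proof -
      have 1: "\<alpha>' * \<Lambda> C \<le> \<alpha>' * Z" "\<beta>' * b C \<le> \<beta>' * W" using ab LZ[OF C] b0[OF C] by auto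
      have 2: "0 \<le> \<alpha>' * Z" "0 \<le> \<beta>' * W" "0 \<le> \<alpha>' * \<beta>'" using ab W by auto
      have 3: "b C * \<Lambda> C \<le> \<alpha>' * \<Lambda> C" if "b C \<le> \<alpha>'" using that L0[OF C] by (intro mult_right_mono)
      have 4: "b C * \<Lambda> C \<le> \<beta>' * b C" if "\<Lambda> C \<le> \<beta>'" using that b0[OF C] by (simp add: mult.commute[of "b C"] mult_right_mono)
      show ?thesis using 1 2 3 4 by (auto simp: cap_def algebra_simps not_less)
    qed
    \<comment> \<open>The slots have total area at most that of the wide items, because
      \<open>a t\<close> is a minimal width. Wide and narrow items together have area at most
      \<open>W * Z'\<close>, so the unreserved parts suffice for the narrow ones up to
      \<open>\<alpha>' * Z + \<beta>' * W\<close> per block.\<close>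
    have sumcap: "sum cap CS \<ge> (\<Sum>i\<in>U. pw i * ph i) - real Nc * (\<alpha>' * Z + \<beta>' * W)"
    proof -
      have "(\<Sum>C\<in>CS. b C * \<Lambda> C) = W * Z' - (\<Sum>C\<in>CS. \<Sum>t<q. a t * (\<Lambda> C * real (C ! t)))"
        unfolding CS3(1)[symmetric] b_def sum_distrib_left sum_subtractf[symmetric]
        by (rule sum.cong) (simp_all add: algebra_simps sum_distrib_left)
      also have "(\<Sum>C\<in>CS. \<Sum>t<q. a t * (\<Lambda> C * real (C ! t))) = (\<Sum>t<q. \<Sum>C\<in>CS. a t * (\<Lambda> C * real (C ! t)))"
        by (rule sum.swap)
      also have "\<dots> = (\<Sum>t<q. a t * H t)"
        using CH by (intro sum.cong) (auto simp: sum_distrib_left[symmetric])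
      finally have 1: "(\<Sum>C\<in>CS. b C * \<Lambda> C) = W * Z' - (\<Sum>t<q. a t * H t)" .
      have "(\<Sum>t<q. a t * H t) \<le> (\<Sum>t<q. \<Sum>i\<in>G t. pw i * ph i)"
        unfolding H_def sum_distrib_left
      proof (intro sum_mono)
        fix t i assume i: "i \<in> G t"
        then have "i \<in> S" using GT TS by blast
        then show "a t * ph i \<le> pw i * ph i" using a_le[OF i] pos[of i] by (intro mult_right_mono) auto
      qed
      also have "\<dots> = (\<Sum>i\<in>T. pw i * ph i)"
        unfolding G_def by (rule sum.group) (use finT gq in auto)
      finally have "(\<Sum>C\<in>CS. b C * \<Lambda> C) \<ge> (\<Sum>i\<in>U. pw i * ph i)" using 1 area areaT by linarith
      moreover have "(\<Sum>C\<in>CS. b C * \<Lambda> C - (\<alpha>' * Z + \<beta>' * W)) \<le> sum cap CS"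
        by (rule sum_mono) (rule cap_ge)
      moreover have "real (card CS) * (\<alpha>' * Z + \<beta>' * W) \<le> real Nc * (\<alpha>' * Z + \<beta>' * W)"
        using cardCS ab W by (intro mult_right_mono) auto
      ultimately show ?thesis by (simp add: sum_subtractf)
    qed
    define \<gamma> where "\<gamma> = \<omega>' * W * (c * Z)"
    have \<gamma>0: "0 \<le> \<gamma>" using \<omega>' c W by (simp add: \<gamma>_def)
    have "\<exists>\<kappa>. (\<forall>C\<in>CS. (\<Sum>i\<in>{i \<in> U. \<kappa> i = Some C}. pw i * ph i) \<le> cap C) \<and>
        (\<forall>i\<in>U. \<kappa> i \<in> insert None (Some ` CS)) \<and>
        (\<Sum>i\<in>{i \<in> U. \<kappa> i = None}. pw i * ph i) \<le>
          max 0 ((\<Sum>i\<in>U. pw i * ph i) - sum cap CS + real (card CS) * \<gamma>)"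
    proof (rule fill_bins)
      show "0 \<le> pw i * ph i \<and> pw i * ph i \<le> \<gamma>" if "i \<in> U" for i
      proof -
        have "i \<in> S" using that TS by blast
        then show ?thesis using pos[of i] Uw[OF that] hc[of i] \<omega>' W
          by (auto simp: \<gamma>_def intro!: mult_mono intro: less_imp_le)
      qed
    qed (use CS(1) finT cap0 \<gamma>0 in auto)
    then obtain E where E1: "\<And>C. C \<in> CS \<Longrightarrow> (\<Sum>i\<in>{i \<in> U. E i = Some C}. pw i * ph i) \<le> cap C"
      and E2: "\<And>i. i \<in> U \<Longrightarrow> E i \<in> insert None (Some ` CS)"
      and E3: "(\<Sum>i\<in>{i \<in> U. E i = None}. pw i * ph i) \<le>
          max 0 ((\<Sum>i\<in>U. pw i * ph i) - sum cap CS + real (card CS) * \<gamma>)"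
      by blast
    have WZ: "0 < W * Z" using W by simp
    have num: "real Nc * (\<omega>' / \<epsilon>) \<le> \<eta> / 24" "real Nc * (c / \<epsilon>) \<le> \<eta> / 24" "real Nc * (\<omega>' * c) \<le> \<eta> / 24"
    proof -
      have "real Nc * \<omega>' \<le> real Nc * \<rho>" "real Nc * c \<le> real Nc * \<rho>"
        using \<omega>' c Nc1 by (auto intro: mult_left_mono)
      then have o: "real Nc * \<omega>' \<le> \<epsilon> * \<eta> / 24" "real Nc * c \<le> \<epsilon> * \<eta> / 24" using rN by linarith+
      then show "real Nc * (\<omega>' / \<epsilon>) \<le> \<eta> / 24" "real Nc * (c / \<epsilon>) \<le> \<eta> / 24"
        using \<epsilon> by (auto simp: field_simps)
      have "c \<le> 1" using c\<eta> \<eta> by linarith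
      then have "real Nc * \<omega>' * c \<le> real Nc * \<omega>' * 1" using \<omega>' by (intro mult_left_mono) auto
      then show "real Nc * (\<omega>' * c) \<le> \<eta> / 24" using o(1) e\<eta> by (simp add: mult_ac)
    qed
    have leftU: "(\<Sum>i\<in>{i \<in> U. E i = None}. pw i * ph i) \<le> \<eta> / 8 * (W * Z)"
    proof -
      have "real (card CS) * \<gamma> \<le> real Nc * \<gamma>" using cardCS \<gamma>0 by (intro mult_right_mono)
      then have "(\<Sum>i\<in>U. pw i * ph i) - sum cap CS + real (card CS) * \<gamma>
         \<le> real Nc * (\<alpha>' * Z + \<beta>' * W) + real Nc * \<gamma>" using sumcap by linarith
      also have "\<dots> = (real Nc * (\<omega>' / \<epsilon>) + real Nc * (c / \<epsilon>) + real Nc * (\<omega>' * c)) * (W * Z)"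
        by (simp add: \<alpha>'_def \<beta>'_def \<gamma>_def algebra_simps)
      also have "\<dots> \<le> \<eta> / 8 * (W * Z)"
      proof (rule mult_right_mono)
        show "real Nc * (\<omega>' / \<epsilon>) + real Nc * (c / \<epsilon>) + real Nc * (\<omega>' * c) \<le> \<eta> / 8" using num by linarith
      qed (use WZ in simp)
      finally have "max 0 ((\<Sum>i\<in>U. pw i * ph i) - sum cap CS + real (card CS) * \<gamma>) \<le> \<eta> / 8 * (W * Z)"
        using WZ \<eta> by (intro max.boundedI) simp_all
      then show ?thesis using E3 by linarith
    qed
    \<comment> \<open>\<open>Inl C\<close> is the block of \<open>C\<close>; \<open>Inr True\<close>
      and \<open>Inr False\<close> are the halves of the free strip for leftover wide and narrow
      items. Group \<open>0\<close> has no preceding group and goes to the strip as a whole.\<close>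
    define vk where "vk i = (if i \<in> T then (case g i of 0 \<Rightarrow> Inr True | Suc t \<Rightarrow>
       (case F t i of None \<Rightarrow> Inr True | Some p \<Rightarrow> Inl (fst p)))
       else (case E i of None \<Rightarrow> Inr False | Some C \<Rightarrow> Inl C))" for i
    \<comment> \<open>The place inside a block, with \<open>None\<close> for the part of the narrow
      items. A wide item uses a slot of group \<open>g i - 1\<close>; the default \<open>0\<close>
      is only taken by items outside the blocks.\<close>
    define hk where "hk i = (if i \<in> T then Some (g i - 1, (case F (g i - 1) i of None \<Rightarrow> 0 | Some p \<Rightarrow> snd p)) else None)" for i
    define J where "J = Inl ` CS \<union> {Inr True, Inr False :: nat list + bool}"
    define z where "z j = (case j of Inl C \<Rightarrow> \<Lambda> C | Inr _ \<Rightarrow> \<eta> * Z / 2)" for j :: "nat list + bool"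
    have vkT: "i \<in> G (Suc (g i - 1)) \<and> F (g i - 1) i = Some (C, snd (the (hk i))) \<and> (C, snd (the (hk i))) \<in> Sl (g i - 1)"
      if iC: "i \<in> T" "vk i = Inl C" for i C
    proof -
      obtain t where t: "g i = Suc t" using iC by (cases "g i") (auto simp: vk_def)
      have iG: "i \<in> G (Suc t)" using iC t by (simp add: G_def)
      obtain p where p: "F t i = Some p" "fst p = C" using iC t by (auto simp: vk_def split: option.splits)
      have "p \<in> Sl t" using F(2)[OF iG] p by auto
      then show ?thesis using iG p t iC by (cases p) (auto simp: hk_def)
    qed
    have block: "cpk \<epsilon> ((q * n + 1) * 1) W (\<Lambda> C) {i \<in> S. vk i = Inl C}" if C: "C \<in> CS" for C
    proof (rule cpk_hstack[where \<kappa> = hk and J = "Some ` (Sigma {..<q} (\<lambda>t. {..<C ! t})) \<union> {None}"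
        and z = "\<lambda>k. case k of None \<Rightarrow> b C | Some p \<Rightarrow> a (fst p)"])
      show "hk ` {i \<in> S. vk i = Inl C} \<subseteq> Some ` (Sigma {..<q} (\<lambda>t. {..<C ! t})) \<union> {None}"
      proof
        fix y assume "y \<in> hk ` {i \<in> S. vk i = Inl C}"
        then obtain i where i: "y = hk i" "i \<in> S" "vk i = Inl C" by auto
        show "y \<in> Some ` (Sigma {..<q} (\<lambda>t. {..<C ! t})) \<union> {None}"
        proof (cases "i \<in> T")
          case True
          have "snd (the (hk i)) < C ! (g i - 1)" using vkT[OF True i(3)] by (simp add: Sl_def)
          moreover have "g i - 1 < q" using gq[OF True] by simp
          ultimately show ?thesis using True i(1) by (auto simp: hk_def)
        next
          case False
          then show ?thesis using i by (simp add: hk_def)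
        qed
      qed
      have fs: "finite (Sigma {..<q} (\<lambda>t. {..<C ! t}))" by simp
      show "(\<Sum>k\<in>Some ` (Sigma {..<q} (\<lambda>t. {..<C ! t})) \<union> {None}. case k of None \<Rightarrow> b C | Some p \<Rightarrow> a (fst p)) \<le> W"
      proof -
        have "(\<Sum>k\<in>Some ` (Sigma {..<q} (\<lambda>t. {..<C ! t})) \<union> {None}. case k of None \<Rightarrow> b C | Some p \<Rightarrow> a (fst p))
          = (\<Sum>p\<in>Sigma {..<q} (\<lambda>t. {..<C ! t}). a (fst p)) + b C"
          using fs by (subst sum.union_disjoint) (auto simp: sum.reindex)
        also have "(\<Sum>p\<in>Sigma {..<q} (\<lambda>t. {..<C ! t}). a (fst p)) = (\<Sum>t<q. \<Sum>k<C ! t. a t)"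
          by (subst sum.Sigma) (auto intro: sum.cong)
        finally show ?thesis by (simp add: b_def)
      qed
      show "card (Some ` (Sigma {..<q} (\<lambda>t. {..<C ! t})) \<union> {None}) \<le> q * n + 1"
      proof -
        have "card (Some ` (Sigma {..<q} (\<lambda>t. {..<C ! t})) \<union> {None}) \<le> card (Some ` (Sigma {..<q} (\<lambda>t. {..<C ! t}))) + card {None :: (nat \<times> nat) option}"
          by (rule card_Un_le)
        also have "\<dots> \<le> card (Sigma {..<q} (\<lambda>t. {..<C ! t})) + 1" using card_image_le[OF fs, of Some] by simp
        also have "card (Sigma {..<q} (\<lambda>t. {..<C ! t})) = (\<Sum>t<q. C ! t)" by simp
        also have "\<dots> \<le> (\<Sum>t<q. n)" using Cn(1)[OF C] by (intro sum_mono) auto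
        finally show ?thesis by simp
      qed
      fix k assume k: "k \<in> Some ` (Sigma {..<q} (\<lambda>t. {..<C ! t})) \<union> {None}"
      show "0 \<le> (case k of None \<Rightarrow> b C | Some p \<Rightarrow> a (fst p))" using b0[OF C] a0 by (cases k) auto
      have v: "valid {i \<in> {i \<in> S. vk i = Inl C}. hk i = k}" by (rule valid_subset[OF S]) auto
      show "cpk \<epsilon> 1 (case k of None \<Rightarrow> b C | Some p \<Rightarrow> a (fst p)) (\<Lambda> C) {i \<in> {i \<in> S. vk i = Inl C}. hk i = k}"
        (is "cpk _ _ _ _ ?X")
      proof (cases k)
        case None
        have X: "?X = {i \<in> U. E i = Some C}" using None
          by (auto simp: hk_def vk_def U_def split: if_splits option.splits)
        show ?thesis
        proof (cases "\<alpha>' < b C \<and> \<beta>' < \<Lambda> C")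
          case True
          have "(\<Sum>i\<in>?X. pw i * ph i) \<le> (b C - \<alpha>') * (\<Lambda> C - \<beta>')"
            unfolding X using E1[OF C] True by (simp only: cap_def if_True simp_thms)
          then have "cpk \<epsilon> 1 (b C) (\<Lambda> C) ?X"
          proof (intro cpk_shelves[where \<alpha> = "\<omega>' * W" and \<beta> = "c * Z" and \<phi> = \<phi>])
            fix i assume "i \<in> ?X"
            then have "i \<in> U" unfolding X by simp
            then show "placed_width \<phi> i \<le> \<omega>' * W \<and> placed_height \<phi> i \<le> c * Z"
              using Uw[of i] hc[of i] TS by (auto simp: pw_def ph_def)
          qed (use v \<epsilon> \<omega>' c W True in \<open>auto simp: \<alpha>'_def \<beta>'_def pw_def ph_def\<close>)
          then show ?thesis by (simp add: None)
        next
          case False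
          \<comment> \<open>With capacity \<open>0\<close> no item can have been assigned, since
            every item has positive area.\<close>
          then have le0: "(\<Sum>i\<in>?X. pw i * ph i) \<le> 0" unfolding X using E1[OF C] by (simp only: cap_def if_False simp_thms)
          have "?X = {}"
          proof (rule ccontr)
            assume "?X \<noteq> {}"
            then have "0 < (\<Sum>i\<in>?X. pw i * ph i)"
              using pos v by (intro sum_pos) (auto simp: valid_def)
            then show False using le0 by simp
          qed
          then show ?thesis by (simp only: cpk_empty)
        qed
      next
        case (Some p)
        obtain t k' where p: "p = (t, k')" by (cases p)
        have tk: "t < q" "k' < C ! t" using k Some p by auto
        have sub: "?X \<subseteq> {i \<in> G (Suc t). F t i = Some (C, k')}"
        proof
          fix i assume i: "i \<in> ?X"
          then have iT: "i \<in> T" using Some by (auto simp: hk_def split: if_splits)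
          have "vk i = Inl C" "hk i = Some (t, k')" using i Some p by auto
          then show "i \<in> {i \<in> G (Suc t). F t i = Some (C, k')}"
            using vkT[OF iT, of C] iT by (auto simp: hk_def)
        qed
        have mem: "(C, k') \<in> Sl t" using C tk by (simp add: Sl_def)
        have ne: "G t \<noteq> {}" using Cn(2)[OF C tk(1)] tk(2) by auto
        show ?thesis
        proof (cases "?X = {}")
          case True
          then show ?thesis by (simp only: cpk_empty)
        next
          case False
          have finX: "finite ?X" using v by (simp add: valid_def)
          have "sum ph ?X \<le> sum ph {i \<in> G (Suc t). F t i = Some (C, k')}"
          proof (rule sum_mono2[OF _ sub])
            show "finite {i \<in> G (Suc t). F t i = Some (C, k')}" using finG by simp
            fix i assume "i \<in> {i \<in> G (Suc t). F t i = Some (C, k')} - ?X"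
            then have "i \<in> S" using GT TS by blast
            then show "0 \<le> ph i" using pos by (simp add: less_imp_le)
          qed
          also have "\<dots> \<le> \<Lambda> C" using F(1)[OF mem] by simp
          finally have s: "sum ph ?X \<le> \<Lambda> C" .
          moreover have "0 < sum ph ?X" using False finX pos by (intro sum_pos) auto
          ultimately have "0 < \<Lambda> C" by linarith
          have "cpk \<epsilon> 1 (a t) (\<Lambda> C) ?X"
          proof (rule cpk_pile[OF v a_pos[OF ne] \<open>0 < \<Lambda> C\<close>, where \<phi> = \<phi>])
            show "placed_width \<phi> i \<le> a t" if "i \<in> ?X" for i
              using a_next[of i t, OF _ ne] subsetD[OF sub that] by (simp add: pw_def)
          qed (use s in \<open>simp add: ph_def\<close>)
          then show ?thesis by (simp add: Some p)
        qed
      qed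
    qed (use fin in auto)
    have one: "1 \<le> (q * n + 1) * 1" by simp
    show ?thesis unfolding K_def
    proof (rule cpk_vstack[where \<kappa> = vk and J = J and z = z])
      show "finite S" by (rule fin)
      show "finite J" using CS(1) by (simp add: J_def)
      show "vk ` S \<subseteq> J"
      proof
        fix y assume "y \<in> vk ` S"
        then obtain i where i: "y = vk i" "i \<in> S" by auto
        show "y \<in> J"
        proof (cases "\<exists>C. vk i = Inl C")
          case True
          then obtain C where C: "vk i = Inl C" by auto
          have "C \<in> CS"
          proof (cases "i \<in> T")
            case True
            then show ?thesis using vkT[OF True C] by (simp add: Sl_def)
          next
            case False
            then have "i \<in> U" using i by (simp add: U_def)
            then show ?thesis using E2[of i] C False by (auto simp: vk_def split: option.splits)
          qed
          then show ?thesis using C i by (simp add: J_def)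
        next
          case False
          then show ?thesis using i by (cases "vk i") (auto simp: J_def)
        qed
      qed
      show "card J \<le> Nc + 2"
      proof -
        have "card J \<le> card (Inl ` CS :: (nat list + bool) set) + card {Inr True, Inr False :: nat list + bool}"
          unfolding J_def by (rule card_Un_le)
        also have "\<dots> \<le> card CS + 2" using card_image_le[OF CS(1), of "Inl :: _ \<Rightarrow> nat list + bool"] by simp
        finally show ?thesis using CS(2) by (simp add: Nc_def)
      qed
      show "sum z J \<le> Z"
      proof -
        have "sum z J = sum z (Inl ` CS) + sum z {Inr True, Inr False}"
          unfolding J_def using CS(1) by (intro sum.union_disjoint) auto
        also have "\<dots> = sum \<Lambda> CS + \<eta> * Z" by (simp add: sum.reindex z_def o_def)
        finally show ?thesis using CS3(1) Z'(2) by simp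
      qed
      fix j assume j: "j \<in> J"
      show "0 \<le> z j" using j L0 \<eta> W by (auto simp: J_def z_def)
      have v: "valid {i \<in> S. vk i = j}" by (rule valid_subset[OF S]) auto
      have half: "0 < \<eta> * Z / 2" using \<eta> W by simp
      consider C where "j = Inl C" "C \<in> CS" | "j = Inr True" | "j = Inr False" using j by (auto simp: J_def)
      then show "cpk \<epsilon> ((q * n + 1) * 1) W (z j) {i \<in> S. vk i = j}"
      proof cases
        case 1
        then show ?thesis using block by (simp add: z_def)
      next
        case 2
        have sub: "{i \<in> S. vk i = j} \<subseteq> G 0 \<union> (\<Union>t<q. {i \<in> G (Suc t). F t i = None})"
        proof
          fix i assume "i \<in> {i \<in> S. vk i = j}"
          then have i: "i \<in> S" "vk i = Inr True" using 2 by auto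
          have iT: "i \<in> T" using i by (auto simp: vk_def split: if_splits option.splits)
          show "i \<in> G 0 \<union> (\<Union>t<q. {i \<in> G (Suc t). F t i = None})"
          proof (cases "g i")
            case 0
            then show ?thesis using iT by (simp add: G_def)
          next
            case (Suc t)
            then have "F t i = None" "i \<in> G (Suc t)" "t < q"
              using i iT gq[OF iT] by (auto simp: vk_def G_def split: option.splits)
            then show ?thesis by blast
          qed
        qed
        have phS: "0 \<le> ph i" if "i \<in> G t" for i t using that GT TS pos by (meson less_imp_le subsetD)
        have "sum ph {i \<in> S. vk i = j} \<le> sum ph (G 0 \<union> (\<Union>t<q. {i \<in> G (Suc t). F t i = None}))"
        proof (rule sum_mono2[OF _ sub])
          show "finite (G 0 \<union> (\<Union>t<q. {i \<in> G (Suc t). F t i = None}))" using finG by simp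
          fix i assume "i \<in> G 0 \<union> (\<Union>t<q. {i \<in> G (Suc t). F t i = None}) - {i \<in> S. vk i = j}"
          then show "0 \<le> ph i" using phS by blast
        qed
        also have "\<dots> = sum ph (G 0) + sum ph (\<Union>t<q. {i \<in> G (Suc t). F t i = None})"
        proof (rule sum.union_disjoint)
          show "G 0 \<inter> (\<Union>t<q. {i \<in> G (Suc t). F t i = None}) = {}" by (auto simp: G_def)
        qed (use finG in simp_all)
        also have "sum ph (\<Union>t<q. {i \<in> G (Suc t). F t i = None}) = (\<Sum>t<q. sum ph {i \<in> G (Suc t). F t i = None})"
        proof (rule sum.UNION_disjoint)
          show "\<forall>t\<in>{..<q}. \<forall>u\<in>{..<q}. t \<noteq> u \<longrightarrow> {i \<in> G (Suc t). F t i = None} \<inter> {i \<in> G (Suc u). F u i = None} = {}"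
            by (auto simp: G_def)
        qed (use finG in simp_all)
        also have "\<dots> \<le> (\<Sum>t<q. (1 + real Nc * real n) * \<beta>)" using left by (intro sum_mono) auto
        also have "\<dots> = (D - 1) * c * Z" by (simp add: D_def \<beta>_def)
        also have "\<dots> \<le> \<eta> / 24 * Z"
        proof -
          have "(D - 1) * c \<le> D * \<rho>" using c D1 by (intro mult_mono) auto
          then have "(D - 1) * c \<le> \<eta> / 24" using rD e\<eta> by linarith
          then show ?thesis using W by (intro mult_right_mono) auto
        qed
        finally have "sum ph {i \<in> S. vk i = j} \<le> sum ph (G 0) + \<eta> / 24 * Z" by simp
        moreover have "0 \<le> \<eta> * Z" using \<eta> W by simp
        ultimately have s: "sum ph {i \<in> S. vk i = j} \<le> \<eta> * Z / 2" using H\<theta>[of 0] by (simp add: H_def \<theta>_def)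
        have inb: "boxin (pbox \<phi> i) (0, 0, W, (1 - \<eta>) * Z)" if "i \<in> S" for i using f that by (simp add: fits_def)
        have "cpk \<epsilon> 1 W (\<eta> * Z / 2) {i \<in> S. vk i = j}"
        proof (rule cpk_pile[OF v W(1) half, where \<phi> = \<phi>])
          show "placed_width \<phi> i \<le> W" if "i \<in> {i \<in> S. vk i = j}" for i
            using inb[of i] that by (auto simp: pbox_def)
        qed (use s in \<open>simp add: ph_def\<close>)
        then show ?thesis using cpk_mono[OF _ one order_refl order_refl] 2 by (simp add: z_def)
      next
        case 3
        have vT: "vk i \<noteq> Inr False" if "i \<in> T" for i
          using that by (auto simp: vk_def split: option.splits nat.splits)
        have vU: "vk i = Inr False \<longleftrightarrow> E i = None" if "i \<notin> T" for i
          using that by (auto simp: vk_def split: option.splits)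
        have X: "{i \<in> S. vk i = j} = {i \<in> U. E i = None}"
          unfolding 3 U_def using vT vU by blast
        have oe: "\<omega>' / \<epsilon> \<le> 1 / 24" "c / \<epsilon> \<le> \<eta> / 24"
        proof -
          have "\<omega>' \<le> \<epsilon> * \<eta> / 24" "c \<le> \<epsilon> * \<eta> / 24" using \<omega>' c rr by linarith+
          moreover have "\<epsilon> * \<eta> \<le> \<epsilon> * 1" using \<epsilon> \<eta> by (intro mult_left_mono) auto
          ultimately have "\<omega>' \<le> \<epsilon> * (1 / 24)" "c \<le> \<epsilon> * (\<eta> / 24)" by linarith+
          then show "\<omega>' / \<epsilon> \<le> 1 / 24" "c / \<epsilon> \<le> \<eta> / 24" using \<epsilon>(1) by (simp_all add: pos_divide_le_eq mult.commute)
        qed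
        have o1: "\<omega>' * W / \<epsilon> \<le> W / 24" using mult_right_mono[OF oe(1), of W] W by simp
        have o2: "c * Z / \<epsilon> \<le> \<eta> * Z / 24" using mult_right_mono[OF oe(2), of Z] W by simp
        have \<eta>Z: "0 < \<eta> * Z" using \<eta> W by simp
        \<comment> \<open>The half strip is \<open>W\<close> wide and \<open>\<eta> * Z / 2\<close>
          high. The margins of \<open>cpk_shelves\<close> take at most half of each side, which
          leaves exactly the area required by \<open>leftU\<close>.\<close>
        have "\<eta> / 8 * (W * Z) = (W / 2) * (\<eta> * Z / 4)" by simp
        also have "\<dots> \<le> (W - \<omega>' * W / \<epsilon>) * (\<eta> * Z / 2 - c * Z / \<epsilon>)"
        proof (intro mult_mono)
          show "W / 2 \<le> W - \<omega>' * W / \<epsilon>" using o1 W by linarith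
          show "\<eta> * Z / 4 \<le> \<eta> * Z / 2 - c * Z / \<epsilon>" using o2 \<eta>Z by linarith
          show "0 \<le> W - \<omega>' * W / \<epsilon>" using o1 W by linarith
        qed (use \<eta>Z in simp)
        finally have s: "(\<Sum>i\<in>{i \<in> S. vk i = j}. pw i * ph i) \<le> (W - \<omega>' * W / \<epsilon>) * (\<eta> * Z / 2 - c * Z / \<epsilon>)"
          using leftU unfolding X by linarith
        have "cpk \<epsilon> 1 W (\<eta> * Z / 2) {i \<in> S. vk i = j}"
        proof (rule cpk_shelves[where \<alpha> = "\<omega>' * W" and \<beta> = "c * Z" and \<phi> = \<phi>])
          fix i assume "i \<in> {i \<in> S. vk i = j}"
          then have "i \<in> U" unfolding X by simp
          then show "placed_width \<phi> i \<le> \<omega>' * W \<and> placed_height \<phi> i \<le> c * Z"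
            using Uw[of i] hc[of i] TS by (auto simp: pw_def ph_def)
        next
          show "\<omega>' * W / \<epsilon> < W" using o1 W by linarith
          show "c * Z / \<epsilon> < \<eta> * Z / 2" using o2 \<eta>Z by linarith
        qed (use v \<epsilon> \<omega>' c W s in \<open>auto simp: pw_def ph_def\<close>)
        then show ?thesis using cpk_mono[OF _ one order_refl order_refl] 3 by (simp add: z_def)
      qed
    qed
  qed
  show ?thesis
    by (intro exI[of _ \<rho>] conjI \<rho>0 exI[of _ K] allI impI) (elim conjE, rule main; assumption)
qed

text \<open>Two losses prepare for \<open>flat_core\<close>: a share \<open>\<epsilon>\<close> for
  items of medium width, which separates wide from narrow, and a share
  \<open>2 / k \<le> 2 * \<epsilon>\<close> for a free strip of height \<open>Z / k\<close>.\<close>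

lemma flat_box:
  assumes \<epsilon>: "0 < \<epsilon>" "\<epsilon> \<le> 1"
  shows "\<exists>c>0. \<exists>K. \<forall>W Z S. 0 < W \<and> 0 < Z \<and> valid S \<and> fpk (c * Z) W Z S \<longrightarrow> good \<epsilon> (3 * \<epsilon>) K W Z S"
proof -
  define k where "k = nat \<lceil>1 / \<epsilon>\<rceil>"
  have k1: "1 / \<epsilon> \<le> real k" using \<epsilon> by (simp add: k_def)
  have k0: "0 < k" using k1 \<epsilon> by (metis divide_pos_pos gr_zeroI less_numeral_extra(1) not_less of_nat_0)
  have k\<epsilon>: "2 / real k \<le> 2 * \<epsilon>" using k1 k0 \<epsilon> by (simp add: field_simps)
  define \<eta> where "\<eta> = 1 / real k"
  have \<eta>: "0 < \<eta>" "\<eta> \<le> 1" using k0 by (auto simp: \<eta>_def)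
  define Q where "Q \<omega> \<rho> K \<longleftrightarrow> (\<forall>W Z S \<phi> c \<omega>'. 0 < W \<and> 0 < Z \<and> valid S \<and> fits \<phi> S W ((1 - \<eta>) * Z) \<and>
     0 < \<omega>' \<and> \<omega>' \<le> \<rho> \<and> 0 < c \<and> c \<le> \<rho> \<and>
     (\<forall>i\<in>S. placed_height \<phi> i \<le> c * Z \<and> (\<omega> * W < placed_width \<phi> i \<or> placed_width \<phi> i \<le> \<omega>' * W)) \<longrightarrow>
     cpk \<epsilon> K W Z S)" for \<omega> \<rho> K
  have "\<forall>\<omega>. \<exists>p. 0 < \<omega> \<longrightarrow> 0 < fst p \<and> Q \<omega> (fst p) (snd p)"
  proof
    fix \<omega>
    show "\<exists>p. 0 < \<omega> \<longrightarrow> 0 < fst p \<and> Q \<omega> (fst p) (snd p)"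
      using flat_core[OF \<epsilon> \<eta>, of \<omega>] unfolding Q_def by (cases "0 < \<omega>") auto
  qed
  from choice[OF this] obtain P where P: "\<And>\<omega>. 0 < \<omega> \<Longrightarrow> 0 < fst (P \<omega>)" "\<And>\<omega>. 0 < \<omega> \<Longrightarrow> Q \<omega> (fst (P \<omega>)) (snd (P \<omega>))"
    by blast
  obtain E where E: "finite E" "E \<noteq> {}" "E \<subseteq> {0<..1}"
    and sg: "\<forall>S fs N. valid S \<and> length fs \<le> 1 \<longrightarrow>
       (\<exists>a\<in>E. \<exists>b\<in>E. b \<le> fst (P a) \<and> b < a \<and>
          profit {i \<in> S. \<exists>f\<in>set fs. b * N < f i \<and> f i \<le> a * N} \<le> \<epsilon> * profit S)"
  proof -
    have "\<exists>E. finite E \<and> E \<noteq> {} \<and> E \<subseteq> {0<..1} \<and>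
      (\<forall>S fs N. valid S \<and> length fs \<le> 1 \<longrightarrow>
       (\<exists>a\<in>E. \<exists>b\<in>E. b \<le> fst (P a) \<and> b < a \<and>
          profit {i \<in> S. \<exists>f\<in>set fs. b * N < f i \<and> f i \<le> a * N} \<le> \<epsilon> * profit S))"
      by (rule scale_gap) (use P(1) \<epsilon> in simp_all)
    then show ?thesis by (elim exE conjE) (rule that; assumption)
  qed
  \<comment> \<open>The least scale is at most \<open>b\<close>, hence at most
    \<open>fst (P a)\<close>, whichever pair of scales the instance selects. The bound
    \<open>\<eta>\<close> keeps the heights below the height of the strip that is cut.\<close>
  define c where "c = min (Min E) \<eta>"
  define K where "K = Max ((\<lambda>\<omega>. snd (P \<omega>)) ` E)"
  have Ep: "0 < a" if "a \<in> E" for a using E(3) that by auto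
  have c0: "0 < c" using Ep Min_in[OF E(1,2)] \<eta> by (simp add: c_def)
  have cE: "c \<le> a" if "a \<in> E" for a using that E(1) by (simp add: c_def min.coboundedI1)
  have main: "good \<epsilon> (3 * \<epsilon>) K W Z S" if W: "0 < W" "0 < Z" and S: "valid S" and fp: "fpk (c * Z) W Z S" for W Z S
  proof -
    obtain \<phi> where \<phi>: "fits \<phi> S W Z" "\<forall>i\<in>S. placed_height \<phi> i \<le> c * Z" using fp unfolding fpk_def by blast
    obtain a b where ab: "a \<in> E" "b \<in> E" "b \<le> fst (P a)"
      and pr: "profit {i \<in> S. \<exists>f\<in>set [placed_width \<phi>]. b * W < f i \<and> f i \<le> a * W} \<le> \<epsilon> * profit S"
      using sg[rule_format, of S "[placed_width \<phi>]" W] S by auto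
    define M where "M = {i \<in> S. b * W < placed_width \<phi> i \<and> placed_width \<phi> i \<le> a * W}"
    define S1 where "S1 = S - M"
    have S1: "S1 \<subseteq> S" "valid S1" using valid_subset[OF S] by (auto simp: S1_def)
    have p1: "profit S1 \<ge> (1 - \<epsilon>) * profit S"
      using pr profit_Diff[of S M] S by (simp add: S1_def M_def valid_def algebra_simps)
    have "\<exists>S'\<subseteq>S1. \<exists>\<psi>. fits \<psi> S' W (Z - Z / k) \<and> (\<forall>i. rotated (\<psi> i) = rotated (\<phi> i)) \<and>
       profit S' \<ge> (1 - 2 / k) * profit S1"
    proof (rule cut_strip[where ?y0.0 = 0, OF S1(2) fits_subset[OF \<phi>(1) S1(1)] W(2) k0])
      fix i assume "i \<in> S1"
      then have "placed_height \<phi> i \<le> c * Z" using \<phi>(2) S1 by auto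
      also have "\<dots> \<le> \<eta> * Z" using W by (simp add: c_def)
      finally show "placed_height \<phi> i \<le> Z / k" by (simp add: \<eta>_def)
    qed auto
    then obtain S2 \<psi> where S2: "S2 \<subseteq> S1" "fits \<psi> S2 W (Z - Z / k)" "\<forall>i. rotated (\<psi> i) = rotated (\<phi> i)"
      "profit S2 \<ge> (1 - 2 / k) * profit S1" by blast
    have d: "placed_width \<psi> i = placed_width \<phi> i" "placed_height \<psi> i = placed_height \<phi> i" for i
      using S2(3) placed_cong by blast+
    have vS2: "valid S2" by (rule valid_subset[OF S1(2) S2(1)])
    have "cpk \<epsilon> (snd (P a)) W Z S2"
    proof (rule P(2)[OF Ep[OF ab(1)], unfolded Q_def, rule_format, of W Z S2 \<psi> b c], intro conjI)
      show "fits \<psi> S2 W ((1 - \<eta>) * Z)" using S2(2) by (simp add: \<eta>_def algebra_simps)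
      show "c \<le> fst (P a)" using cE[OF ab(2)] ab(3) by linarith
      show "\<forall>i\<in>S2. placed_height \<psi> i \<le> c * Z \<and> (a * W < placed_width \<psi> i \<or> placed_width \<psi> i \<le> b * W)"
      proof
        fix i assume "i \<in> S2"
        then have "i \<in> S" "i \<notin> M" using S2(1) by (auto simp: S1_def)
        then show "placed_height \<psi> i \<le> c * Z \<and> (a * W < placed_width \<psi> i \<or> placed_width \<psi> i \<le> b * W)"
          using \<phi>(2) by (auto simp: d M_def)
      qed
    qed (use W vS2 Ep[OF ab(2)] ab c0 in simp_all)
    moreover have "snd (P a) \<le> K" unfolding K_def using E(1) ab(1) by (intro Max_ge) auto
    ultimately have "cpk \<epsilon> K W Z S2" by (rule cpk_mono) simp_all
    then have "good \<epsilon> 0 K W Z S2" unfolding good_def by auto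
    then have "good \<epsilon> (0 + 2 / k) K W Z S1"
      by (rule good_subset[OF _ S1(2) S2(1) S2(4)]) simp_all
    then have "good \<epsilon> (2 * \<epsilon>) K W Z S1"
      by (rule good_mono) (use S1 k\<epsilon> in simp_all)
    then show ?thesis
    proof (cases "2 * \<epsilon> \<le> 1")
      case True
      have "good \<epsilon> (2 * \<epsilon> + \<epsilon>) K W Z S"
        by (rule good_subset[OF \<open>good \<epsilon> (2 * \<epsilon>) K W Z S1\<close> S S1(1) p1]) (use True \<epsilon> in simp_all)
      then show ?thesis by simp
    next
      case False
      \<comment> \<open>For \<open>2 * \<epsilon> > 1\<close> the required profit is not positive
        and the empty set is enough.\<close>
      then have "(1 - 3 * \<epsilon>) * profit S \<le> 0" using profit_nonneg[OF S] by (intro mult_nonpos_nonneg) simp_all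
      then show ?thesis unfolding good_def by (intro exI[of _ "{}"]) (simp add: profit_def)
    qed
  qed
  show ?thesis
    by (intro exI[of _ c] conjI c0 exI[of _ K] allI impI) (elim conjE, rule main; assumption)
qed

subsection \<open>Gaps between blockers\<close>

text \<open>The gap around an interval from \<open>u\<close> to \<open>v\<close> extends to the
  nearest blockers, with \<open>0\<close> and \<open>N\<close> as default ends. A degenerate blocker
  \<open>(t, t)\<close> acts as a cut at \<open>t\<close>.\<close>

definition gap_lo :: "(real \<times> real) set \<Rightarrow> real \<Rightarrow> real" where
  "gap_lo B u = Max (insert 0 {q. \<exists>p. (p, q) \<in> B \<and> q \<le> u})"

definition gap_hi :: "real \<Rightarrow> (real \<times> real) set \<Rightarrow> real \<Rightarrow> real" where
  "gap_hi N B v = Min (insert N {p. \<exists>q. (p, q) \<in> B \<and> v \<le> p})"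

lemma gap_lo_in: "finite B \<Longrightarrow> gap_lo B u \<in> insert 0 (snd ` B)"
  and gap_hi_in: "finite B \<Longrightarrow> gap_hi N B v \<in> insert N (fst ` B)"
proof -
  assume B: "finite B"
  have "{q. \<exists>p. (p, q) \<in> B \<and> q \<le> u} \<subseteq> snd ` B" by force
  moreover have "finite {q. \<exists>p. (p, q) \<in> B \<and> q \<le> u}"
    by (rule finite_subset[OF calculation]) (use B in simp)
  ultimately show "gap_lo B u \<in> insert 0 (snd ` B)"
    using Max_in[of "insert 0 {q. \<exists>p. (p, q) \<in> B \<and> q \<le> u}"] unfolding gap_lo_def by blast
next
  assume B: "finite B"
  have "{p. \<exists>q. (p, q) \<in> B \<and> v \<le> p} \<subseteq> fst ` B" by force
  moreover have "finite {p. \<exists>q. (p, q) \<in> B \<and> v \<le> p}"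
    by (rule finite_subset[OF calculation]) (use B in simp)
  ultimately show "gap_hi N B v \<in> insert N (fst ` B)"
    using Min_in[of "insert N {p. \<exists>q. (p, q) \<in> B \<and> v \<le> p}"] unfolding gap_hi_def by blast
qed

definition gap_ok :: "real \<Rightarrow> (real \<times> real) set \<Rightarrow> real \<Rightarrow> real \<Rightarrow> bool" where
  "gap_ok N B u v \<longleftrightarrow> finite B \<and> 0 \<le> u \<and> u < v \<and> v \<le> N \<and> (\<forall>(p, q)\<in>B. p \<le> q \<and> (q \<le> u \<or> v \<le> p))"

lemma gap_bounds:
  assumes "gap_ok N B u v"
  shows "0 \<le> gap_lo B u" "gap_lo B u \<le> u" "v \<le> gap_hi N B v" "gap_hi N B v \<le> N"
    "\<And>p q. (p, q) \<in> B \<Longrightarrow> q \<le> gap_lo B u \<or> gap_hi N B v \<le> p"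
proof -
  have B: "finite B" using assms by (simp add: gap_ok_def)
  have f1: "finite {q. \<exists>p. (p, q) \<in> B \<and> q \<le> u}"
    by (rule finite_subset[of _ "snd ` B"]) (use B in force)+
  have f2: "finite {p. \<exists>q. (p, q) \<in> B \<and> v \<le> p}"
    by (rule finite_subset[of _ "fst ` B"]) (use B in force)+
  show "0 \<le> gap_lo B u" unfolding gap_lo_def using f1 by (intro Max_ge) auto
  show "gap_lo B u \<le> u" unfolding gap_lo_def using f1 assms by (subst Max_le_iff) (auto simp: gap_ok_def)
  show "v \<le> gap_hi N B v" unfolding gap_hi_def using f2 assms by (subst Min_ge_iff) (auto simp: gap_ok_def)
  show "gap_hi N B v \<le> N" unfolding gap_hi_def using f2 by (intro Min_le) auto
  fix p q assume pq: "(p, q) \<in> B"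
  then have "q \<le> u \<or> v \<le> p" using assms by (auto simp: gap_ok_def)
  then show "q \<le> gap_lo B u \<or> gap_hi N B v \<le> p"
  proof
    assume "q \<le> u"
    then have "q \<le> gap_lo B u" unfolding gap_lo_def using f1 pq by (intro Max_ge) auto
    then show ?thesis ..
  next
    assume "v \<le> p"
    then have "gap_hi N B v \<le> p" unfolding gap_hi_def using f2 pq by (intro Min_le) auto
    then show ?thesis ..
  qed
qed

text \<open>An end of a gap is \<open>0\<close>, \<open>N\<close> or an end of a blocker, and by
  \<open>gap_bounds\<close> no blocker reaches into the other gap. This makes gaps usable as
  disjoint boxes.\<close>

lemma gap_eq_or_separated:
  assumes g: "gap_ok N B u v" and g': "gap_ok N B u' v'"
  shows "gap_lo B u = gap_lo B u' \<and> gap_hi N B v = gap_hi N B v' \<or>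
     gap_hi N B v \<le> gap_lo B u' \<or> gap_hi N B v' \<le> gap_lo B u"
proof -
  have B: "finite B" using g by (simp add: gap_ok_def)
  have le: "p \<le> q" if "(p, q) \<in> B" for p q using g that by (auto simp: gap_ok_def)
  have lo: "gap_lo B u' \<le> gap_lo B u \<or> gap_hi N B v \<le> gap_lo B u'"
    if g: "gap_ok N B u v" and g': "gap_ok N B u' v'" for u v u' v'
  proof (cases "gap_lo B u' = 0")
    case True
    then show ?thesis using gap_bounds(1)[OF g] by simp
  next
    case False
    then obtain p where "(p, gap_lo B u') \<in> B" using gap_lo_in[OF B, of u'] by force
    then show ?thesis using gap_bounds(5)[OF g] le by fastforce
  qed
  have hi: "gap_hi N B v \<le> gap_hi N B v' \<or> gap_hi N B v' \<le> gap_lo B u"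
    if g: "gap_ok N B u v" and g': "gap_ok N B u' v'" for u v u' v'
  proof (cases "gap_hi N B v' = N")
    case True
    then show ?thesis using gap_bounds(4)[OF g] by simp
  next
    case False
    then obtain q where "(gap_hi N B v', q) \<in> B" using gap_hi_in[OF B, of N v'] by force
    then show ?thesis using gap_bounds(5)[OF g] le by fastforce
  qed
  show ?thesis using lo[OF g g'] lo[OF g' g] hi[OF g g'] hi[OF g' g] by linarith
qed

subsection \<open>Items that are flat relative to the rows of a grid\<close>

lemma fpk_crossing:
  assumes ap: "pairwise (\<lambda>i j. apart (pbox \<phi> i) (pbox \<phi> j)) X"
    and x: "\<And>i. i \<in> X \<Longrightarrow> lo \<le> corner_x (\<phi> i) \<and> corner_x (\<phi> i) + placed_width \<phi> i \<le> hi"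
    and y: "\<And>i. i \<in> X \<Longrightarrow> corner_y (\<phi> i) < t \<and> t < corner_y (\<phi> i) + placed_height \<phi> i"
    and h: "\<And>i. i \<in> X \<Longrightarrow> placed_height \<phi> i \<le> \<beta>"
  shows "fpk \<beta> (hi - lo) \<beta> X"
proof -
  define \<xi> where "\<xi> i = \<lparr>corner_x = corner_x (\<phi> i) - lo, corner_y = 0, rotated = rotated (\<phi> i)\<rparr>" for i
  have d: "placed_width \<xi> i = placed_width \<phi> i" "placed_height \<xi> i = placed_height \<phi> i" for i
    by (auto intro: placed_cong simp: \<xi>_def)
  have pb: "pbox \<xi> i = (corner_x (\<phi> i) - lo, 0, placed_width \<phi> i, placed_height \<phi> i)" for i
    by (simp add: pbox_def d) (simp add: \<xi>_def)
  show ?thesis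
    unfolding fpk_def fits_def
  proof (intro exI[of _ \<xi>] conjI ballI pairwiseI)
    fix i assume i: "i \<in> X"
    show "boxin (pbox \<xi> i) (0, 0, hi - lo, \<beta>)" using x[OF i] h[OF i] by (simp add: pb)
    show "placed_height \<xi> i \<le> \<beta>" using h[OF i] by (simp add: d)
  next
    fix i j assume ij: "i \<in> X" "j \<in> X" "i \<noteq> j"
    then have "apart (pbox \<phi> i) (pbox \<phi> j)" using ap by (simp add: pairwise_def)
    then show "apart (pbox \<xi> i) (pbox \<xi> j)"
      using y[OF ij(1)] y[OF ij(2)] unfolding pb by (auto simp: apart_def pbox_def)
  qed
qed

text \<open>The items that start in the row from \<open>a\<close> to \<open>b\<close> but end above
  it form one layer of height at most \<open>c * (b - a)\<close>, by \<open>fpk_crossing\<close>. As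
  \<open>c \<le> 1 / k\<close>, a strip of height \<open>(b - a) / k\<close> cut out of the other
  items makes room for the layer.\<close>

lemma absorb_crossing:
  assumes Q: "valid Q" and ap: "pairwise (\<lambda>i j. apart (pbox \<phi> i) (pbox \<phi> j)) Q"
    and x: "\<And>i. i \<in> Q \<Longrightarrow> lo \<le> corner_x (\<phi> i) \<and> corner_x (\<phi> i) + placed_width \<phi> i \<le> hi"
    and y: "\<And>i. i \<in> Q \<Longrightarrow> a \<le> corner_y (\<phi> i) \<and> corner_y (\<phi> i) < b"
    and h: "\<And>i. i \<in> Q \<Longrightarrow> placed_height \<phi> i \<le> c * (b - a)"
    and k: "0 < (k::nat)" "c \<le> 1 / k" "0 < c" and abl: "a < b"
  shows "\<exists>Q'\<subseteq>Q. fpk (c * (b - a)) (hi - lo) (b - a) Q' \<and> profit Q' \<ge> (1 - 2 / k) * profit Q"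
proof -
  define X where "X = {i \<in> Q. b < corner_y (\<phi> i) + placed_height \<phi> i}"
  define D where "D = Q - X"
  have XQ: "X \<subseteq> Q" "D \<subseteq> Q" by (auto simp: X_def D_def)
  have vD: "valid D" "valid X" using valid_subset[OF Q] XQ by auto
  have "fpk (c * (b - a)) (hi - lo) (b - a) D"
  proof (rule fpk_shiftI[where x = lo and y = a and \<phi> = \<phi>])
    show "pairwise (\<lambda>i j. apart (pbox \<phi> i) (pbox \<phi> j)) D" using ap XQ(2) by (rule pairwise_subset)
    fix i assume i: "i \<in> D"
    then have iQ: "i \<in> Q" using XQ by blast
    show "boxin (pbox \<phi> i) (lo, a, hi - lo, b - a)"
      using x[OF iQ] y[OF iQ] i by (auto simp: pbox_def D_def X_def)
    show "placed_height \<phi> i \<le> c * (b - a)" by (rule h[OF iQ])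
  qed
  then obtain \<psi> where \<psi>: "fits \<psi> D (hi - lo) (b - a)" "\<forall>i\<in>D. placed_height \<psi> i \<le> c * (b - a)"
    unfolding fpk_def by blast
  have "\<exists>S'\<subseteq>D. \<exists>\<theta>. fits \<theta> S' (hi - lo) ((b - a) - (b - a) / k) \<and> (\<forall>i. rotated (\<theta> i) = rotated (\<psi> i)) \<and>
       profit S' \<ge> (1 - 2 / k) * profit D"
  proof (rule cut_strip[where ?y0.0 = 0, OF vD(1) \<psi>(1)])
    fix i assume "i \<in> D"
    then have "placed_height \<psi> i \<le> c * (b - a)" using \<psi>(2) by simp
    also have "\<dots> \<le> 1 / k * (b - a)" using k abl by (intro mult_right_mono) auto
    finally show "placed_height \<psi> i \<le> (b - a) / k" by simp
  qed (use k abl in auto)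
  then obtain D' \<theta> where D': "D' \<subseteq> D" "fits \<theta> D' (hi - lo) ((b - a) - (b - a) / k)"
    "\<forall>i. rotated (\<theta> i) = rotated (\<psi> i)" "profit D' \<ge> (1 - 2 / k) * profit D" by blast
  have hD': "placed_height \<theta> i \<le> c * (b - a)" if "i \<in> D'" for i
    using \<psi>(2) D'(1) that placed_cong(2)[of \<theta> i \<psi>] D'(3) by auto
  have f1: "fpk (c * (b - a)) (hi - lo) ((b - a) - (b - a) / k) D'" unfolding fpk_def using D'(2) hD' by blast
  have f2: "fpk (c * (b - a)) (hi - lo) (c * (b - a)) X"
  proof (rule fpk_crossing[where \<phi> = \<phi> and t = b])
    show "pairwise (\<lambda>i j. apart (pbox \<phi> i) (pbox \<phi> j)) X" using ap XQ(1) by (rule pairwise_subset)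
  qed (use x y h in \<open>auto simp: X_def\<close>)
  have "(b - a) / k \<le> (b - a) / 1" using k(1) abl by (intro divide_left_mono) auto
  then have "(b - a) / k \<le> b - a" by simp
  then have "fpk (c * (b - a)) (hi - lo) (((b - a) - (b - a) / k) + c * (b - a)) (D' \<union> X)"
    using k abl by (intro fpk_stack[OF f1 f2]) auto
  moreover have "c * (b - a) \<le> 1 / k * (b - a)" using k abl by (intro mult_right_mono) auto
  ultimately have "fpk (c * (b - a)) (hi - lo) (b - a) (D' \<union> X)"
    by (elim fpk_mono) auto
  moreover have "profit (D' \<union> X) \<ge> (1 - 2 / k) * profit Q"
  proof -
    have fQ: "finite Q" using Q by (simp add: valid_def)
    have "D' \<inter> X = {}" using D'(1) by (auto simp: D_def)
    then have "profit (D' \<union> X) = profit D' + profit X"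
      using finite_subset[OF _ fQ, of D'] finite_subset[OF XQ(1) fQ] D'(1) XQ(2) by (intro profit_Un_disjoint) auto
    moreover have "profit D = profit Q - profit X" unfolding D_def using fQ XQ(1) by (rule profit_Diff)
    moreover have "(1 - 2 / k) * profit X \<le> 1 * profit X"
      using profit_nonneg[OF vD(2)] by (intro mult_right_mono) auto
    ultimately show ?thesis using D'(4) by (simp add: right_diff_distrib)
  qed
  moreover have "D' \<union> X \<subseteq> Q" using D'(1) XQ by blast
  ultimately show ?thesis by blast
qed

definition ygrid :: "(item \<Rightarrow> placement) \<Rightarrow> real \<Rightarrow> item set \<Rightarrow> real set" where
  "ygrid \<phi> N L = {0, N} \<union> (\<lambda>i. corner_y (\<phi> i)) ` L \<union> (\<lambda>i. corner_y (\<phi> i) + placed_height \<phi> i) ` L"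

definition grid_row :: "real set \<Rightarrow> real \<Rightarrow> real \<Rightarrow> bool" where
  "grid_row G a b \<longleftrightarrow> a \<in> G \<and> b \<in> G \<and> a < b \<and> (\<forall>g\<in>G. g \<le> a \<or> b \<le> g)"

text \<open>The threshold is relative to one of the rows that the item meets. If the row of its
  lower edge does not make an item tall, the item is flat for a box as high as that row, however
  thin the row is.\<close>

definition reltall :: "real \<Rightarrow> (item \<Rightarrow> placement) \<Rightarrow> real set \<Rightarrow> item \<Rightarrow> bool" where
  "reltall c \<phi> G i \<longleftrightarrow> (\<exists>a b. grid_row G a b \<and> corner_y (\<phi> i) < b \<and>
     a < corner_y (\<phi> i) + placed_height \<phi> i \<and> c * (b - a) < placed_height \<phi> i)"

lemma finite_ygrid: "finite L \<Longrightarrow> finite (ygrid \<phi> N L)"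
  by (simp add: ygrid_def)

lemma card_ygrid: "finite L \<Longrightarrow> card (ygrid \<phi> N L) \<le> 2 + 2 * card L"
proof -
  assume L: "finite L"
  have "card (ygrid \<phi> N L) \<le> card {0, N} + card ((\<lambda>i. corner_y (\<phi> i)) ` L) +
     card ((\<lambda>i. corner_y (\<phi> i) + placed_height \<phi> i) ` L)"
    unfolding ygrid_def by (meson add_mono card_Un_le le_refl order_trans)
  also have "\<dots> \<le> 2 + card L + card L"
    using L by (intro add_mono card_image_le) (auto simp: card_insert_if)
  finally show ?thesis by simp
qed

lemma grid_row_of:
  assumes G: "finite G" "0 \<in> G" "N \<in> G" and y: "0 \<le> y" "y < N"
  obtains a b where "grid_row G a b" "a \<le> y" "y < b"
proof -
  define a where "a = Max {g \<in> G. g \<le> y}"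
  define b where "b = Min {g \<in> G. y < g}"
  have fa: "finite {g \<in> G. g \<le> y}" "{g \<in> G. g \<le> y} \<noteq> {}" using G y by auto
  have fb: "finite {g \<in> G. y < g}" "{g \<in> G. y < g} \<noteq> {}" using G y by auto
  have a: "a \<in> G" "a \<le> y" using Max_in[OF fa] by (auto simp: a_def)
  have b: "b \<in> G" "y < b" using Min_in[OF fb] by (auto simp: b_def)
  have "g \<le> a \<or> b \<le> g" if "g \<in> G" for g
  proof (cases "g \<le> y")
    case True
    then have "g \<le> a" unfolding a_def using fa that by (intro Max_ge) auto
    then show ?thesis ..
  next
    case False
    then have "b \<le> g" unfolding b_def using fb that by (intro Min_le) auto
    then show ?thesis ..
  qed
  then have "grid_row G a b" using a b by (auto simp: grid_row_def)
  then show ?thesis using that a b by blast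
qed

lemma good_single:
  assumes "valid_item i" "1 \<le> K" "0 \<le> \<eta>"
  shows "good \<epsilon> \<eta> K (placed_width \<phi> i) (placed_height \<phi> i) {i}"
proof -
  have v: "valid {i}" using assms by (simp add: valid_def)
  have "good \<epsilon> 0 1 (placed_width \<phi> i) (placed_height \<phi> i) {i}"
    unfolding good_def using cpk_single[OF assms(1)] by auto
  then show ?thesis by (rule good_mono[OF _ v]) (use assms in auto)
qed

text \<open>Each item outside \<open>L\<close> is assigned to the row of its lower edge and, within
  this row, to the gap between the items of \<open>L\<close> that contains it. The gap is a flat box
  after \<open>absorb_crossing\<close> has dealt with items protruding at the top. The losses are
  \<open>2 * \<epsilon>\<close> there and \<open>3 * \<epsilon>\<close> in
  \<open>flat_box\<close>.\<close>

lemma flat_rows: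
  assumes \<epsilon>: "0 < \<epsilon>" "\<epsilon> \<le> 1 / 6"
  shows "\<exists>c>0. \<exists>K. \<forall>N \<phi> R L m. 0 < N \<and> valid R \<and> fits \<phi> R N N \<and> L \<subseteq> R \<and> card L \<le> m \<and>
     (\<forall>i\<in>R - L. \<not> reltall c \<phi> (ygrid \<phi> N L) i) \<longrightarrow> good \<epsilon> (5 * \<epsilon>) (K m) N N R"
proof -
  have \<epsilon>1: "\<epsilon> \<le> 1" using \<epsilon> by simp
  obtain cB KB where cB: "0 < cB" and B: "\<forall>W Z S. 0 < W \<and> 0 < Z \<and> valid S \<and> fpk (cB * Z) W Z S \<longrightarrow> good \<epsilon> (3 * \<epsilon>) KB W Z S"
    using flat_box[OF \<epsilon>(1) \<epsilon>1] by blast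
  define k where "k = nat \<lceil>1 / \<epsilon>\<rceil>"
  have k1: "1 / \<epsilon> \<le> real k" using \<epsilon> by (simp add: k_def)
  have k0: "0 < k" using k1 \<epsilon> by (metis divide_pos_pos gr_zeroI less_numeral_extra(1) not_less of_nat_0)
  have k\<epsilon>: "2 / real k \<le> 2 * \<epsilon>" using k1 k0 \<epsilon> by (simp add: field_simps)
  define c where "c = min cB (1 / real k)"
  have c0: "0 < c" "c \<le> 1 / real k" "c \<le> cB" using cB k0 by (auto simp: c_def)
  \<comment> \<open>A box for each item of \<open>L\<close> and for each choice of two row borders
    and two gap ends. \<open>KB + 1\<close> also covers the one container of a single item, even if
    \<open>KB\<close> is \<open>0\<close>.\<close>
  define K where "K m = (m + (2 + 2 * m) * ((2 + 2 * m) * ((m + 1) * (m + 1)))) * (KB + 1)" for m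
  have main: "good \<epsilon> (5 * \<epsilon>) (K m) N N R"
    if N: "0 < N" and R: "valid R" and f: "fits \<phi> R N N" and L: "L \<subseteq> R" "card L \<le> m"
      and nt: "\<forall>i\<in>R - L. \<not> reltall c \<phi> (ygrid \<phi> N L) i" for N \<phi> R L m
  proof -
    have finR: "finite R" using R by (simp add: valid_def)
    have finL: "finite L" by (rule finite_subset[OF L(1) finR])
    define G where "G = ygrid \<phi> N L"
    have G: "finite G" "0 \<in> G" "N \<in> G" using finite_ygrid[OF finL] by (auto simp: G_def ygrid_def)
    define X where "X i = corner_x (\<phi> i)" for i
    define Y where "Y i = corner_y (\<phi> i)" for i
    define w where "w i = placed_width \<phi> i" for i
    define h where "h i = placed_height \<phi> i" for i
    have pb: "pbox \<phi> i = (X i, Y i, w i, h i)" for i by (simp add: pbox_def X_def Y_def w_def h_def)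
    have pos: "0 < w i" "0 < h i" if "i \<in> R" for i
      using R that placed_pos unfolding valid_def w_def h_def by blast+
    have bnd: "0 \<le> X i" "X i + w i \<le> N" "0 \<le> Y i" "Y i + h i \<le> N" if "i \<in> R" for i
      using f that unfolding fits_def pb by auto
    have ap: "apart (pbox \<phi> i) (pbox \<phi> j)" if "i \<in> R" "j \<in> R" "i \<noteq> j" for i j
      using f that unfolding fits_def pairwise_def by blast
    have LG: "Y l \<in> G" "Y l + h l \<in> G" if "l \<in> L" for l
      using that by (auto simp: G_def ygrid_def Y_def h_def)
    have "\<forall>i. \<exists>p. i \<in> R \<longrightarrow> grid_row G (fst p) (snd p) \<and> fst p \<le> Y i \<and> Y i < snd p"
    proof
      fix i
      show "\<exists>p. i \<in> R \<longrightarrow> grid_row G (fst p) (snd p) \<and> fst p \<le> Y i \<and> Y i < snd p"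
      proof (cases "i \<in> R")
        case True
        have "0 \<le> Y i" "Y i < N" using bnd[OF True] pos[OF True] by auto
        then obtain a b where "grid_row G a b" "a \<le> Y i" "Y i < b" using grid_row_of[OF G] by blast
        then show ?thesis by (intro exI[of _ "(a, b)"]) simp
      qed simp
    qed
    from choice[OF this] obtain rw where rw: "\<And>i. i \<in> R \<Longrightarrow> grid_row G (fst (rw i)) (snd (rw i))"
      "\<And>i. i \<in> R \<Longrightarrow> fst (rw i) \<le> Y i" "\<And>i. i \<in> R \<Longrightarrow> Y i < snd (rw i)" by blast
    \<comment> \<open>The grid contains the horizontal edges of \<open>L\<close>, so an item of
      \<open>L\<close> covers a row in its full height or avoids it. Only covering items bound
      gaps.\<close>
    define cov where "cov p = {l \<in> L. Y l \<le> fst p \<and> snd p \<le> Y l + h l}" for p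
    define Bl where "Bl p = (\<lambda>l. (X l, X l + w l)) ` cov p" for p
    have finBl: "finite (Bl p)" for p using finL by (simp add: Bl_def cov_def)
    \<comment> \<open>The item starts inside its row, so it overlaps every covering item vertically,
      even if it protrudes above the row; hence it must be separated from it horizontally.\<close>
    have gok: "gap_ok N (Bl (rw i)) (X i) (X i + w i)" if i: "i \<in> R - L" for i
      unfolding gap_ok_def
    proof (intro conjI finBl)
      have iR: "i \<in> R" using i by simp
      show "0 \<le> X i" "X i < X i + w i" "X i + w i \<le> N" using bnd[OF iR] pos[OF iR] by auto
      show "\<forall>(p, q)\<in>Bl (rw i). p \<le> q \<and> (q \<le> X i \<or> X i + w i \<le> p)"
      proof
        fix z assume "z \<in> Bl (rw i)"
        then obtain l where l: "l \<in> cov (rw i)" "z = (X l, X l + w l)" by (auto simp: Bl_def)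
        have lR: "l \<in> R" "l \<in> L" using l L by (auto simp: cov_def)
        have "apart (pbox \<phi> i) (pbox \<phi> l)" using ap[OF iR lR(1)] lR(2) i by blast
        moreover have "Y l \<le> fst (rw i)" "snd (rw i) \<le> Y l + h l" using l by (auto simp: cov_def)
        ultimately show "case z of (p, q) \<Rightarrow> p \<le> q \<and> (q \<le> X i \<or> X i + w i \<le> p)"
          using rw(2)[OF iR] rw(3)[OF iR] pos[OF iR] pos[OF lR(1)] by (auto simp: l(2) pb apart_def)
      qed
    qed
    define lo where "lo i = gap_lo (Bl (rw i)) (X i)" for i
    define hi where "hi i = gap_hi N (Bl (rw i)) (X i + w i)" for i
    \<comment> \<open>The key of an item outside \<open>L\<close> consists of the coordinates of its
      box, so different keys are disjoint boxes by \<open>gap_eq_or_separated\<close>.\<close>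
    define \<kappa> where "\<kappa> i = (if i \<in> L then Inl i else Inr (fst (rw i), snd (rw i), lo i, hi i))" for i
    define bx where "bx k = (case k of Inl l \<Rightarrow> pbox \<phi> l | Inr (a, b, u, v) \<Rightarrow> (u, a, v - u, b - a))"
      for k :: "item + real \<times> real \<times> real \<times> real"
    have lohi: "0 \<le> lo i" "lo i \<le> X i" "X i + w i \<le> hi i" "hi i \<le> N" if "i \<in> R - L" for i
      using gap_bounds(1-4)[OF gok[OF that]] by (auto simp: lo_def hi_def)
    have Gbnd: "0 \<le> g" "g \<le> N" if "g \<in> G" for g
    proof -
      have "0 \<le> Y l" "Y l + h l \<le> N" "0 < h l" if "l \<in> L" for l
        using bnd[of l] pos[of l] that L by auto
      then have "0 \<le> g \<and> g \<le> N" using that N unfolding G_def ygrid_def Y_def h_def by force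
      then show "0 \<le> g" "g \<le> N" by auto
    qed
    have rwG: "fst (rw i) \<in> G" "snd (rw i) \<in> G" "fst (rw i) < snd (rw i)" if "i \<in> R" for i
      using rw(1)[OF that] by (auto simp: grid_row_def)
    have "good \<epsilon> (5 * \<epsilon>) ((m + (2 + 2 * m) * ((2 + 2 * m) * ((m + 1) * (m + 1)))) * (KB + 1)) N N R"
    proof (rule good_glue[where \<kappa> = \<kappa> and bx = bx, OF R])
      fix j assume "j \<in> \<kappa> ` R"
      then obtain i where i: "i \<in> R" "j = \<kappa> i" by auto
      show "boxin (bx j) (0, 0, N, N)"
      proof (cases "i \<in> L")
        case True
        then show ?thesis using bnd[OF i(1)] by (simp add: i(2) \<kappa>_def bx_def pb)
      next
        case False
        then have iL: "i \<in> R - L" using i by simp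
        show ?thesis using lohi[OF iL] Gbnd rwG[OF i(1)] False by (simp add: i(2) \<kappa>_def bx_def)
      qed
      show "case bx j of (x, y, w, h) \<Rightarrow> good \<epsilon> (5 * \<epsilon>) (KB + 1) w h {i \<in> R. \<kappa> i = j}"
      proof (cases "i \<in> L")
        case True
        then have "{i' \<in> R. \<kappa> i' = j} = {i}" using i by (auto simp: \<kappa>_def split: if_splits)
        moreover have "good \<epsilon> (5 * \<epsilon>) (KB + 1) (w i) (h i) {i}"
          unfolding w_def h_def by (rule good_single) (use R i \<epsilon> in \<open>auto simp: valid_def\<close>)
        ultimately show ?thesis using True by (simp add: i(2) \<kappa>_def bx_def pb)
      next
        case False
        then have iL: "i \<in> R - L" using i by simp
        define a b where "a = fst (rw i)" and "b = snd (rw i)"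
        define Q where "Q = {i' \<in> R. \<kappa> i' = j}"
        have Qeq: "i' \<in> R - L" "rw i' = (a, b)" "lo i' = lo i" "hi i' = hi i" if "i' \<in> Q" for i'
          using that False i(2) by (auto simp: Q_def \<kappa>_def a_def b_def prod_eq_iff split: if_splits)
        have vQ: "valid Q" by (rule valid_subset[OF R]) (auto simp: Q_def)
        have ab: "a < b" using rwG[OF i(1)] by (simp add: a_def b_def)
        have "\<exists>Q'\<subseteq>Q. fpk (c * (b - a)) (hi i - lo i) (b - a) Q' \<and> profit Q' \<ge> (1 - 2 / real k) * profit Q"
        proof (rule absorb_crossing[OF vQ _ _ _ _ k0 c0(2) c0(1) ab, where \<phi> = \<phi>])
          show "pairwise (\<lambda>i j. apart (pbox \<phi> i) (pbox \<phi> j)) Q" using ap by (auto simp: pairwise_def Q_def)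
        next
          fix i' assume i': "i' \<in> Q"
          show "lo i \<le> corner_x (\<phi> i') \<and> corner_x (\<phi> i') + placed_width \<phi> i' \<le> hi i"
            using lohi[OF Qeq(1)[OF i']] Qeq[OF i'] by (simp add: X_def w_def)
        next
          fix i' assume i': "i' \<in> Q"
          have "i' \<in> R" using Qeq(1)[OF i'] by simp
          then show "a \<le> corner_y (\<phi> i') \<and> corner_y (\<phi> i') < b"
            using rw(2,3)[of i'] Qeq(2)[OF i'] by (simp add: Y_def)
        next
          fix i' assume i': "i' \<in> Q"
          have i'R: "i' \<in> R" using Qeq(1)[OF i'] by simp
          have "\<not> reltall c \<phi> G i'" using nt Qeq(1)[OF i'] by (simp add: G_def)
          moreover have "grid_row G a b" "a \<le> Y i'" "Y i' < b" using rw(1-3)[OF i'R] Qeq(2)[OF i'] by simp_all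
          ultimately show "placed_height \<phi> i' \<le> c * (b - a)"
            using pos(2)[OF i'R] unfolding reltall_def Y_def h_def by (meson add_strict_increasing2 le_less_trans less_add_same_cancel1 not_le)
        qed
        then obtain Q' where Q': "Q' \<subseteq> Q" "fpk (c * (b - a)) (hi i - lo i) (b - a) Q'"
          "profit Q' \<ge> (1 - 2 / real k) * profit Q" by blast
        have vQ': "valid Q'" by (rule valid_subset[OF vQ Q'(1)])
        have wid: "0 < hi i - lo i" using lohi[OF iL] pos[OF i(1)] by linarith
        have "c * (b - a) \<le> cB * (b - a)" using c0(3) ab by (intro mult_right_mono) auto
        then have "fpk (cB * (b - a)) (hi i - lo i) (b - a) Q'" using Q'(2) by (elim fpk_mono) auto
        then have g0: "good \<epsilon> (3 * \<epsilon>) KB (hi i - lo i) (b - a) Q'" using B wid ab vQ' by simp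
        have "(1 - 2 * \<epsilon>) * profit Q \<le> (1 - 2 / real k) * profit Q"
          using profit_nonneg[OF vQ] k\<epsilon> by (intro mult_right_mono) auto
        then have "good \<epsilon> (3 * \<epsilon> + 2 * \<epsilon>) KB (hi i - lo i) (b - a) Q"
          using Q'(3) \<epsilon> by (intro good_subset[OF g0 vQ Q'(1)]) auto
        then have "good \<epsilon> (5 * \<epsilon>) (KB + 1) (hi i - lo i) (b - a) Q" by (rule good_mono[OF _ vQ]) auto
        then show ?thesis using False by (simp add: i(2) \<kappa>_def bx_def a_def b_def Q_def)
      qed
    next
      fix j j' assume "j \<in> \<kappa> ` R" "j' \<in> \<kappa> ` R" and ne: "j \<noteq> j'"
      then obtain i i' where i: "i \<in> R" "j = \<kappa> i" and i': "i' \<in> R" "j' = \<kappa> i'" by auto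
      have mixed: "apart (bx (\<kappa> l)) (bx (\<kappa> i))" if l: "l \<in> L" and i: "i \<in> R - L" for l i
      proof -
        have iR: "i \<in> R" and lR: "l \<in> R" using i l L by auto
        have row: "Y l \<le> fst (rw i) \<or> snd (rw i) \<le> Y l" "Y l + h l \<le> fst (rw i) \<or> snd (rw i) \<le> Y l + h l"
          using rw(1)[OF iR] LG[OF l] by (auto simp: grid_row_def)
        show ?thesis
        proof (cases "l \<in> cov (rw i)")
          case True
          then have "X l + w l \<le> lo i \<or> hi i \<le> X l"
            using gap_bounds(5)[OF gok[OF i], of "X l" "X l + w l"] by (auto simp: Bl_def lo_def hi_def)
          then show ?thesis using l i by (auto simp: \<kappa>_def bx_def pb apart_def)
        next
          case False
          then have "snd (rw i) \<le> Y l \<or> Y l + h l \<le> fst (rw i)" using row l by (auto simp: cov_def)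
          then show ?thesis using l i by (auto simp: \<kappa>_def bx_def pb apart_def)
        qed
      qed
      consider "i \<in> L" "i' \<in> L" | "i \<in> L" "i' \<in> R - L" | "i \<in> R - L" "i' \<in> L" | "i \<in> R - L" "i' \<in> R - L"
        using i i' by auto
      then show "apart (bx j) (bx j')"
      proof cases
        case 1
        then have "i \<noteq> i'" using ne i i' by auto
        then show ?thesis using 1 ap[OF i(1) i'(1)] by (simp add: i i' \<kappa>_def bx_def)
      next
        case 2
        then show ?thesis using mixed i i' by simp
      next
        case 3
        then show ?thesis using mixed i i' apart_sym by simp
      next
        case 4
        show ?thesis
        proof (cases "rw i = rw i'")
          case True
          have "gap_lo (Bl (rw i)) (X i) = gap_lo (Bl (rw i)) (X i') \<and>
              gap_hi N (Bl (rw i)) (X i + w i) = gap_hi N (Bl (rw i)) (X i' + w i') \<or>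
              gap_hi N (Bl (rw i)) (X i + w i) \<le> gap_lo (Bl (rw i)) (X i') \<or>
              gap_hi N (Bl (rw i)) (X i' + w i') \<le> gap_lo (Bl (rw i)) (X i)"
            by (rule gap_eq_or_separated) (use gok[OF 4(1)] gok[OF 4(2)] True in simp_all)
          then show ?thesis using ne 4 True by (auto simp: i i' \<kappa>_def bx_def lo_def hi_def apart_def)
        next
          case False
          have "grid_row G (fst (rw i)) (snd (rw i))" "grid_row G (fst (rw i')) (snd (rw i'))"
            using rw(1) i i' by auto
          then have "snd (rw i) \<le> fst (rw i') \<or> snd (rw i') \<le> fst (rw i)"
            using False unfolding grid_row_def prod_eq_iff by fastforce
          then show ?thesis using 4 by (auto simp: i i' \<kappa>_def bx_def apart_def)
        qed
      qed
    next
      define A where "A = insert 0 ((\<lambda>l. X l + w l) ` L)"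
      define A' where "A' = insert N (X ` L)"
      have sub: "\<kappa> ` R \<subseteq> Inl ` L \<union> Inr ` (G \<times> G \<times> A \<times> A')"
      proof
        fix j assume "j \<in> \<kappa> ` R"
        then obtain i where i: "i \<in> R" "j = \<kappa> i" by auto
        have "lo i \<in> A" using gap_lo_in[OF finBl, of "rw i" "X i"] by (auto simp: lo_def A_def Bl_def cov_def)
        moreover have "hi i \<in> A'" using gap_hi_in[OF finBl, of N "rw i" "X i + w i"] by (auto simp: hi_def A'_def Bl_def cov_def)
        ultimately show "j \<in> Inl ` L \<union> Inr ` (G \<times> G \<times> A \<times> A')"
          using rwG[OF i(1)] by (auto simp: i(2) \<kappa>_def)
      qed
      have fA: "finite A" "finite A'" using finL by (auto simp: A_def A'_def)
      have cA: "card A \<le> m + 1" "card A' \<le> m + 1"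
        using card_insert_le_m1 card_image_le[OF finL, of "\<lambda>l. X l + w l"] card_image_le[OF finL, of X] L(2) finL
        by (auto simp: A_def A'_def card_insert_if)
      have cG: "card G \<le> 2 + 2 * m" using card_ygrid[OF finL, of \<phi> N] L(2) by (simp add: G_def)
      have "card (\<kappa> ` R) \<le> card (Inl ` L \<union> Inr ` (G \<times> G \<times> A \<times> A'))"
        by (rule card_mono[OF _ sub]) (use finL G fA in simp)
      also have "\<dots> \<le> card (Inl ` L :: (item + real \<times> real \<times> real \<times> real) set) + card (Inr ` (G \<times> G \<times> A \<times> A') :: (item + real \<times> real \<times> real \<times> real) set)"
        by (rule card_Un_le)
      also have "\<dots> = card L + card (G \<times> G \<times> A \<times> A')" by (simp add: card_image)
      also have "card (G \<times> G \<times> A \<times> A') = card G * (card G * (card A * card A'))" by (simp add: card_cartesian_product)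
      also have "\<dots> \<le> (2 + 2 * m) * ((2 + 2 * m) * ((m + 1) * (m + 1)))" using cG cA by (intro mult_le_mono)
      finally show "card (\<kappa> ` R) \<le> m + (2 + 2 * m) * ((2 + 2 * m) * ((m + 1) * (m + 1)))" using L(2) by simp
    qed
    then show ?thesis by (simp add: K_def)
  qed
  show ?thesis
    by (intro exI[of _ c] conjI c0(1) exI[of _ K] allI impI) (elim conjE, rule main; assumption)
qed

subsection \<open>Resource augmentation\<close>

lemma floor_eq_close: "\<lfloor>x / d\<rfloor> = \<lfloor>y / d\<rfloor> \<Longrightarrow> 0 < d \<Longrightarrow> y < x + (d::real)"
proof -
  assume a: "\<lfloor>x / d\<rfloor> = \<lfloor>y / d\<rfloor>" "0 < d"
  have "y / d < \<lfloor>y / d\<rfloor> + 1" by linarith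
  also have "\<dots> \<le> x / d + 1" using a(1) by linarith
  finally show "y < x + d" using a(2) by (simp add: field_simps)
qed

lemma nat_floor_eq_close: "nat \<lfloor>x / d\<rfloor> = nat \<lfloor>y / d\<rfloor> \<Longrightarrow> 0 < d \<Longrightarrow> 0 \<le> x \<Longrightarrow> 0 \<le> y \<Longrightarrow> y < x + (d::real)"
  by (rule floor_eq_close) (auto simp: eq_nat_nat_iff)

text \<open>An edge snapped to a multiple of \<open>g\<close> never lies strictly inside a row of
  height \<open>g\<close>. This is how absolute rows come to be covered or avoided by tall
  items.\<close>

lemma multiple_cases:
  fixes g :: real and k :: nat and a :: int
  assumes "0 < g"
  shows "g * real_of_int a \<le> real k * g \<or> (real k + 1) * g \<le> g * real_of_int a"
proof (cases "a \<le> int k")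
  case True
  then have "real_of_int a \<le> real k" by linarith
  then show ?thesis using assms by (simp add: mult.commute)
next
  case False
  then have "real k + 1 \<le> real_of_int a" by linarith
  then show ?thesis using assms by (simp add: mult.commute)
qed

text \<open>Tall items are snapped to rows of equal height. A gap of a row that contains a wide flat
  item becomes a flat box; these gaps are few because they are wide. The other items are narrow or
  belong to \<open>L\<close>, and the narrow ones are collected in columns between the ends of these
  gaps and of the items in \<open>L\<close>. Everything that crosses a border goes to the strip on
  top.\<close>

lemma augmented_core:
  assumes \<epsilon>: "0 < \<epsilon>" "\<epsilon> \<le> 1 / 6" and \<delta>: "0 < \<delta>" "\<delta> \<le> 1 / 2" and el: "0 < el" "el \<le> 1"
  shows "\<exists>\<rho>>0. \<exists>K. \<forall>N S \<phi> es. 0 < N \<and> valid S \<and> fits \<phi> S N ((1 - \<delta>) * N) \<and> 0 < es \<and> es \<le> \<rho> \<and> es < el \<and>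
     (\<forall>i\<in>S. (placed_width \<phi> i \<le> es * N \<or> el * N < placed_width \<phi> i) \<and>
            (placed_height \<phi> i \<le> es * N \<or> el * N < placed_height \<phi> i)) \<longrightarrow>
     good \<epsilon> (3 * \<epsilon>) K N N S"
proof -
  have \<epsilon>1: "\<epsilon> \<le> 1" using \<epsilon> by simp
  obtain c KB where c: "0 < c" and B: "\<forall>W Z S. 0 < W \<and> 0 < Z \<and> valid S \<and> fpk (c * Z) W Z S \<longrightarrow> good \<epsilon> (3 * \<epsilon>) KB W Z S"
    using flat_box[OF \<epsilon>(1) \<epsilon>1] by blast
  \<comment> \<open>\<open>M\<close> bounds the rows of height \<open>g\<close>, \<open>nl\<close>
    the cells of length \<open>el * N\<close> along one side, \<open>nH\<close> the H-gaps and
    \<open>nL\<close> the items that are tall and wide. \<open>nX\<close> bounds the vertical cut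
    lines: both sides of the knapsack and two for each H-gap and each item of
    \<open>L\<close>.\<close>
  define M where "M = nat \<lfloor>4 / (\<delta> * el)\<rfloor> + 1"
  define nl where "nl = nat \<lfloor>1 / el\<rfloor> + 1"
  define nH where "nH = M * nl"
  define nL where "nL = nl * nl"
  define nX where "nX = 2 + 2 * nH + 2 * nL"
  \<comment> \<open>The first bound gives \<open>es * N \<le> c * g\<close>, so that small items are
    flat for a row. By the second, the strip of height \<open>\<delta> * N / 4\<close> holds
    \<open>M\<close> row crossings and \<open>nX\<close> cut-line crossings of thickness
    \<open>es * N\<close> and \<open>nX * nX\<close> columns of width
    \<open>es * N / c\<close>.\<close>
  define \<rho> where "\<rho> = min (c * \<delta> * el / 4) ((\<delta> / 4) / (real M + real nX + real (nX * nX) / c))"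
  have den: "0 < real M + real nX + real (nX * nX) / c" using c by (simp add: M_def add_pos_nonneg)
  have \<rho>0: "0 < \<rho>" unfolding \<rho>_def using c \<delta> el den by simp
  \<comment> \<open>The summands count the items of \<open>L\<close>, the H-gaps, the column runs
    given by two sides and two vertical ends, and the free strip.\<close>
  define KK where "KK = nL + nH + (nX * nX) * ((1 + nH + nL) * (1 + nH + nL)) + 1"
  have main: "good \<epsilon> (3 * \<epsilon>) (KK * (KB + 1)) N N S"
    if N: "0 < N" and S: "valid S" and f: "fits \<phi> S N ((1 - \<delta>) * N)" and es: "0 < es" "es \<le> \<rho>" "es < el"
      and dim: "\<forall>i\<in>S. (placed_width \<phi> i \<le> es * N \<or> el * N < placed_width \<phi> i) \<and>
            (placed_height \<phi> i \<le> es * N \<or> el * N < placed_height \<phi> i)" for N S \<phi> es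
  proof -
    have finS: "finite S" using S by (simp add: valid_def)
    define x where "x i = corner_x (\<phi> i)" for i
    define y where "y i = corner_y (\<phi> i)" for i
    define w where "w i = placed_width \<phi> i" for i
    define h where "h i = placed_height \<phi> i" for i
    have pb: "pbox \<phi> i = (x i, y i, w i, h i)" for i by (simp add: pbox_def x_def y_def w_def h_def)
    have pos: "0 < w i" "0 < h i" if "i \<in> S" for i
      using S that placed_pos unfolding valid_def w_def h_def by blast+
    have bnd: "0 \<le> x i" "x i + w i \<le> N" "0 \<le> y i" "y i + h i \<le> (1 - \<delta>) * N" if "i \<in> S" for i
      using f that unfolding fits_def pb by auto
    have ap0: "x i + w i \<le> x j \<or> x j + w j \<le> x i \<or> y i + h i \<le> y j \<or> y j + h j \<le> y i"
      if "i \<in> S" "j \<in> S" "i \<noteq> j" for i j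
      using f that unfolding fits_def pairwise_def pb apart_def by fastforce
    define tall where "tall i \<longleftrightarrow> el * N < h i" for i
    define wide where "wide i \<longleftrightarrow> el * N < w i" for i
    have flat: "h i \<le> es * N" if "i \<in> S" "\<not> tall i" for i using dim that by (auto simp: tall_def h_def)
    have narrow: "w i \<le> es * N" if "i \<in> S" "\<not> wide i" for i using dim that by (auto simp: wide_def w_def)
    have elN: "0 < el * N" using el N by simp
    (* Stretching by s leaves enough slack to snap the tall items to multiples of g. *)
    define s where "s = (1 - \<delta> / 2) / (1 - \<delta>)"
    have s1: "s * (1 - \<delta>) = 1 - \<delta> / 2" using \<delta> by (simp add: s_def)
    have s2: "1 + \<delta> / 2 \<le> s" using \<delta> by (simp add: s_def field_simps)
    have s0: "1 \<le> s" using s2 \<delta> by linarith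
    define g where "g = \<delta> * el * N / 4"
    have g0: "0 < g" using \<delta> el N by (simp add: g_def)
    have g1: "g \<le> \<delta> * N / 4"
    proof -
      have "\<delta> * N * el \<le> \<delta> * N * 1" using \<delta> N el by (intro mult_left_mono) auto
      then show ?thesis by (simp add: g_def mult_ac)
    qed
    \<comment> \<open>The stretched packing ends at \<open>(1 - \<delta> / 2) * N\<close>. The next
      \<open>\<delta> * N / 4\<close>, which is at least \<open>g\<close>, lets the highest row
      stick out; the last \<open>\<delta> * N / 4\<close> is the free strip.\<close>
    define Zt where "Zt = (1 - \<delta> / 4) * N"
    \<comment> \<open>\<open>T i\<close> is the top of the space reserved for \<open>i\<close>. For
      a tall item both ends of this space are multiples of \<open>g\<close>.\<close>
    define Y where "Y i = (if tall i then g * real_of_int \<lceil>s * y i / g\<rceil> else s * y i)" for i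
    define T where "T i = (if tall i then g * real_of_int \<lceil>(Y i + h i) / g\<rceil> else Y i + h i)" for i
    have ceil1: "u \<le> g * real_of_int \<lceil>u / g\<rceil>" "g * real_of_int \<lceil>u / g\<rceil> < u + g" for u
    proof -
      have "u / g \<le> real_of_int \<lceil>u / g\<rceil>" "real_of_int \<lceil>u / g\<rceil> < u / g + 1" by linarith+
      then have "g * (u / g) \<le> g * real_of_int \<lceil>u / g\<rceil>" "g * real_of_int \<lceil>u / g\<rceil> < g * (u / g + 1)"
        using g0 by (simp_all only: mult_le_cancel_left_pos mult_less_cancel_left_pos)
      moreover have "g * (u / g) = u" "g * (u / g + 1) = u + g" using g0 by (simp_all add: distrib_left)
      ultimately show "u \<le> g * real_of_int \<lceil>u / g\<rceil>" "g * real_of_int \<lceil>u / g\<rceil> < u + g" by simp_all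
    qed
    have Ylow: "s * y i \<le> Y i" for i using ceil1(1)[of "s * y i"] by (simp add: Y_def)
    have YT: "Y i + h i \<le> T i" for i using ceil1(1)[of "Y i + h i"] by (simp add: T_def)
    have Thigh: "T i \<le> s * (y i + h i)" if "i \<in> S" for i
    proof (cases "tall i")
      case True
      \<comment> \<open>The left side is \<open>2 * g\<close>: one \<open>g\<close> for rounding up
        the bottom and one for rounding up the top.\<close>
      have "\<delta> / 2 * (el * N) \<le> (s - 1) * h i"
        using True s2 \<delta> elN by (intro mult_mono) (auto simp: tall_def)
      then have "h i + 2 * g \<le> s * h i" by (simp add: g_def algebra_simps)
      moreover have "Y i < s * y i + g" using ceil1(2)[of "s * y i"] True by (simp add: Y_def)
      moreover have "T i < Y i + h i + g" using ceil1(2)[of "Y i + h i"] True by (simp add: T_def)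
      ultimately show ?thesis by (simp add: algebra_simps)
    next
      case False
      have "1 * h i \<le> s * h i" using s0 pos[OF that] by (intro mult_right_mono) auto
      then show ?thesis using False by (simp add: T_def Y_def algebra_simps)
    qed
    have Y0: "0 \<le> Y i" if "i \<in> S" for i
    proof -
      have "0 \<le> s * y i" using bnd[OF that] s0 by simp
      then show ?thesis using Ylow[of i] by linarith
    qed
    have Ttop: "T i \<le> (1 - \<delta> / 2) * N" if "i \<in> S" for i
    proof -
      have "s * (y i + h i) \<le> s * ((1 - \<delta>) * N)" using bnd[OF that] s0 by (intro mult_left_mono) auto
      also have "\<dots> = (1 - \<delta> / 2) * N" using s1 by (simp add: mult.assoc[symmetric])
      finally show ?thesis using Thigh[OF that] by linarith
    qed
    have TZ: "T i \<le> Zt" "T i \<le> N" if "i \<in> S" for i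
    proof -
      have "(1 - \<delta> / 2) * N \<le> Zt" "(1 - \<delta> / 2) * N \<le> N" using N \<delta> by (auto simp: Zt_def intro: mult_right_mono)
      then show "T i \<le> Zt" "T i \<le> N" using Ttop[OF that] by linarith+
    qed
    have sep: "x i + w i \<le> x j \<or> x j + w j \<le> x i \<or> T i \<le> Y j \<or> T j \<le> Y i"
      if ij: "i \<in> S" "j \<in> S" "i \<noteq> j" for i j
    proof -
      have ys: "T i \<le> Y j" if "i \<in> S" "y i + h i \<le> y j" for i j
      proof -
        have "T i \<le> s * (y i + h i)" by (rule Thigh[OF that(1)])
        also have "\<dots> \<le> s * y j" using that(2) s0 by (intro mult_left_mono) auto
        finally show ?thesis using Ylow[of j] by linarith
      qed
      show ?thesis using ap0[OF ij] ys[OF ij(1), of j] ys[OF ij(2), of i] by blast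
    qed
    define \<psi> where "\<psi> i = \<lparr>corner_x = x i, corner_y = Y i, rotated = rotated (\<phi> i)\<rparr>" for i
    have d: "placed_width \<psi> i = w i" "placed_height \<psi> i = h i" for i
      unfolding w_def h_def by (auto intro: placed_cong simp: \<psi>_def)
    have cor: "corner_x (\<psi> i) = x i" "corner_y (\<psi> i) = Y i" for i by (simp_all add: \<psi>_def)
    have pb2: "pbox \<psi> i = (x i, Y i, w i, h i)" for i by (simp add: pbox_def d cor)
    have ap: "apart (pbox \<psi> i) (pbox \<psi> j)" if "i \<in> S" "j \<in> S" "i \<noteq> j" for i j
      using sep[OF that] YT[of i] YT[of j] by (auto simp: pb2 apart_def)
    have ap': "pairwise (\<lambda>i j. apart (pbox \<psi> i) (pbox \<psi> j)) A" if "A \<subseteq> S" for A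
      using ap that by (auto simp: pairwise_def)

    have Ymul: "Y i \<le> real k * g \<or> (real k + 1) * g \<le> Y i" if "tall i" for i k
      using multiple_cases[OF g0, of "\<lceil>s * y i / g\<rceil>" k] that by (simp add: Y_def)
    have Tmul: "T i \<le> real k * g \<or> (real k + 1) * g \<le> T i" if "tall i" for i k
      using multiple_cases[OF g0, of "\<lceil>(Y i + h i) / g\<rceil>" k] that by (simp add: T_def)
    define rw where "rw i = nat \<lfloor>Y i / g\<rfloor>" for i
    have rw: "real (rw i) * g \<le> Y i" "Y i < (real (rw i) + 1) * g" if "i \<in> S" for i
    proof -
      have "0 \<le> Y i / g" using Y0[OF that] g0 by simp
      then have "real (rw i) \<le> Y i / g" "Y i / g < real (rw i) + 1" by (simp_all add: rw_def)
      then show "real (rw i) * g \<le> Y i" "Y i < (real (rw i) + 1) * g" using g0 by (simp_all add: field_simps)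
    qed
    have rwM: "rw i < M" if i: "i \<in> S" for i
    proof -
      have "real (rw i) * g \<le> N" using rw(1)[OF i] YT[of i] TZ(2)[OF i] pos[OF i] by linarith
      then have "real (rw i) \<le> 4 / (\<delta> * el)" using g0 N \<delta> el by (simp add: g_def field_simps)
      then show ?thesis unfolding M_def by linarith
    qed
    \<comment> \<open>Flat items that cross the upper border of the row of their lower edge; the
      remaining flat items, in \<open>F0\<close>, lie inside a single row.\<close>
    define E1 where "E1 = {i \<in> S. \<not> tall i \<and> (real (rw i) + 1) * g < Y i + h i}"
    define F0 where "F0 = {i \<in> S. \<not> tall i \<and> Y i + h i \<le> (real (rw i) + 1) * g}"
    define cov where "cov k = {j \<in> S. tall j \<and> Y j \<le> real k * g \<and> (real k + 1) * g \<le> T j}" for k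
    define Bl where "Bl k = (\<lambda>j. (x j, x j + w j)) ` cov k" for k
    have finBl: "finite (Bl k)" for k using finS by (simp add: Bl_def cov_def)
    have gok: "gap_ok N (Bl (rw i)) (x i) (x i + w i)" if i: "i \<in> F0" for i
      unfolding gap_ok_def
    proof (intro conjI finBl)
      have iS: "i \<in> S" using i by (simp add: F0_def)
      show "0 \<le> x i" "x i < x i + w i" "x i + w i \<le> N" using bnd[OF iS] pos[OF iS] by auto
      show "\<forall>(p, q)\<in>Bl (rw i). p \<le> q \<and> (q \<le> x i \<or> x i + w i \<le> p)"
      proof
        fix z assume "z \<in> Bl (rw i)"
        then obtain l where l: "l \<in> cov (rw i)" "z = (x l, x l + w l)" by (auto simp: Bl_def)
        have lS: "l \<in> S" "i \<noteq> l" using l i by (auto simp: cov_def F0_def)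
        have "Y l \<le> real (rw i) * g" "(real (rw i) + 1) * g \<le> T l" using l by (auto simp: cov_def)
        moreover have "T i = Y i + h i" "Y i + h i \<le> (real (rw i) + 1) * g" using i by (auto simp: F0_def T_def)
        ultimately show "case z of (p, q) \<Rightarrow> p \<le> q \<and> (q \<le> x i \<or> x i + w i \<le> p)"
          using sep[OF iS lS] rw[OF iS] pos[OF iS] pos[OF lS(1)] by (auto simp: l(2))
      qed
    qed
    (* An H-gap is a maximal gap between the tall items of a row that contains a wide flat item. *)
    define lo where "lo i = gap_lo (Bl (rw i)) (x i)" for i
    define hi where "hi i = gap_hi N (Bl (rw i)) (x i + w i)" for i
    define gk where "gk i = (rw i, lo i, hi i)" for i
    define HH where "HH = gk ` {i \<in> F0. wide i}"
    have lohi: "0 \<le> lo i" "lo i \<le> x i" "x i + w i \<le> hi i" "hi i \<le> N" if "i \<in> F0" for i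
      using gap_bounds(1-4)[OF gok[OF that]] by (auto simp: lo_def hi_def)
    have gapsep: "gk i = gk i' \<or> hi i \<le> lo i' \<or> hi i' \<le> lo i"
      if "i \<in> F0" "i' \<in> F0" "rw i = rw i'" for i i'
    proof -
      have "gap_lo (Bl (rw i)) (x i) = gap_lo (Bl (rw i)) (x i') \<and>
            gap_hi N (Bl (rw i)) (x i + w i) = gap_hi N (Bl (rw i)) (x i' + w i') \<or>
            gap_hi N (Bl (rw i)) (x i + w i) \<le> gap_lo (Bl (rw i)) (x i') \<or>
            gap_hi N (Bl (rw i)) (x i' + w i') \<le> gap_lo (Bl (rw i)) (x i)"
        by (rule gap_eq_or_separated) (use gok[OF that(1)] gok[OF that(2)] that(3) in simp_all)
      then show ?thesis using that(3) by (auto simp: gk_def lo_def hi_def)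
    qed
    define L where "L = {i \<in> S. tall i \<and> wide i}"
    have finF0: "finite F0" and finL: "finite L" using finS by (auto simp: F0_def L_def)
    have finHH: "finite HH" using finF0 by (simp add: HH_def)
    have flo: "nat \<lfloor>u / (el * N)\<rfloor> < nl" if "u \<le> N" for u
    proof -
      have "u / (el * N) \<le> N / (el * N)" using that elN by (intro divide_right_mono) auto
      also have "\<dots> = 1 / el" using N by simp
      finally have "\<lfloor>u / (el * N)\<rfloor> \<le> \<lfloor>1 / el\<rfloor>" by (rule floor_mono)
      then show ?thesis unfolding nl_def by linarith
    qed
    have cardL: "card L \<le> nL"
    proof -
      \<comment> \<open>Two items with both sides longer than \<open>el * N\<close> and corners in
        the same cell of side \<open>el * N\<close> would overlap.\<close>
      define em where "em i = (nat \<lfloor>x i / (el * N)\<rfloor>, nat \<lfloor>y i / (el * N)\<rfloor>)" for i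
      have "inj_on em L"
      proof (rule inj_onI, rule ccontr)
        fix i j assume ij: "i \<in> L" "j \<in> L" "em i = em j" "i \<noteq> j"
        have iS: "i \<in> S" "j \<in> S" "el * N < w i" "el * N < h i" "el * N < w j" "el * N < h j"
          using ij by (auto simp: L_def tall_def wide_def)
        have "x j < x i + el * N" "x i < x j + el * N" "y j < y i + el * N" "y i < y j + el * N"
          using ij(3) bnd[OF iS(1)] bnd[OF iS(2)] elN by (auto simp: em_def intro!: nat_floor_eq_close)
        then show False using ap0[OF iS(1,2) ij(4)] iS by linarith
      qed
      moreover have "em ` L \<subseteq> {..<nl} \<times> {..<nl}"
      proof
        fix z assume "z \<in> em ` L"
        then obtain i where i: "i \<in> S" "z = em i" by (auto simp: L_def)
        have "(1 - \<delta>) * N \<le> 1 * N" using N \<delta> by (intro mult_right_mono) auto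
        then have "x i \<le> N" "y i \<le> N" using bnd[OF i(1)] pos[OF i(1)] by linarith+
        then show "z \<in> {..<nl} \<times> {..<nl}" using flo by (simp add: i(2) em_def)
      qed
      ultimately have "card L \<le> card ({..<nl} \<times> {..<nl})" by (metis card_inj_on_le finite_SigmaI finite_lessThan)
      then show ?thesis by (simp add: nL_def card_cartesian_product)
    qed
    have cardHH: "card HH \<le> nH"
    proof -
      \<comment> \<open>H-gaps are wider than \<open>el * N\<close>, so two of them in one row with
        left ends in the same cell overlap and are therefore equal.\<close>
      define em where "em p = (fst p, nat \<lfloor>fst (snd p) / (el * N)\<rfloor>)" for p :: "nat \<times> real \<times> real"
      have "inj_on em HH"
      proof (rule inj_onI)
        fix p p' assume p: "p \<in> HH" "p' \<in> HH" "em p = em p'"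
        obtain i where i: "i \<in> F0" "wide i" "p = gk i" using p by (auto simp: HH_def)
        obtain j where j: "j \<in> F0" "wide j" "p' = gk j" using p by (auto simp: HH_def)
        have r: "rw i = rw j" "nat \<lfloor>lo i / (el * N)\<rfloor> = nat \<lfloor>lo j / (el * N)\<rfloor>" using p(3) by (auto simp: em_def i j gk_def)
        have "lo j < lo i + el * N" "lo i < lo j + el * N"
          using r(2) lohi[OF i(1)] lohi[OF j(1)] elN by (auto intro!: nat_floor_eq_close)
        moreover have "lo i + el * N < hi i" "lo j + el * N < hi j"
          using i(2) j(2) lohi[OF i(1)] lohi[OF j(1)] by (auto simp: wide_def)
        ultimately show "p = p'" using gapsep[OF i(1) j(1) r(1)] by (auto simp: i(3) j(3))
      qed
      moreover have "em ` HH \<subseteq> {..<M} \<times> {..<nl}"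
      proof
        fix z assume "z \<in> em ` HH"
        then obtain i where i: "i \<in> F0" "z = em (gk i)" by (auto simp: HH_def)
        have iS: "i \<in> S" using i by (simp add: F0_def)
        have "lo i \<le> N" using lohi[OF i(1)] pos[OF iS] by linarith
        then show "z \<in> {..<M} \<times> {..<nl}" using rwM[OF iS] flo by (simp add: i(2) em_def gk_def)
      qed
      ultimately have "card HH \<le> card ({..<M} \<times> {..<nl})" by (metis card_inj_on_le finite_SigmaI finite_lessThan)
      then show ?thesis by (simp add: nH_def card_cartesian_product)
    qed
    define Xg where "Xg = {0, N} \<union> (\<lambda>p. fst (snd p)) ` HH \<union> (\<lambda>p. snd (snd p)) ` HH \<union> x ` L \<union> (\<lambda>l. x l + w l) ` L"
    have finXg: "finite Xg" using finHH finL by (simp add: Xg_def)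
    have cardXg: "card Xg \<le> nX"
    proof -
      have "card Xg \<le> card {0, N} + card ((\<lambda>p. fst (snd p)) ` HH) + card ((\<lambda>p. snd (snd p)) ` HH) + card (x ` L) + card ((\<lambda>l. x l + w l) ` L)"
        unfolding Xg_def by (meson add_mono card_Un_le le_refl order_trans)
      also have "\<dots> \<le> 2 + nH + nH + nL + nL"
        using card_image_le[OF finHH, of "\<lambda>p. fst (snd p)"] card_image_le[OF finHH, of "\<lambda>p. snd (snd p)"]
          card_image_le[OF finL, of x] card_image_le[OF finL, of "\<lambda>l. x l + w l"] cardHH cardL
        by (intro add_mono) (auto simp: card_insert_if)
      finally show ?thesis by (simp add: nX_def)
    qed
    \<comment> \<open>A narrow flat item inside an H-gap stays with the box of that gap. What
      remains in \<open>Nr\<close> is narrow, be it tall or flat.\<close>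
    define Hg where "Hg = {i \<in> F0. gk i \<in> HH}"
    define Nr where "Nr = {i \<in> S. \<not> wide i \<and> i \<notin> E1 \<and> i \<notin> Hg}"
    have wideHg: "i \<in> Hg" if "i \<in> S" "wide i" "\<not> tall i" "i \<notin> E1" for i
      using that by (auto simp: Hg_def HH_def F0_def E1_def)
    \<comment> \<open>Degenerate blockers: the gaps between them are the columns between consecutive
      cut lines.\<close>
    define PB where "PB = (\<lambda>t. (t, t)) ` Xg"
    define E2 where "E2 = {i \<in> Nr. \<exists>t\<in>Xg. x i < t \<and> t < x i + w i}"
    have finPB: "finite PB" using finXg by (simp add: PB_def)
    have cok: "gap_ok N PB (x i) (x i + w i)" if i: "i \<in> Nr - E2" for i
    proof -
      have iS: "i \<in> S" using i by (simp add: Nr_def)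
      have "t \<le> x i \<or> x i + w i \<le> t" if "t \<in> Xg" for t using i that by (auto simp: E2_def not_less)
      then show ?thesis unfolding gap_ok_def using bnd[OF iS] pos[OF iS] finPB by (auto simp: PB_def)
    qed
    define cp where "cp i = gap_lo PB (x i)" for i
    define cq where "cq i = gap_hi N PB (x i + w i)" for i
    have cpq: "0 \<le> cp i" "cp i \<le> x i" "x i + w i \<le> cq i" "cq i \<le> N" if "i \<in> Nr - E2" for i
      using gap_bounds(1-4)[OF cok[OF that]] by (auto simp: cp_def cq_def)
    have cXg: "t \<le> cp i \<or> cq i \<le> t" if "i \<in> Nr - E2" "t \<in> Xg" for i t
      using gap_bounds(5)[OF cok[OF that(1)], of t t] that(2) by (auto simp: PB_def cp_def cq_def)
    have cin: "cp i \<in> Xg" "cq i \<in> Xg" for i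
    proof -
      have "snd ` PB = Xg" "fst ` PB = Xg" by (simp_all add: PB_def image_image)
      moreover have "0 \<in> Xg" "N \<in> Xg" by (simp_all add: Xg_def)
      ultimately show "cp i \<in> Xg" "cq i \<in> Xg"
        using gap_lo_in[OF finPB, of "x i"] gap_hi_in[OF finPB, of N "x i + w i"]
        unfolding cp_def cq_def by (metis insert_absorb)+
    qed
    define \<tau> where "\<tau> = es * N / c"
    have \<tau>0: "0 < \<tau>" using es N c by (simp add: \<tau>_def)
    define E3 where "E3 = {i \<in> Nr - E2. cq i - cp i < \<tau>}"
    define V where "V = Nr - E2 - E3"
    \<comment> \<open>The vertical blockers of the column from \<open>p\<close> to \<open>q\<close>
      are the H-gaps and the reserved spaces of \<open>L\<close> that span it. Their sides are cut
      lines, so each of them either spans the column or avoids it.\<close>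
    define YB where "YB p q = (\<lambda>k. (real (fst k) * g, (real (fst k) + 1) * g)) ` {k \<in> HH. fst (snd k) \<le> p \<and> q \<le> snd (snd k)}
       \<union> (\<lambda>l. (Y l, T l)) ` {l \<in> L. x l \<le> p \<and> q \<le> x l + w l}" for p q
    have finYB: "finite (YB p q)" for p q using finHH finL by (simp add: YB_def)
    have vok: "gap_ok Zt (YB (cp i) (cq i)) (Y i) (T i)" if i: "i \<in> Nr - E2" for i
      unfolding gap_ok_def
    proof (intro conjI finYB)
      have iS: "i \<in> S" using i by (simp add: Nr_def)
      show "0 \<le> Y i" "Y i < T i" "T i \<le> Zt" using Y0[OF iS] YT[of i] pos[OF iS] TZ[OF iS] by auto
      show "\<forall>(p, q)\<in>YB (cp i) (cq i). p \<le> q \<and> (q \<le> Y i \<or> T i \<le> p)"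
      proof
        fix z assume "z \<in> YB (cp i) (cq i)"
        then consider k where "k \<in> HH" "fst (snd k) \<le> cp i" "cq i \<le> snd (snd k)" "z = (real (fst k) * g, (real (fst k) + 1) * g)"
          | l where "l \<in> L" "x l \<le> cp i" "cq i \<le> x l + w l" "z = (Y l, T l)"
          by (auto simp: YB_def)
        then show "case z of (p, q) \<Rightarrow> p \<le> q \<and> (q \<le> Y i \<or> T i \<le> p)"
        proof cases
          case 1
          obtain j where j: "j \<in> F0" "k = gk j" using 1(1) by (auto simp: HH_def)
          have gj: "lo j \<le> x i" "x i + w i \<le> hi j" using 1 cpq[OF i] by (auto simp: j(2) gk_def)
          have z: "z = (real (rw j) * g, (real (rw j) + 1) * g)" using 1(4) by (simp add: j(2) gk_def)
          have rg: "real (rw j) * g \<le> (real (rw j) + 1) * g" using g0 by simp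
          \<comment> \<open>A tall item meeting this row would cover it and hence be a blocker of
            the gap of \<open>j\<close>. A flat item lies in a single row; in this row it would lie
            in the same gap and belong to \<open>Hg\<close>.\<close>
          have "(real (rw j) + 1) * g \<le> Y i \<or> T i \<le> real (rw j) * g"
          proof (cases "tall i")
            case True
            show ?thesis
            proof (rule ccontr)
              assume n: "\<not> ?thesis"
              then have "i \<in> cov (rw j)"
                using Ymul[OF True, of "rw j"] Tmul[OF True, of "rw j"] iS True by (auto simp: cov_def)
              then have "x i + w i \<le> lo j \<or> hi j \<le> x i"
                using gap_bounds(5)[OF gok[OF j(1)], of "x i" "x i + w i"] by (auto simp: Bl_def lo_def hi_def)
              then show False using gj pos[OF iS] by linarith
            qed
          next
            case False
            have iF: "i \<in> F0" using i False by (auto simp: Nr_def E1_def F0_def)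
            have Ti: "T i = Y i + h i" using False by (simp add: T_def)
            have hb: "Y i + h i \<le> (real (rw i) + 1) * g" using iF by (simp add: F0_def)
            show ?thesis
            proof (cases "rw i" "rw j" rule: linorder_cases)
              case less
              then have "(real (rw i) + 1) * g \<le> real (rw j) * g" using g0 by (intro mult_right_mono) auto
              then show ?thesis using hb Ti by linarith
            next
              case greater
              then have "(real (rw j) + 1) * g \<le> real (rw i) * g" using g0 by (intro mult_right_mono) auto
              then show ?thesis using rw(1)[OF iS] by linarith
            next
              case equal
              have "gk i = gk j \<or> hi i \<le> lo j \<or> hi j \<le> lo i" by (rule gapsep[OF iF j(1) equal])
              then have "gk i = gk j" using gj lohi[OF iF] pos[OF iS] by linarith
              then have "i \<in> Hg" using iF 1(1) j(2) by (simp add: Hg_def)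
              then show ?thesis using i by (simp add: Nr_def)
            qed
          qed
          then show ?thesis using rg by (simp add: z)
        next
          case 2
          have lS: "l \<in> S" "i \<noteq> l" using 2(1) i by (auto simp: L_def Nr_def)
          have "T l \<le> Y i \<or> T i \<le> Y l"
            using sep[OF iS lS] 2 cpq[OF i] pos[OF iS] by linarith
          then show ?thesis using YT[of l] pos[OF lS(1)] by (auto simp: 2(4))
        qed
      qed
    qed
    define vl where "vl i = gap_lo (YB (cp i) (cq i)) (Y i)" for i
    define vh where "vh i = gap_hi Zt (YB (cp i) (cq i)) (T i)" for i
    have vlh: "0 \<le> vl i" "vl i \<le> Y i" "T i \<le> vh i" "vh i \<le> Zt" if "i \<in> Nr - E2" for i
      using gap_bounds(1-4)[OF vok[OF that]] by (auto simp: vl_def vh_def)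
    have VN: "i \<in> Nr - E2" "i \<in> S" "\<not> wide i" "\<tau> \<le> cq i - cp i" if "i \<in> V" for i
      using that by (auto simp: V_def E3_def Nr_def)

    define E where "E = E1 \<union> E2 \<union> E3"
    have ZtN: "Zt + \<delta> * N / 4 = N" by (simp add: Zt_def algebra_simps)
    have esN: "0 < es * N" using es N by simp
    \<comment> \<open>The layers are the crossings of each row border, the rotated crossings of each
      cut line, and the rotated columns that are narrower than \<open>\<tau>\<close>.\<close>
    have EE: "fpk (es * N) N (\<delta> * N / 4) E"
    proof -
      have "fpk (es * N) N (es * N) {i \<in> E1. rw i = k}" for k
      proof -
        have "fpk (es * N) (N - 0) (es * N) {i \<in> E1. rw i = k}"
        proof (rule fpk_crossing[where \<phi> = \<psi> and t = "(real k + 1) * g"])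
          show "pairwise (\<lambda>i j. apart (pbox \<psi> i) (pbox \<psi> j)) {i \<in> E1. rw i = k}" by (rule ap') (auto simp: E1_def)
          fix i assume "i \<in> {i \<in> E1. rw i = k}"
          then have i: "i \<in> S" "\<not> tall i" "rw i = k" "(real (rw i) + 1) * g < Y i + h i" by (auto simp: E1_def)
          show "0 \<le> corner_x (\<psi> i) \<and> corner_x (\<psi> i) + placed_width \<psi> i \<le> N" using bnd[OF i(1)] by (simp add: cor d)
          show "corner_y (\<psi> i) < (real k + 1) * g \<and> (real k + 1) * g < corner_y (\<psi> i) + placed_height \<psi> i"
            using rw(2)[OF i(1)] i(3,4) by (simp add: cor d)
          show "placed_height \<psi> i \<le> es * N" using flat[OF i(1,2)] by (simp add: d)
        qed
        then show ?thesis by simp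
      qed
      then have "fpk (es * N) N (real (card {..<M}) * (es * N)) (\<Union>k\<in>{..<M}. {i \<in> E1. rw i = k})"
        using esN by (intro fpk_stack_family) auto
      moreover have "E1 \<subseteq> (\<Union>k\<in>{..<M}. {i \<in> E1. rw i = k})" using rwM by (auto simp: E1_def)
      ultimately have e1: "fpk (es * N) N (real M * (es * N)) E1" by (elim fpk_mono) auto
      have flipap: "pairwise (\<lambda>i j. apart (pbox (flip \<psi>) i) (pbox (flip \<psi>) j)) A" if "A \<subseteq> S" for A
        using ap'[OF that] by simp
      have Nrn: "i \<in> S" "w i \<le> es * N" "0 \<le> Y i" "Y i + h i \<le> N" if "i \<in> Nr" for i
      proof -
        show iS: "i \<in> S" using that by (simp add: Nr_def)
        show "w i \<le> es * N" "0 \<le> Y i" "Y i + h i \<le> N"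
          using narrow[OF iS] that Y0[OF iS] YT[of i] TZ[OF iS] by (auto simp: Nr_def)
      qed
      have "fpk (es * N) N (es * N) {i \<in> Nr. x i < t \<and> t < x i + w i}" for t
      proof -
        have "fpk (es * N) (N - 0) (es * N) {i \<in> Nr. x i < t \<and> t < x i + w i}"
        proof (rule fpk_crossing[where \<phi> = "flip \<psi>" and t = t])
          show "pairwise (\<lambda>i j. apart (pbox (flip \<psi>) i) (pbox (flip \<psi>) j)) {i \<in> Nr. x i < t \<and> t < x i + w i}"
            by (rule flipap) (auto simp: Nr_def)
        qed (use Nrn in \<open>auto simp: cor d\<close>)
        then show ?thesis by simp
      qed
      then have "fpk (es * N) N (real (card Xg) * (es * N)) (\<Union>t\<in>Xg. {i \<in> Nr. x i < t \<and> t < x i + w i})"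
        using esN finXg by (intro fpk_stack_family) auto
      moreover have "E2 \<subseteq> (\<Union>t\<in>Xg. {i \<in> Nr. x i < t \<and> t < x i + w i})" by (auto simp: E2_def)
      moreover have "real (card Xg) * (es * N) \<le> real nX * (es * N)"
        using cardXg esN by (intro mult_right_mono) auto
      ultimately have e2: "fpk (es * N) N (real nX * (es * N)) E2" by (elim fpk_mono) auto
      have "fpk (es * N) N \<tau> {i \<in> E3. cp i = fst p \<and> cq i = snd p}" for p
      proof (rule fpk_shiftI[where \<phi> = "flip \<psi>" and x = 0 and y = "fst p"])
        show "pairwise (\<lambda>i j. apart (pbox (flip \<psi>) i) (pbox (flip \<psi>) j)) {i \<in> E3. cp i = fst p \<and> cq i = snd p}"
          by (rule flipap) (auto simp: E3_def Nr_def)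
        fix i assume "i \<in> {i \<in> E3. cp i = fst p \<and> cq i = snd p}"
        then have i: "i \<in> Nr - E2" "i \<in> Nr" "cp i = fst p" "cq i = snd p" "cq i - cp i < \<tau>" by (auto simp: E3_def)
        show "boxin (pbox (flip \<psi>) i) (0, fst p, N, \<tau>)"
          using cpq[OF i(1)] Nrn[OF i(2)] i(3-5) by (simp add: pb2)
        show "placed_height (flip \<psi>) i \<le> es * N" using Nrn[OF i(2)] by (simp add: d)
      qed
      then have "fpk (es * N) N (real (card (Xg \<times> Xg)) * \<tau>) (\<Union>p\<in>Xg \<times> Xg. {i \<in> E3. cp i = fst p \<and> cq i = snd p})"
        using \<tau>0 finXg by (intro fpk_stack_family) auto
      moreover have "E3 \<subseteq> (\<Union>p\<in>Xg \<times> Xg. {i \<in> E3. cp i = fst p \<and> cq i = snd p})" using cin by auto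
      moreover have "real (card (Xg \<times> Xg)) * \<tau> \<le> real (nX * nX) * \<tau>"
      proof -
        have "card (Xg \<times> Xg) \<le> nX * nX" unfolding card_cartesian_product using cardXg by (intro mult_le_mono)
        then have "real (card (Xg \<times> Xg)) \<le> real (nX * nX)" by (rule of_nat_mono)
        then show ?thesis using \<tau>0 by (intro mult_right_mono) auto
      qed
      ultimately have e3: "fpk (es * N) N (real (nX * nX) * \<tau>) E3" by (elim fpk_mono) auto
      have "fpk (es * N) N (real M * (es * N) + real nX * (es * N)) (E1 \<union> E2)"
        by (rule fpk_stack[OF e1 e2]) (use esN in simp_all)
      then have "fpk (es * N) N (real M * (es * N) + real nX * (es * N) + real (nX * nX) * \<tau>) E"
        unfolding E_def by (rule fpk_stack[OF _ e3]) (use esN \<tau>0 in simp_all)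
      moreover have "real M * (es * N) + real nX * (es * N) + real (nX * nX) * \<tau> \<le> \<delta> * N / 4"
      proof -
        have "es \<le> (\<delta> / 4) / (real M + real nX + real (nX * nX) / c)" using es(2) by (simp add: \<rho>_def)
        then have "es * (real M + real nX + real (nX * nX) / c) \<le> \<delta> / 4" using pos_le_divide_eq[OF den] by blast
        then have "es * (real M + real nX + real (nX * nX) / c) * N \<le> \<delta> / 4 * N" using N by (intro mult_right_mono) auto
        then show ?thesis by (simp add: \<tau>_def algebra_simps)
      qed
      ultimately show ?thesis by (elim fpk_mono) auto
    qed
    have Esub: "E \<subseteq> S" by (auto simp: E_def E1_def E2_def E3_def Nr_def)
    have esc: "es * N \<le> c * g" "es * N \<le> c * (\<delta> * N / 4)"
    proof -
      have "es \<le> c * \<delta> * el / 4" using es(2) by (simp add: \<rho>_def)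
      then have "es * N \<le> c * \<delta> * el / 4 * N" using N by (intro mult_right_mono) auto
      then show "es * N \<le> c * g" by (simp add: g_def)
      moreover have "c * g \<le> c * (\<delta> * N / 4)" using g1 c by (intro mult_left_mono) auto
      ultimately show "es * N \<le> c * (\<delta> * N / 4)" by linarith
    qed
    (* Four kinds of boxes: single large items, the free strip, H-gaps, and runs of a column. *)
    define \<kappa> where "\<kappa> i = (if i \<in> L then (Some i, 0::nat, (x i, Y i, w i, h i))
       else if i \<in> E then (None, 1, (0, Zt, N, \<delta> * N / 4))
       else if i \<in> Hg then (None, 2, (lo i, real (rw i) * g, hi i - lo i, g))
       else (None, 3, (cp i, vl i, cq i - cp i, vh i - vl i)))" for i
    have cases: "i \<in> L \<or> i \<in> E - L \<or> i \<in> Hg - E - L \<or> i \<in> V - Hg - E - L" if "i \<in> S" for i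
    proof -
      have "i \<in> V" if "i \<notin> L" "i \<notin> E" "i \<notin> Hg"
      proof -
        have "\<not> wide i" using wideHg[of i] that \<open>i \<in> S\<close> by (auto simp: L_def E_def)
        then show ?thesis using that \<open>i \<in> S\<close> by (auto simp: V_def Nr_def E_def)
      qed
      then show ?thesis by blast
    qed
    have k0: "\<kappa> i = (Some i, 0, (x i, Y i, w i, h i))" if "i \<in> L" for i using that by (simp add: \<kappa>_def)
    have k1: "\<kappa> i = (None, 1, (0, Zt, N, \<delta> * N / 4))" if "i \<in> E - L" for i using that by (simp add: \<kappa>_def)
    have k2: "\<kappa> i = (None, 2, (lo i, real (rw i) * g, hi i - lo i, g))" if "i \<in> Hg - E - L" for i using that by (simp add: \<kappa>_def)
    have k3: "\<kappa> i = (None, 3, (cp i, vl i, cq i - cp i, vh i - vl i))" if "i \<in> V - Hg - E - L" for i using that by (simp add: \<kappa>_def)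
    have HgF: "i \<in> F0" "i \<in> S" "\<not> tall i" "Y i + h i \<le> (real (rw i) + 1) * g" if "i \<in> Hg" for i
      using that by (auto simp: Hg_def F0_def)
    have kg: "(real k + 1) * g = real k * g + g" for k by (simp add: algebra_simps)
    have rowZ: "real (rw i) * g + g \<le> Zt" if "i \<in> S" for i
    proof -
      have "real (rw i) * g \<le> (1 - \<delta> / 2) * N" using rw(1)[OF that] YT[of i] Ttop[OF that] pos[OF that] by linarith
      then show ?thesis using g1 by (simp add: Zt_def algebra_simps)
    qed
    have "good \<epsilon> (3 * \<epsilon>) (KK * (KB + 1)) N N S"
    proof (rule good_glue[where \<kappa> = \<kappa> and bx = "\<lambda>k. snd (snd k)", OF S])
      fix j assume "j \<in> \<kappa> ` S"
      then obtain i where i: "i \<in> S" "j = \<kappa> i" by auto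
      define Q where "Q = {i' \<in> S. \<kappa> i' = j}"
      have vQ: "valid Q" by (rule valid_subset[OF S]) (auto simp: Q_def)
      have QS: "Q \<subseteq> S" by (auto simp: Q_def)
      have up: "good \<epsilon> (3 * \<epsilon>) (KB + 1) W Z Q" if "good \<epsilon> (3 * \<epsilon>) KB W Z Q" for W Z
        using that by (rule good_mono[OF _ vQ]) auto
      have "boxin (snd (snd j)) (0, 0, N, N) \<and>
         (case snd (snd j) of (x, y, w, h) \<Rightarrow> good \<epsilon> (3 * \<epsilon>) (KB + 1) w h Q)"
        using cases[OF i(1)]
      proof (elim disjE)
        assume L: "i \<in> L"
        have Qi: "i' = i" if "i' \<in> Q" for i'
        proof -
          have "\<kappa> i' = (Some i, 0, (x i, Y i, w i, h i))" using that i k0[OF L] by (simp add: Q_def)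
          then show ?thesis by (auto simp: \<kappa>_def split: if_splits)
        qed
        have "Q = {i}" using Qi i by (auto simp: Q_def)
        moreover have "good \<epsilon> (3 * \<epsilon>) (KB + 1) (w i) (h i) {i}"
          unfolding w_def h_def by (rule good_single) (use S i \<epsilon> in \<open>auto simp: valid_def\<close>)
        ultimately show ?thesis
          using bnd[OF i(1)] Y0[OF i(1)] YT[of i] TZ[OF i(1)] by (simp add: i(2) k0[OF L])
      next
        assume E: "i \<in> E - L"
        have "Q \<subseteq> E" using i k1[OF E] by (auto simp: Q_def \<kappa>_def split: if_splits)
        then have "fpk (c * (\<delta> * N / 4)) N (\<delta> * N / 4) Q" using EE esc(2) by (elim fpk_mono) auto
        then have "good \<epsilon> (3 * \<epsilon>) KB N (\<delta> * N / 4) Q" using B N \<delta> vQ by simp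
        moreover have "0 \<le> Zt" using N \<delta> by (simp add: Zt_def)
        ultimately show ?thesis using up ZtN by (simp add: i(2) k1[OF E])
      next
        assume H: "i \<in> Hg - E - L"
        have Qp: "i' \<in> Hg \<and> lo i' = lo i \<and> real (rw i') * g = real (rw i) * g \<and> hi i' = hi i" if "i' \<in> Q" for i'
          using that i k2[OF H] by (auto simp: Q_def \<kappa>_def split: if_splits)
        have iF: "i \<in> F0" using H by (simp add: Hg_def)
        have "fpk (c * g) (hi i - lo i) g Q"
        proof (rule fpk_shiftI[where \<phi> = \<psi> and x = "lo i" and y = "real (rw i) * g"])
          show "pairwise (\<lambda>i j. apart (pbox \<psi> i) (pbox \<psi> j)) Q" by (rule ap'[OF QS])
          fix i' assume "i' \<in> Q"
          then have q: "i' \<in> Hg" "lo i' = lo i" "real (rw i') * g = real (rw i) * g" "hi i' = hi i" using Qp by auto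
          show "boxin (pbox \<psi> i') (lo i, real (rw i) * g, hi i - lo i, g)"
            using lohi[OF HgF(1)[OF q(1)]] rw(1)[OF HgF(2)[OF q(1)]] HgF(4)[OF q(1)] q(2-4) by (simp add: pb2 kg)
          show "placed_height \<psi> i' \<le> c * g" using flat[OF HgF(2,3)[OF q(1)]] esc(1) by (simp add: d)
        qed
        moreover have "0 < hi i - lo i" using lohi[OF iF] pos[OF i(1)] by linarith
        ultimately have "good \<epsilon> (3 * \<epsilon>) KB (hi i - lo i) g Q" using B g0 vQ by simp
        moreover have "real (rw i) * g + g \<le> N" using rowZ[OF i(1)] ZtN \<delta> N by (smt (verit) mult_pos_pos divide_pos_pos)
        ultimately show ?thesis using up lohi[OF iF] g0 by (simp add: i(2) k2[OF H])
      next
        assume V: "i \<in> V - Hg - E - L"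
        then have iV: "i \<in> V" by simp
        have Qp: "i' \<in> V \<and> cp i' = cp i \<and> vl i' = vl i \<and> cq i' = cq i \<and> vh i' = vh i" if "i' \<in> Q" for i'
        proof -
          have e: "\<kappa> i' = (None, 3, (cp i, vl i, cq i - cp i, vh i - vl i))" using that i k3[OF V] by (simp add: Q_def)
          then have "i' \<in> V" using cases[of i'] that k0[of i'] k1[of i'] k2[of i'] QS by auto
          then show ?thesis using e by (auto simp: \<kappa>_def split: if_splits)
        qed
        have "fpk (es * N) (vh i - vl i) (cq i - cp i) Q"
        proof (rule fpk_shiftI[where \<phi> = "flip \<psi>" and x = "vl i" and y = "cp i"])
          show "pairwise (\<lambda>i j. apart (pbox (flip \<psi>) i) (pbox (flip \<psi>) j)) Q" using ap'[OF QS] by simp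
          fix i' assume "i' \<in> Q"
          then have q: "i' \<in> V" "cp i' = cp i" "vl i' = vl i" "cq i' = cq i" "vh i' = vh i" using Qp by auto
          show "boxin (pbox (flip \<psi>) i') (vl i, cp i, vh i - vl i, cq i - cp i)"
            using vlh[OF VN(1)[OF q(1)]] cpq[OF VN(1)[OF q(1)]] YT[of i'] q(2-5) by (simp add: pb2)
          show "placed_height (flip \<psi>) i' \<le> es * N" using narrow[OF VN(2,3)[OF q(1)]] by (simp add: d)
        qed
        moreover have "es * N \<le> c * (cq i - cp i)"
        proof -
          have "c * \<tau> \<le> c * (cq i - cp i)" using VN(4)[OF iV] c by (intro mult_left_mono) auto
          then show ?thesis using c by (simp add: \<tau>_def)
        qed
        ultimately have "fpk (c * (cq i - cp i)) (vh i - vl i) (cq i - cp i) Q" by (elim fpk_mono) auto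
        moreover have "0 < vh i - vl i" using vlh[OF VN(1)[OF iV]] YT[of i] pos[OF i(1)] by linarith
        moreover have "0 < cq i - cp i" using VN(4)[OF iV] \<tau>0 by linarith
        ultimately have "good \<epsilon> (3 * \<epsilon>) KB (vh i - vl i) (cq i - cp i) Q" using B vQ by simp
        then have "good \<epsilon> (3 * \<epsilon>) KB (cq i - cp i) (vh i - vl i) Q" by (rule good_flip)
        moreover have "Zt \<le> N" using ZtN \<delta> N by (smt (verit) mult_pos_pos divide_pos_pos)
        ultimately show ?thesis using up cpq[OF VN(1)[OF iV]] vlh[OF VN(1)[OF iV]] by (simp add: i(2) k3[OF V])
      qed
      then show "boxin (snd (snd j)) (0, 0, N, N)"
        "case snd (snd j) of (x, y, w, h) \<Rightarrow> good \<epsilon> (3 * \<epsilon>) (KB + 1) w h {i \<in> S. \<kappa> i = j}"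
        unfolding Q_def by simp_all
    next
      fix j j' assume "j \<in> \<kappa> ` S" "j' \<in> \<kappa> ` S" and ne: "j \<noteq> j'"
      then obtain i i' where i: "i \<in> S" "j = \<kappa> i" and i': "i' \<in> S" "j' = \<kappa> i'" by auto
      define bb where "bb i = snd (snd (\<kappa> i))" for i
      have LL: "apart (bb l) (bb l')" if "l \<in> L" "l' \<in> L" "l \<noteq> l'" for l l'
        using ap[of l l'] that by (auto simp: bb_def k0 pb2 L_def)
      have top: "\<exists>a b c d. bb i = (a, b, c, d) \<and> b + d \<le> Zt" if "i \<in> S" "i \<notin> E - L" for i
        using cases[OF that(1)]
      proof (elim disjE)
        assume "i \<in> L" then show ?thesis using YT[of i] TZ[OF that(1)] by (simp add: bb_def k0)
      next
        assume "i \<in> E - L" then show ?thesis using that by simp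
      next
        assume "i \<in> Hg - E - L" then show ?thesis using rowZ[OF that(1)] by (simp add: bb_def k2)
      next
        assume a: "i \<in> V - Hg - E - L" then show ?thesis using vlh[OF VN(1), of i] by (simp add: bb_def k3)
      qed
      have ET: "apart (bb e) (bb i)" if "e \<in> E - L" "i \<in> S" "i \<notin> E - L" for e i
        using top[OF that(2,3)] k1[OF that(1)] by (auto simp: bb_def apart_def)
      have LH: "apart (bb l) (bb i)" if l: "l \<in> L" and i: "i \<in> Hg - E - L" for l i
      proof (cases "l \<in> cov (rw i)")
        case True
        have "x l + w l \<le> lo i \<or> hi i \<le> x l"
          using gap_bounds(5)[OF gok[of i], of "x l" "x l + w l"] True i HgF by (auto simp: Bl_def lo_def hi_def)
        then show ?thesis by (auto simp: bb_def k0[OF l] k2[OF i] apart_def)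
      next
        case False
        have t: "tall l" "l \<in> S" using l by (auto simp: L_def)
        then have "T l \<le> real (rw i) * g \<or> (real (rw i) + 1) * g \<le> Y l"
          using Ymul[OF t(1), of "rw i"] Tmul[OF t(1), of "rw i"] False by (auto simp: cov_def)
        then show ?thesis using YT[of l] by (auto simp: bb_def k0[OF l] k2[OF i] apart_def kg)
      qed
      have LV: "apart (bb l) (bb i)" if l: "l \<in> L" and i: "i \<in> V - Hg - E - L" for l i
      proof -
        have iN: "i \<in> Nr - E2" using i VN(1) by blast
        have "x l \<in> Xg" "x l + w l \<in> Xg" using l by (auto simp: Xg_def)
        then have e: "x l \<le> cp i \<or> cq i \<le> x l" "x l + w l \<le> cp i \<or> cq i \<le> x l + w l" using cXg[OF iN] by auto
        show ?thesis
        proof (cases "x l \<le> cp i \<and> cq i \<le> x l + w l")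
          case True
          then have "(Y l, T l) \<in> YB (cp i) (cq i)" using l by (auto simp: YB_def)
          then have "T l \<le> vl i \<or> vh i \<le> Y l" using gap_bounds(5)[OF vok[OF iN]] by (auto simp: vl_def vh_def)
          then show ?thesis using YT[of l] by (auto simp: bb_def k0[OF l] k3[OF i] apart_def)
        next
          case False
          then show ?thesis using e by (auto simp: bb_def k0[OF l] k3[OF i] apart_def)
        qed
      qed
      have HV: "apart (bb u) (bb i)" if u: "u \<in> Hg - E - L" and i: "i \<in> V - Hg - E - L" for u i
      proof -
        have iN: "i \<in> Nr - E2" using i VN(1) by blast
        have uH: "gk u \<in> HH" using u by (simp add: Hg_def)
        then have "lo u \<in> Xg" "hi u \<in> Xg" unfolding Xg_def by (force simp: gk_def)+
        then have e: "lo u \<le> cp i \<or> cq i \<le> lo u" "hi u \<le> cp i \<or> cq i \<le> hi u" using cXg[OF iN] by auto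
        show ?thesis
        proof (cases "lo u \<le> cp i \<and> cq i \<le> hi u")
          case True
          then have "gk u \<in> {k \<in> HH. fst (snd k) \<le> cp i \<and> cq i \<le> snd (snd k)}" using uH by (simp add: gk_def)
          then have "(real (fst (gk u)) * g, (real (fst (gk u)) + 1) * g) \<in> YB (cp i) (cq i)" unfolding YB_def by blast
          then have "(real (rw u) + 1) * g \<le> vl i \<or> vh i \<le> real (rw u) * g"
            using gap_bounds(5)[OF vok[OF iN]] by (auto simp: vl_def vh_def gk_def)
          then show ?thesis by (auto simp: bb_def k2[OF u] k3[OF i] apart_def kg)
        next
          case False
          then show ?thesis using e by (auto simp: bb_def k2[OF u] k3[OF i] apart_def)
        qed
      qed
      have HH: "apart (bb u) (bb i)" if u: "u \<in> Hg - E - L" and i: "i \<in> Hg - E - L" and n: "\<kappa> u \<noteq> \<kappa> i" for u i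
      proof (cases "rw u" "rw i" rule: linorder_cases)
        case less
        then have "(real (rw u) + 1) * g \<le> real (rw i) * g" using g0 by (intro mult_right_mono) auto
        then show ?thesis by (auto simp: bb_def k2[OF u] k2[OF i] apart_def kg)
      next
        case greater
        then have "(real (rw i) + 1) * g \<le> real (rw u) * g" using g0 by (intro mult_right_mono) auto
        then show ?thesis by (auto simp: bb_def k2[OF u] k2[OF i] apart_def kg)
      next
        case equal
        have "gk u = gk i \<or> hi u \<le> lo i \<or> hi i \<le> lo u" using u i equal by (intro gapsep HgF) auto
        moreover have "gk u \<noteq> gk i" using n by (auto simp: k2[OF u] k2[OF i] gk_def)
        ultimately show ?thesis by (auto simp: bb_def k2[OF u] k2[OF i] apart_def)
      qed
      have VV: "apart (bb u) (bb i)" if u: "u \<in> V - Hg - E - L" and i: "i \<in> V - Hg - E - L" and n: "\<kappa> u \<noteq> \<kappa> i" for u i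
      proof -
        have iN: "i \<in> Nr - E2" "u \<in> Nr - E2" using i u VN(1) by blast+
        have "cp u = cp i \<and> cq u = cq i \<or> cq u \<le> cp i \<or> cq i \<le> cp u"
          using gap_eq_or_separated[OF cok[OF iN(2)] cok[OF iN(1)]] by (simp add: cp_def cq_def)
        moreover have "apart (bb u) (bb i)" if e: "cp u = cp i" "cq u = cq i"
        proof -
          have "vl u = vl i \<and> vh u = vh i \<or> vh u \<le> vl i \<or> vh i \<le> vl u"
            using gap_eq_or_separated[OF vok[OF iN(2), unfolded e] vok[OF iN(1)]] by (simp add: vl_def vh_def e)
          then show ?thesis using n e by (auto simp: bb_def k3[OF u] k3[OF i] apart_def)
        qed
        ultimately show ?thesis by (auto simp: bb_def k3[OF u] k3[OF i] apart_def)
      qed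
      have "apart (bb i) (bb i')"
      proof (cases "i \<in> E - L \<or> i' \<in> E - L")
        case True
        then have "\<not> (i \<in> E - L \<and> i' \<in> E - L)" using ne k1[of i] k1[of i'] unfolding i i' by metis
        then show ?thesis using True ET[of i i'] ET[of i' i] i(1) i'(1) apart_sym by blast
      next
        case False
        then have c: "i \<in> L \<or> i \<in> Hg - E - L \<or> i \<in> V - Hg - E - L" "i' \<in> L \<or> i' \<in> Hg - E - L \<or> i' \<in> V - Hg - E - L"
          using cases[OF i(1)] cases[OF i'(1)] by blast+
        have n: "\<kappa> i \<noteq> \<kappa> i'" "\<kappa> i' \<noteq> \<kappa> i" "i \<noteq> i'" using ne i i' by auto
        show ?thesis
          using c(1)
        proof (elim disjE)
          assume a: "i \<in> L"
          show ?thesis using c(2) LL[OF a _ n(3)] LH[OF a] LV[OF a] by blast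
        next
          assume a: "i \<in> Hg - E - L"
          show ?thesis using c(2) LH[OF _ a] HH[OF a _ n(1)] HV[OF a] apart_sym by blast
        next
          assume a: "i \<in> V - Hg - E - L"
          show ?thesis using c(2) LV[OF _ a] HV[OF _ a] VV[OF a _ n(1)] apart_sym by blast
        qed
      qed
      then show "apart (snd (snd j)) (snd (snd j'))" by (simp add: bb_def i i')
    next
      define YL where "YL = insert 0 ((\<lambda>k. (real (fst k) + 1) * g) ` HH \<union> T ` L)"
      define YH where "YH = insert Zt ((\<lambda>k. real (fst k) * g) ` HH \<union> Y ` L)"
      define D where "D = (\<lambda>i. (Some i, 0::nat, (x i, Y i, w i, h i))) ` L"
      define D2 where "D2 = (\<lambda>k. (None :: item option, 2::nat, (fst (snd k), real (fst k) * g, snd (snd k) - fst (snd k), g))) ` HH"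
      define D3 where "D3 = (\<lambda>(p, q, u, v). (None :: item option, 3::nat, (p, u, q - p, v - u))) ` (Xg \<times> Xg \<times> YL \<times> YH)"
      have fYL: "finite YL" "finite YH" using finHH finL by (auto simp: YL_def YH_def)
      have cYL: "card YL \<le> 1 + nH + nL"
      proof -
        have "card YL \<le> Suc (card ((\<lambda>k. (real (fst k) + 1) * g) ` HH \<union> T ` L))" unfolding YL_def using finHH finL by (simp add: card_insert_if)
        also have "\<dots> \<le> Suc (card ((\<lambda>k. (real (fst k) + 1) * g) ` HH) + card (T ` L))" using card_Un_le by simp
        also have "\<dots> \<le> Suc (card HH + card L)" using card_image_le[OF finHH] card_image_le[OF finL] by (meson Suc_le_mono add_mono)
        finally show ?thesis using cardHH cardL by simp
      qed
      have cYH: "card YH \<le> 1 + nH + nL"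
      proof -
        have "card YH \<le> Suc (card ((\<lambda>k. real (fst k) * g) ` HH \<union> Y ` L))" unfolding YH_def using finHH finL by (simp add: card_insert_if)
        also have "\<dots> \<le> Suc (card ((\<lambda>k. real (fst k) * g) ` HH) + card (Y ` L))" using card_Un_le by simp
        also have "\<dots> \<le> Suc (card HH + card L)" using card_image_le[OF finHH] card_image_le[OF finL] by (meson Suc_le_mono add_mono)
        finally show ?thesis using cardHH cardL by simp
      qed
      have sub: "\<kappa> ` S \<subseteq> D \<union> D2 \<union> D3 \<union> {(None, 1, (0, Zt, N, \<delta> * N / 4))}"
      proof
        fix j assume "j \<in> \<kappa> ` S"
        then obtain i where i: "i \<in> S" "j = \<kappa> i" by auto
        show "j \<in> D \<union> D2 \<union> D3 \<union> {(None, 1, (0, Zt, N, \<delta> * N / 4))}"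
          using cases[OF i(1)]
        proof (elim disjE)
          assume "i \<in> L" then show ?thesis by (auto simp: i(2) k0 D_def)
        next
          assume "i \<in> E - L" then show ?thesis by (simp add: i(2) k1)
        next
          assume a: "i \<in> Hg - E - L"
          then have "gk i \<in> HH" by (simp add: Hg_def)
          then have "\<kappa> i \<in> D2" unfolding D2_def k2[OF a] by (rule rev_image_eqI) (simp add: gk_def)
          then show ?thesis by (simp add: i(2))
        next
          assume a: "i \<in> V - Hg - E - L"
          have "snd ` YB (cp i) (cq i) \<subseteq> (\<lambda>k. (real (fst k) + 1) * g) ` HH \<union> T ` L"
            "fst ` YB (cp i) (cq i) \<subseteq> (\<lambda>k. real (fst k) * g) ` HH \<union> Y ` L"
            unfolding YB_def image_Un image_image fst_conv snd_conv by (intro Un_mono image_mono; blast)+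
          then have "vl i \<in> YL" "vh i \<in> YH"
            using gap_lo_in[OF finYB, of "cp i" "cq i" "Y i"] gap_hi_in[OF finYB, of Zt "cp i" "cq i" "T i"]
            unfolding vl_def vh_def YL_def YH_def by blast+
          then have "(cp i, cq i, vl i, vh i) \<in> Xg \<times> Xg \<times> YL \<times> YH" using cin by simp
          then have "\<kappa> i \<in> D3" unfolding D3_def k3[OF a] by (rule rev_image_eqI) simp
          then show ?thesis by (simp add: i(2))
        qed
      qed
      have c3: "card D3 \<le> (nX * nX) * ((1 + nH + nL) * (1 + nH + nL))"
      proof -
        have "card D3 \<le> card (Xg \<times> Xg \<times> YL \<times> YH)" unfolding D3_def using finXg fYL by (intro card_image_le) simp
        also have "\<dots> = (card Xg * card Xg) * (card YL * card YH)" by (simp add: card_cartesian_product)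
        also have "\<dots> \<le> (nX * nX) * ((1 + nH + nL) * (1 + nH + nL))" using cardXg cYL cYH by (intro mult_le_mono)
        finally show ?thesis .
      qed
      have c12: "card D \<le> nL" "card D2 \<le> nH"
        using card_image_le[OF finL] card_image_le[OF finHH] cardL cardHH unfolding D_def D2_def by (meson order_trans)+
      have "finite (D \<union> D2 \<union> D3 \<union> {(None, 1, (0, Zt, N, \<delta> * N / 4))})"
        using finL finHH finXg fYL by (simp add: D_def D2_def D3_def)
      then have "card (\<kappa> ` S) \<le> card (D \<union> D2 \<union> D3 \<union> {(None, 1, (0, Zt, N, \<delta> * N / 4))})" using sub by (rule card_mono)
      also have "\<dots> \<le> card D + card D2 + card D3 + card {(None :: item option, 1 :: nat, (0 :: real, Zt, N, \<delta> * N / 4))}"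
        by (meson add_mono card_Un_le le_refl order_trans)
      finally show "card (\<kappa> ` S) \<le> KK" using c12 c3 by (simp add: KK_def)
    qed
    then show ?thesis .
  qed
  show ?thesis
    by (intro exI[of _ \<rho>] conjI \<rho>0 exI[of _ "KK * (KB + 1)"] allI impI) (elim conjE, rule main; assumption)
qed

text \<open>\<open>augmented_core\<close> provides a required ratio of scales for each
  \<open>el\<close>. \<open>scale_gap\<close> is run with this ratio, and the items of medium width
  or height cost another share \<open>\<epsilon>\<close>. \<open>K\<close> is a maximum over the
  finitely many scales.\<close>

lemma augmented:
  assumes \<epsilon>: "0 < \<epsilon>" "\<epsilon> \<le> 1 / 6" and \<delta>: "0 < \<delta>" "\<delta> \<le> 1 / 2"
  shows "\<exists>K. \<forall>N S \<phi>. 0 < N \<and> valid S \<and> fits \<phi> S N ((1 - \<delta>) * N) \<longrightarrow> good \<epsilon> (4 * \<epsilon>) K N N S"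
proof -
  define Q where "Q el \<rho> K \<longleftrightarrow> (\<forall>N S \<phi> es. 0 < N \<and> valid S \<and> fits \<phi> S N ((1 - \<delta>) * N) \<and> 0 < es \<and> es \<le> \<rho> \<and> es < el \<and>
     (\<forall>i\<in>S. (placed_width \<phi> i \<le> es * N \<or> el * N < placed_width \<phi> i) \<and>
            (placed_height \<phi> i \<le> es * N \<or> el * N < placed_height \<phi> i)) \<longrightarrow>
     good \<epsilon> (3 * \<epsilon>) K N N S)" for el \<rho> K
  have "\<forall>el. \<exists>p. 0 < fst p \<and> (0 < el \<and> el \<le> 1 \<longrightarrow> Q el (fst p) (snd p))"
  proof
    fix el
    show "\<exists>p. 0 < fst p \<and> (0 < el \<and> el \<le> 1 \<longrightarrow> Q el (fst p) (snd p))"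
    proof (cases "0 < el \<and> el \<le> 1")
      case True
      then obtain \<rho> K where "0 < \<rho>" "Q el \<rho> K" using augmented_core[OF \<epsilon> \<delta>, of el] unfolding Q_def by blast
      then show ?thesis by (intro exI[of _ "(\<rho>, K)"]) simp
    next
      case False
      then show ?thesis by (intro exI[of _ "(1, 0)"]) auto
    qed
  qed
  from choice[OF this] obtain P where P: "\<And>e. 0 < fst (P e)" "\<And>e. 0 < e \<Longrightarrow> e \<le> 1 \<Longrightarrow> Q e (fst (P e)) (snd (P e))"
    by blast
  have "\<exists>E. finite E \<and> E \<noteq> {} \<and> E \<subseteq> {0<..1} \<and>
      (\<forall>S fs N. valid S \<and> length fs \<le> 2 \<longrightarrow>
       (\<exists>a\<in>E. \<exists>b\<in>E. b \<le> fst (P a) \<and> b < a \<and>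
          profit {i \<in> S. \<exists>f\<in>set fs. b * N < f i \<and> f i \<le> a * N} \<le> \<epsilon> * profit S))"
    by (rule scale_gap) (use P(1) \<epsilon> in simp_all)
  then obtain E where E: "finite E" "E \<noteq> {}" "E \<subseteq> {0<..1}"
    and sg: "\<forall>S fs N. valid S \<and> length fs \<le> 2 \<longrightarrow>
       (\<exists>a\<in>E. \<exists>b\<in>E. b \<le> fst (P a) \<and> b < a \<and>
          profit {i \<in> S. \<exists>f\<in>set fs. b * N < f i \<and> f i \<le> a * N} \<le> \<epsilon> * profit S)"
    by (elim exE conjE) (rule that; assumption)
  define K where "K = Max ((\<lambda>\<omega>. snd (P \<omega>)) ` E)"
  have main: "good \<epsilon> (4 * \<epsilon>) K N N S" if N: "0 < N" and S: "valid S" and f: "fits \<phi> S N ((1 - \<delta>) * N)" for N S \<phi>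
  proof -
    obtain a b where ab: "a \<in> E" "b \<in> E" "b \<le> fst (P a)" "b < a"
      and pr: "profit {i \<in> S. \<exists>f\<in>set [placed_width \<phi>, placed_height \<phi>]. b * N < f i \<and> f i \<le> a * N} \<le> \<epsilon> * profit S"
      using sg[rule_format, of S "[placed_width \<phi>, placed_height \<phi>]" N] S by auto
    define M where "M = {i \<in> S. \<exists>f\<in>set [placed_width \<phi>, placed_height \<phi>]. b * N < f i \<and> f i \<le> a * N}"
    define S1 where "S1 = S - M"
    have S1: "S1 \<subseteq> S" "valid S1" using valid_subset[OF S] by (auto simp: S1_def)
    have "M \<subseteq> S" by (auto simp: M_def)
    then have "profit S1 = profit S - profit M" unfolding S1_def using S by (intro profit_Diff) (simp_all add: valid_def)
    then have p1: "profit S1 \<ge> (1 - \<epsilon>) * profit S" using pr by (simp add: M_def algebra_simps)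
    have a01: "0 < a" "a \<le> 1" "0 < b" using E(3) ab by auto
    have "good \<epsilon> (3 * \<epsilon>) (snd (P a)) N N S1"
    proof (rule P(2)[OF a01(1,2), unfolded Q_def, rule_format, of N S1 \<phi> b], intro conjI)
      show "fits \<phi> S1 N ((1 - \<delta>) * N)" by (rule fits_subset[OF f S1(1)])
      show "\<forall>i\<in>S1. (placed_width \<phi> i \<le> b * N \<or> a * N < placed_width \<phi> i) \<and>
            (placed_height \<phi> i \<le> b * N \<or> a * N < placed_height \<phi> i)"
        by (auto simp: S1_def M_def)
    qed (use N S1 a01 ab in simp_all)
    moreover have "snd (P a) \<le> K" unfolding K_def using E(1) ab(1) by (intro Max_ge) auto
    ultimately have "good \<epsilon> (3 * \<epsilon>) K N N S1" by (elim good_mono) (use S1 in auto)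
    then have "good \<epsilon> (3 * \<epsilon> + \<epsilon>) K N N S"
      by (rule good_subset[OF _ S S1(1) p1]) (use \<epsilon> in simp_all)
    then show ?thesis by simp
  qed
  show ?thesis by (intro exI[of _ K] allI impI) (elim conjE, rule main; assumption)
qed

subsection \<open>Resource contraction\<close>

text \<open>The last four entries measure how far an item reaches from each side of the knapsack.
  With no value between the scales, an item inside a margin of width \<open>el * N\<close> even lies
  inside the margin of width \<open>es * N\<close>.\<close>

definition params :: "(item \<Rightarrow> placement) \<Rightarrow> real \<Rightarrow> (item \<Rightarrow> real) list" where
  "params \<phi> N = [placed_width \<phi>, placed_height \<phi>,
     \<lambda>i. corner_x (\<phi> i) + placed_width \<phi> i, \<lambda>i. N - corner_x (\<phi> i),
     \<lambda>i. corner_y (\<phi> i) + placed_height \<phi> i, \<lambda>i. N - corner_y (\<phi> i)]"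

definition scale_ok :: "(item \<Rightarrow> placement) \<Rightarrow> real \<Rightarrow> item set \<Rightarrow> real \<Rightarrow> real \<Rightarrow> bool" where
  "scale_ok \<phi> N R es el \<longleftrightarrow> (\<forall>i\<in>R. \<forall>f\<in>set (params \<phi> N). f i \<le> es * N \<or> el * N < f i)"

lemma scale_ok_flip: "scale_ok \<phi> N R es el \<Longrightarrow> scale_ok (flip \<phi>) N R es el"
  unfolding scale_ok_def params_def by simp

definition side_items :: "(item \<Rightarrow> placement) \<Rightarrow> real \<Rightarrow> item set \<Rightarrow> real \<Rightarrow> item set" where
  "side_items \<phi> N R e = {i \<in> R. corner_x (\<phi> i) + placed_width \<phi> i \<le> e * N \<or> N - corner_x (\<phi> i) \<le> e * N}"

text \<open>The items in the left and right margins are rotated into the strip that is cut out.\<close>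

lemma contract_at:
  assumes N: "0 < N" and R: "valid R" and f: "fits \<phi> R N N" and sc: "scale_ok \<phi> N R es el"
    and es: "0 < es" "0 < el" "4 * es * real k \<le> el" and k: "0 < k"
    and y0: "0 \<le> y0" "y0 + el * N \<le> N"
    and lost: "\<And>i. i \<in> R - side_items \<phi> N R el \<Longrightarrow> el * N < placed_height \<phi> i \<Longrightarrow> corner_y (\<phi> i) < y0 + el * N \<Longrightarrow>
       y0 < corner_y (\<phi> i) + placed_height \<phi> i \<Longrightarrow> i \<in> Lost" and LR: "Lost \<subseteq> R"
  shows "\<exists>S'\<subseteq>R. (\<exists>\<psi>. fits \<psi> S' N ((1 - 2 * es) * N)) \<and> profit S' \<ge> (1 - 2 / k) * profit R - profit Lost"
proof -
  define F where "F = side_items \<phi> N R el"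
  have FR: "F \<subseteq> R" by (auto simp: F_def side_items_def)
  have elN: "0 < el * N" using es N by simp
  define R1 where "R1 = R - F - Lost"
  have R1R: "R1 \<subseteq> R" by (auto simp: R1_def)
  have v: "valid R1" "valid F" "valid Lost" "finite R" using valid_subset[OF R] R1R FR LR R by (auto simp: valid_def)
  \<comment> \<open>The strip that is cut has height at least \<open>4 * es * N\<close>: the items
    of the two side margins take \<open>es * N\<close> each after rotation, and
    \<open>2 * es * N\<close> stays free.\<close>
  have ek: "4 * (es * N) \<le> el * N / k"
  proof -
    have "4 * es * real k * N \<le> el * N" using es(3) N by (intro mult_right_mono) auto
    then show ?thesis using k by (simp add: field_simps)
  qed
  have esN: "0 < es * N" using es N by simp
  have "\<exists>S'\<subseteq>R1. \<exists>\<psi>. fits \<psi> S' N (N - el * N / k) \<and> (\<forall>i. rotated (\<psi> i) = rotated (\<phi> i)) \<and>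
     profit S' \<ge> (1 - 2 / k) * profit R1"
  proof (rule cut_strip[where ?y0.0 = y0, OF v(1) fits_subset[OF f R1R] elN k])
    fix i assume i: "i \<in> R1" "corner_y (\<phi> i) < y0 + el * N" "y0 < corner_y (\<phi> i) + placed_height \<phi> i"
    have "\<not> el * N < placed_height \<phi> i" using lost[of i] i by (auto simp: R1_def F_def)
    moreover have "placed_height \<phi> i \<le> es * N \<or> el * N < placed_height \<phi> i"
      using sc i(1) R1R by (auto simp: scale_ok_def params_def)
    ultimately show "placed_height \<phi> i \<le> el * N / k" using ek esN by linarith
  qed (use y0 in auto)
  then obtain S1 \<psi> where S1: "S1 \<subseteq> R1" "fits \<psi> S1 N (N - el * N / k)" "profit S1 \<ge> (1 - 2 / k) * profit R1" by blast
  have inb: "boxin (pbox \<phi> i) (0, 0, N, N)" if "i \<in> R" for i using f that by (simp add: fits_def)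
  have apR: "pairwise (\<lambda>i j. apart (pbox \<phi> i) (pbox \<phi> j)) A" if "A \<subseteq> R" for A
    using f that pairwise_subset unfolding fits_def by blast
  have pos: "0 < placed_width \<phi> i" "0 < placed_height \<phi> i" if "i \<in> R" for i
    using R that placed_pos unfolding valid_def by blast+
  define Fl where "Fl = {i \<in> R. corner_x (\<phi> i) + placed_width \<phi> i \<le> es * N}"
  define Fr where "Fr = {i \<in> R. N - corner_x (\<phi> i) \<le> es * N}"
  have FF: "F \<subseteq> Fl \<union> Fr"
  proof
    fix i assume i: "i \<in> F"
    then have "i \<in> R" "corner_x (\<phi> i) + placed_width \<phi> i \<le> el * N \<or> N - corner_x (\<phi> i) \<le> el * N"
      by (auto simp: F_def side_items_def)
    moreover from this have "corner_x (\<phi> i) + placed_width \<phi> i \<le> es * N \<or> el * N < corner_x (\<phi> i) + placed_width \<phi> i"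
      "N - corner_x (\<phi> i) \<le> es * N \<or> el * N < N - corner_x (\<phi> i)"
      using sc by (auto simp: scale_ok_def params_def)
    ultimately show "i \<in> Fl \<union> Fr" by (auto simp: Fl_def Fr_def)
  qed
  \<comment> \<open>Reflection turns the left margin into a horizontal layer of height
    \<open>es * N\<close>.\<close>
  have f1: "fpk N N (es * N) Fl"
  proof (rule fpk_shiftI[where \<phi> = "flip \<phi>" and x = 0 and y = 0])
    show "pairwise (\<lambda>i j. apart (pbox (flip \<phi>) i) (pbox (flip \<phi>) j)) Fl" using apR[of Fl] by (simp add: Fl_def)
    fix i assume "i \<in> Fl"
    then have i: "i \<in> R" "corner_x (\<phi> i) + placed_width \<phi> i \<le> es * N" by (auto simp: Fl_def)
    show "boxin (pbox (flip \<phi>) i) (0, 0, N, es * N)" "placed_height (flip \<phi>) i \<le> N"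
      using inb[OF i(1)] i(2) by (auto simp: pbox_def)
  qed
  have f2: "fpk N N (es * N) Fr"
  proof (rule fpk_shiftI[where \<phi> = "flip \<phi>" and x = 0 and y = "N - es * N"])
    show "pairwise (\<lambda>i j. apart (pbox (flip \<phi>) i) (pbox (flip \<phi>) j)) Fr" using apR[of Fr] by (simp add: Fr_def)
    fix i assume "i \<in> Fr"
    then have i: "i \<in> R" "N - corner_x (\<phi> i) \<le> es * N" by (auto simp: Fr_def)
    show "boxin (pbox (flip \<phi>) i) (0, N - es * N, N, es * N)" "placed_height (flip \<phi>) i \<le> N"
      using inb[OF i(1)] i(2) by (auto simp: pbox_def)
  qed
  have fk: "el * N / k \<le> N"
  proof -
    have "el * N / k \<le> el * N / 1" using k elN by (intro divide_left_mono) auto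
    then show ?thesis using y0 by linarith
  qed
  have f0: "fpk N N (N - el * N / k) S1"
    unfolding fpk_def
  proof (intro exI[of _ \<psi>] conjI S1(2) ballI)
    fix i assume "i \<in> S1"
    then have "boxin (pbox \<psi> i) (0, 0, N, N - el * N / k)" using S1(2) by (simp add: fits_def)
    moreover have "0 \<le> el * N / k" using elN by simp
    ultimately show "placed_height \<psi> i \<le> N" by (simp add: pbox_def)
  qed
  have "fpk N N (es * N + es * N) (Fl \<union> Fr)" by (rule fpk_stack[OF f1 f2]) (use esN in auto)
  then have "fpk N N ((N - el * N / k) + (es * N + es * N)) (S1 \<union> (Fl \<union> Fr))"
    by (rule fpk_stack[OF f0]) (use esN fk in linarith)+
  moreover have "(N - el * N / k) + (es * N + es * N) \<le> (1 - 2 * es) * N" using ek by (simp add: algebra_simps)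
  ultimately have "fpk N N ((1 - 2 * es) * N) (S1 \<union> F)" by (elim fpk_mono) (use FF in auto)
  then have "\<exists>\<psi>. fits \<psi> (S1 \<union> F) N ((1 - 2 * es) * N)" unfolding fpk_def by blast
  moreover have "S1 \<union> F \<subseteq> R" using S1(1) R1R FR by blast
  moreover have "profit (S1 \<union> F) \<ge> (1 - 2 / k) * profit R - profit Lost"
  proof -
    have kk: "0 \<le> 2 / real k" by simp
    have "profit (S1 \<union> F) = profit S1 + profit F"
      using S1(1) v finite_subset[OF S1(1)] by (intro profit_Un_disjoint) (auto simp: valid_def R1_def)
    moreover have "profit (R - F) = profit R - profit F" using v(4) FR by (rule profit_Diff)
    moreover have "profit (R - F) \<le> profit R1 + profit Lost"
    proof -
      have "profit (R - F) \<le> profit (R1 \<union> Lost)"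
        by (rule profit_mono) (use v in \<open>auto simp: valid_def R1_def\<close>)
      also have "\<dots> \<le> profit R1 + profit Lost" by (rule profit_Un_le[OF v(1,3)])
      finally show ?thesis .
    qed
    moreover have "profit R1 \<le> profit R" by (rule profit_mono[OF R R1R])
    moreover have "2 / k * profit R1 \<le> 2 / k * profit R" using calculation(4) kk by (intro mult_left_mono)
    ultimately show ?thesis using S1(3) by (simp add: left_diff_distrib)
  qed
  ultimately show ?thesis by blast
qed

lemma weaken_loss:
  assumes "\<exists>S'\<subseteq>R. Q S' \<and> a - p \<le> profit S'" "p \<le> q"
  shows "\<exists>S'\<subseteq>R. Q S' \<and> a - q \<le> profit S'"
proof -
  obtain S' where S': "S' \<subseteq> R" "Q S'" "a - p \<le> profit S'" using assms(1) by blast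
  have "a - q \<le> profit S'" using S'(3) assms(2) by linarith
  then show ?thesis using S'(1,2) by blast
qed

text \<open>The strip can be cut out of the bottom or the top band. By \<open>span\<close> no tall
  item outside the side margins meets both bands, so the cheaper choice costs at most half of the
  tall items.\<close>

lemma contract_half:
  assumes N: "0 < N" and R: "valid R" and f: "fits \<phi> R N N" and sc: "scale_ok \<phi> N R es el"
    and es: "0 < es" "0 < el" "4 * es * real k \<le> el" and k: "0 < k" and el1: "el \<le> 1"
    and span: "\<And>i. i \<in> R \<Longrightarrow> el * N < placed_height \<phi> i \<Longrightarrow> corner_y (\<phi> i) < el * N \<Longrightarrow>
       N - el * N < corner_y (\<phi> i) + placed_height \<phi> i \<Longrightarrow> i \<in> side_items \<phi> N R el"
  shows "\<exists>S'\<subseteq>R. (\<exists>\<psi>. fits \<psi> S' N ((1 - 2 * es) * N)) \<and>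
     profit S' \<ge> (1 - 2 / k) * profit R - profit {i \<in> R. el * N < placed_height \<phi> i} / 2"
proof -
  define F where "F = side_items \<phi> N R el"
  define B where "B = {i \<in> R - F. el * N < placed_height \<phi> i \<and> corner_y (\<phi> i) < el * N}"
  define T where "T = {i \<in> R - F. el * N < placed_height \<phi> i \<and> N - el * N < corner_y (\<phi> i) + placed_height \<phi> i}"
  have elN: "el * N \<le> N" "0 \<le> el * N" using el1 es N by auto
  have BT: "\<exists>S'\<subseteq>R. (\<exists>\<psi>. fits \<psi> S' N ((1 - 2 * es) * N)) \<and> profit S' \<ge> (1 - 2 / k) * profit R - profit B"
    by (rule contract_at[OF N R f sc es k, where ?y0.0 = 0]) (use elN in \<open>auto simp: B_def F_def\<close>)
  have TT: "\<exists>S'\<subseteq>R. (\<exists>\<psi>. fits \<psi> S' N ((1 - 2 * es) * N)) \<and> profit S' \<ge> (1 - 2 / k) * profit R - profit T"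
    by (rule contract_at[OF N R f sc es k, where ?y0.0 = "N - el * N"]) (use elN in \<open>auto simp: T_def F_def\<close>)
  have dis: "B \<inter> T = {}" using span by (auto simp: B_def T_def F_def)
  have fin: "finite B" "finite T" using R by (auto simp: B_def T_def valid_def)
  have "profit B + profit T = profit (B \<union> T)" using profit_Un_disjoint[OF fin dis] by simp
  also have "\<dots> \<le> profit {i \<in> R. el * N < placed_height \<phi> i}"
    by (rule profit_mono) (auto intro: valid_subset[OF R] simp: B_def T_def)
  finally have "profit B \<le> profit {i \<in> R. el * N < placed_height \<phi> i} / 2 \<or>
     profit T \<le> profit {i \<in> R. el * N < placed_height \<phi> i} / 2" by linarith
  then show ?thesis
  proof
    assume "profit B \<le> profit {i \<in> R. el * N < placed_height \<phi> i} / 2"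
    then show ?thesis by (rule weaken_loss[OF BT])
  next
    assume "profit T \<le> profit {i \<in> R. el * N < placed_height \<phi> i} / 2"
    then show ?thesis by (rule weaken_loss[OF TT])
  qed
qed

text \<open>An item spanning the knapsack vertically and one spanning it horizontally can only coexist
  if one of them lies in a margin, or if they are the same (huge) item.\<close>

lemma contraction:
  assumes N: "0 < N" and R: "valid R" and f: "fits \<phi> R N N" and sc: "scale_ok \<phi> N R es el"
    and es: "0 < es" "0 < el" "4 * es * real k \<le> el" and k: "0 < k" and el1: "el \<le> 1"
    and tall: "profit {i \<in> R. el * N < placed_height \<phi> i} \<le> 2 * P"
    and wide: "profit {i \<in> R. el * N < placed_width \<phi> i} \<le> 2 * P"
    and huge: "\<And>i. i \<in> R \<Longrightarrow> el * N < placed_width \<phi> i \<Longrightarrow> el * N < placed_height \<phi> i \<Longrightarrow> item_profit i \<le> P"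
  shows "\<exists>S'\<subseteq>R. (\<exists>\<psi>. fits \<psi> S' N ((1 - 2 * es) * N)) \<and> profit S' \<ge> (1 - 2 / k) * profit R - P"
proof -
  define x where "x i = corner_x (\<phi> i)" for i
  define y where "y i = corner_y (\<phi> i)" for i
  define w where "w i = placed_width \<phi> i" for i
  define h where "h i = placed_height \<phi> i" for i
  have pb: "pbox \<phi> i = (x i, y i, w i, h i)" for i by (simp add: pbox_def x_def y_def w_def h_def)
  have pos: "0 < w i" "0 < h i" if "i \<in> R" for i
    using R that placed_pos unfolding valid_def w_def h_def by blast+
  have bnd: "0 \<le> x i" "x i + w i \<le> N" "0 \<le> y i" "y i + h i \<le> N" if "i \<in> R" for i
    using f that unfolding fits_def pb by auto
  have ap: "x i + w i \<le> x j \<or> x j + w j \<le> x i \<or> y i + h i \<le> y j \<or> y j + h j \<le> y i"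
    if "i \<in> R" "j \<in> R" "i \<noteq> j" for i j
    using f that unfolding fits_def pairwise_def pb apart_def by fastforce
  define V where "V = {i \<in> R. el * N < h i \<and> y i < el * N \<and> N - el * N < y i + h i}"
  define G where "G = {i \<in> R. el * N < w i \<and> x i < el * N \<and> N - el * N < x i + w i}"
  define F where "F = {i \<in> R. x i + w i \<le> el * N \<or> N - x i \<le> el * N}"
  define F' where "F' = {i \<in> R. y i + h i \<le> el * N \<or> N - y i \<le> el * N}"
  have Feq: "F = side_items \<phi> N R el" by (simp add: F_def side_items_def x_def w_def)
  have F'eq: "F' = side_items (flip \<phi>) N R el" by (simp add: F'_def side_items_def y_def h_def)
  \<comment> \<open>Otherwise \<open>v\<close> reaches beyond both side margins and \<open>g\<close>
    beyond the bottom and top margins, so neither direction can separate them.\<close>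
  have VG: "v \<in> F \<or> g \<in> F'" if "v \<in> V" "g \<in> G" "v \<noteq> g" for v g
    using ap[of v g] that by (auto simp: V_def G_def F_def F'_def)
  consider (a) m where "m \<in> V" "m \<in> G" | (b) "V \<subseteq> F" | (c) "G \<subseteq> F'" using VG by blast
  then show ?thesis
  proof cases
    case a
    \<comment> \<open>Any other tall item outside the side margins would overlap \<open>m\<close>,
      so \<open>m\<close> is the only candidate for \<open>Lost\<close>.\<close>
    have "\<exists>S'\<subseteq>R. (\<exists>\<psi>. fits \<psi> S' N ((1 - 2 * es) * N)) \<and> profit S' \<ge> (1 - 2 / k) * profit R - profit {m}"
    proof (rule contract_at[OF N R f sc es k, where ?y0.0 = 0])
      show "0 + el * N \<le> N" using el1 N by simp
      show "{m} \<subseteq> R" using a by (simp add: V_def)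
      fix i assume i: "i \<in> R - side_items \<phi> N R el" "el * N < placed_height \<phi> i"
      show "i \<in> {m}"
      proof (rule ccontr)
        assume "i \<notin> {m}"
        then have "x i + w i \<le> x m \<or> x m + w m \<le> x i \<or> y i + h i \<le> y m \<or> y m + h m \<le> y i"
          using ap[of i m] i(1) a(1) by (auto simp: V_def)
        moreover have "\<not> x i + w i \<le> el * N" "\<not> N - x i \<le> el * N" using i(1) by (auto simp: Feq[symmetric] F_def)
        moreover have "el * N < h i" "i \<in> R" using i by (auto simp: h_def)
        ultimately show False using a bnd[of i] by (auto simp: V_def G_def)
      qed
    qed simp
    moreover have "profit {m} \<le> P" using huge[of m] a by (simp add: profit_def V_def G_def w_def h_def)
    ultimately show ?thesis by (rule weaken_loss)
  next
    case b
    have "\<exists>S'\<subseteq>R. (\<exists>\<psi>. fits \<psi> S' N ((1 - 2 * es) * N)) \<and>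
       profit S' \<ge> (1 - 2 / k) * profit R - profit {i \<in> R. el * N < placed_height \<phi> i} / 2"
      by (rule contract_half[OF N R f sc es k el1]) (use b in \<open>auto simp: Feq V_def h_def y_def\<close>)
    then show ?thesis by (rule weaken_loss) (use tall in simp)
  next
    case c
    have "\<exists>S'\<subseteq>R. (\<exists>\<psi>. fits \<psi> S' N ((1 - 2 * es) * N)) \<and>
       profit S' \<ge> (1 - 2 / k) * profit R - profit {i \<in> R. el * N < placed_height (flip \<phi>) i} / 2"
      by (rule contract_half[OF N R fits_flip[OF f] scale_ok_flip[OF sc] es k el1])
        (use c in \<open>auto simp: F'eq G_def w_def x_def\<close>)
    then show ?thesis by (rule weaken_loss) (use wide in simp)
  qed
qed

subsection \<open>Items that are large relative to a grid\<close>

text \<open>The lattice starts at \<open>a\<close> and has spacing \<open>c * (b - a) < h\<close>,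
  so its first point above \<open>y\<close> lies below \<open>y + h\<close>. As
  \<open>y < b\<close>, the index of that point is at most
  \<open>nat \<lfloor>1 / c\<rfloor> + 1\<close>. For \<open>y < a\<close> the point
  \<open>a\<close> itself serves.\<close>

lemma lattice_point:
  fixes a b c y h :: real
  assumes "y < b" "a < y + h" "c * (b - a) < h" "a < b" "0 < c"
  shows "\<exists>k < nat \<lfloor>1 / c\<rfloor> + 2. y < a + real k * (c * (b - a)) \<and> a + real k * (c * (b - a)) < y + h"
proof (cases "y < a")
  case True
  then show ?thesis using assms by (intro exI[of _ 0]) simp
next
  case False
  define d where "d = c * (b - a)"
  have d0: "0 < d" using assms by (simp add: d_def)
  define k where "k = nat \<lfloor>(y - a) / d\<rfloor> + 1"
  have nn: "0 \<le> (y - a) / d" using False d0 by simp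
  have "(y - a) / d \<le> (b - a) / d" using assms d0 by (intro divide_right_mono) auto
  also have "\<dots> = 1 / c" using assms by (simp add: d_def)
  finally have "\<lfloor>(y - a) / d\<rfloor> \<le> \<lfloor>1 / c\<rfloor>" by (rule floor_mono)
  then have "k < nat \<lfloor>1 / c\<rfloor> + 2" unfolding k_def by linarith
  moreover have kr: "real k = real_of_int \<lfloor>(y - a) / d\<rfloor> + 1" using nn by (simp add: k_def)
  have "(y - a) / d < real k" "real k \<le> (y - a) / d + 1" unfolding kr by linarith+
  then have "(y - a) / d * d < real k * d" "real k * d \<le> ((y - a) / d + 1) * d"
    using d0 by (simp_all only: mult_less_cancel_right_pos mult_le_cancel_right_pos)
  then have "y - a < real k * d" "real k * d \<le> y - a + d" using d0 by (simp_all add: distrib_right)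
  ultimately show ?thesis using assms(3) unfolding d_def by (intro exI[of _ k]) auto
qed

definition large_items :: "real \<Rightarrow> (item \<Rightarrow> placement) \<Rightarrow> real \<Rightarrow> item set \<Rightarrow> item set \<Rightarrow> item set" where
  "large_items c \<phi> N R L = {i \<in> R. reltall c \<phi> (ygrid \<phi> N L) i \<and> reltall c (flip \<phi>) (ygrid (flip \<phi>) N L) i}"

lemma reltall_lattice_point:
  assumes "reltall c \<phi> G i" "0 < c"
  shows "\<exists>p \<in> G \<times> G \<times> {..<nat \<lfloor>1 / c\<rfloor> + 2}.
     corner_y (\<phi> i) < fst p + real (snd (snd p)) * (c * (fst (snd p) - fst p)) \<and>
     fst p + real (snd (snd p)) * (c * (fst (snd p) - fst p)) < corner_y (\<phi> i) + placed_height \<phi> i"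
proof -
  obtain a b where ab: "grid_row G a b" "corner_y (\<phi> i) < b" "a < corner_y (\<phi> i) + placed_height \<phi> i"
    "c * (b - a) < placed_height \<phi> i" using assms(1) unfolding reltall_def by blast
  have G: "a \<in> G" "b \<in> G" "a < b" using ab(1) by (auto simp: grid_row_def)
  obtain k where k: "k < nat \<lfloor>1 / c\<rfloor> + 2" "corner_y (\<phi> i) < a + real k * (c * (b - a))"
    "a + real k * (c * (b - a)) < corner_y (\<phi> i) + placed_height \<phi> i"
    using lattice_point[OF ab(2-4) G(3) assms(2)] by blast
  show ?thesis by (rule bexI[of _ "(a, b, k)"]) (use G k in auto)
qed

text \<open>An item that is large in both directions contains a lattice point of a row and one of a
  column strictly between its edges. Two items with the same pair would overlap. Each coordinate is
  given by two grid lines and an index, which explains the bound.\<close>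

lemma card_large_items:
  assumes R: "valid R" and f: "fits \<phi> R N N" and L: "finite L" "card L \<le> m" and c: "0 < c"
  shows "card (large_items c \<phi> N R L) \<le>
     ((2 + 2 * m) * ((2 + 2 * m) * (nat \<lfloor>1 / c\<rfloor> + 2))) * ((2 + 2 * m) * ((2 + 2 * m) * (nat \<lfloor>1 / c\<rfloor> + 2)))"
proof -
  define n where "n = nat \<lfloor>1 / c\<rfloor> + 2"
  define A where "A = large_items c \<phi> N R L"
  define G where "G = ygrid \<phi> N L"
  define G' where "G' = ygrid (flip \<phi>) N L"
  define pt where "pt p = fst p + real (snd (snd p)) * (c * (fst (snd p) - fst p))" for p :: "real \<times> real \<times> nat"
  have "\<forall>i\<in>A. \<exists>p. p \<in> G \<times> G \<times> {..<n} \<and> corner_y (\<phi> i) < pt p \<and> pt p < corner_y (\<phi> i) + placed_height \<phi> i"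
    using reltall_lattice_point[OF _ c, of \<phi> G] unfolding A_def large_items_def n_def pt_def G_def by blast
  from bchoice[OF this] obtain p where p: "\<forall>i\<in>A. p i \<in> G \<times> G \<times> {..<n} \<and> corner_y (\<phi> i) < pt (p i) \<and> pt (p i) < corner_y (\<phi> i) + placed_height \<phi> i" ..
  have "\<forall>i\<in>A. \<exists>p. p \<in> G' \<times> G' \<times> {..<n} \<and> corner_x (\<phi> i) < pt p \<and> pt p < corner_x (\<phi> i) + placed_width \<phi> i"
    using reltall_lattice_point[OF _ c, of "flip \<phi>" G'] unfolding A_def large_items_def n_def pt_def G'_def by force
  from bchoice[OF this] obtain q where q: "\<forall>i\<in>A. q i \<in> G' \<times> G' \<times> {..<n} \<and> corner_x (\<phi> i) < pt (q i) \<and> pt (q i) < corner_x (\<phi> i) + placed_width \<phi> i" ..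
  define e where "e i = (p i, q i)" for i
  have "inj_on e A"
  proof (rule inj_onI, rule ccontr)
    fix i j assume ij: "i \<in> A" "j \<in> A" "e i = e j" "i \<noteq> j"
    then have "apart (pbox \<phi> i) (pbox \<phi> j)" using f by (auto simp: fits_def pairwise_def A_def large_items_def)
    moreover have "pt (p i) = pt (p j)" "pt (q i) = pt (q j)" using ij(3) by (auto simp: e_def)
    ultimately show False using bspec[OF p ij(1)] bspec[OF p ij(2)] bspec[OF q ij(1)] bspec[OF q ij(2)]
      by (auto simp: apart_def pbox_def)
  qed
  moreover have "e ` A \<subseteq> (G \<times> G \<times> {..<n}) \<times> (G' \<times> G' \<times> {..<n})"
    unfolding e_def using p q by blast
  moreover have fG: "finite G" "finite G'" using finite_ygrid[OF L(1)] by (auto simp: G_def G'_def)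
  ultimately have "card A \<le> card ((G \<times> G \<times> {..<n}) \<times> (G' \<times> G' \<times> {..<n}))"
    by (intro card_inj_on_le[of e]) auto
  also have "\<dots> = (card G * (card G * n)) * (card G' * (card G' * n))" by (simp add: card_cartesian_product)
  also have "\<dots> \<le> ((2 + 2 * m) * ((2 + 2 * m) * n)) * ((2 + 2 * m) * ((2 + 2 * m) * n))"
  proof -
    have "card G \<le> 2 + 2 * m" "card G' \<le> 2 + 2 * m"
      using card_ygrid[OF L(1), of \<phi> N] card_ygrid[OF L(1), of "flip \<phi>" N] L(2) by (auto simp: G_def G'_def)
    then show ?thesis by (intro mult_le_mono order_refl)
  qed
  finally show ?thesis by (simp only: A_def n_def)
qed

fun level :: "real \<Rightarrow> (item \<Rightarrow> placement) \<Rightarrow> real \<Rightarrow> item set \<Rightarrow> nat \<Rightarrow> item set" where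
  "level c \<phi> N R 0 = {}"
| "level c \<phi> N R (Suc j) = level c \<phi> N R j \<union> large_items c \<phi> N R (level c \<phi> N R j)"

fun level_card :: "nat \<Rightarrow> nat \<Rightarrow> nat" where
  "level_card n 0 = 0"
| "level_card n (Suc j) = level_card n j +
     ((2 + 2 * level_card n j) * ((2 + 2 * level_card n j) * n)) * ((2 + 2 * level_card n j) * ((2 + 2 * level_card n j) * n))"

lemma level_subset: "level c \<phi> N R j \<subseteq> R"
  by (induction j) (auto simp: large_items_def)

lemma level_mono: "i \<le> j \<Longrightarrow> level c \<phi> N R i \<subseteq> level c \<phi> N R j"
  by (rule lift_Suc_mono_le) auto

lemma level_card_mono: "i \<le> j \<Longrightarrow> level_card n i \<le> level_card n j"
  by (rule lift_Suc_mono_le) auto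

lemma card_level:
  assumes R: "valid R" and f: "fits \<phi> R N N" and c: "0 < c"
  shows "card (level c \<phi> N R j) \<le> level_card (nat \<lfloor>1 / c\<rfloor> + 2) j"
proof (induction j)
  case (Suc j)
  have "finite (level c \<phi> N R j)"
    using level_subset[of c \<phi> N R j] R finite_subset by (auto simp: valid_def)
  from card_large_items[OF R f this Suc c] show ?case
    unfolding level.simps(2) level_card.simps(2) by (intro order_trans[OF card_Un_le] add_mono Suc)
qed simp

lemma grid_row_le:
  assumes "grid_row (ygrid \<phi> N L) a b" "\<And>i. i \<in> L \<Longrightarrow> boxin (pbox \<phi> i) (0, 0, N, N)"
    "\<And>i. i \<in> L \<Longrightarrow> 0 < placed_height \<phi> i" "0 < N"
  shows "b - a \<le> N"
proof -
  have "0 \<le> g \<and> g \<le> N" if "g \<in> ygrid \<phi> N L" for g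
  proof -
    have "0 \<le> corner_y (\<phi> i) \<and> corner_y (\<phi> i) + placed_height \<phi> i \<le> N \<and> 0 < placed_height \<phi> i" if "i \<in> L" for i
      using assms(2,3)[OF that] by (simp add: pbox_def)
    then show ?thesis using that assms(4) unfolding ygrid_def by force
  qed
  then show ?thesis using assms(1) unfolding grid_row_def by (smt (verit))
qed

text \<open>No row is higher than \<open>N\<close>, so an item that is tall in the absolute sense is
  tall relative to the row of its lower edge.\<close>

lemma not_reltall_height:
  assumes R: "valid R" and f: "fits \<phi> R N N" and L: "L \<subseteq> R" and N: "0 < N" and c: "0 < c" and i: "i \<in> R"
    and nt: "\<not> reltall c \<phi> (ygrid \<phi> N L) i"
  shows "placed_height \<phi> i \<le> c * N"
proof -
  have pos: "0 < placed_height \<phi> j" if "j \<in> R" for j using R that placed_pos unfolding valid_def by blast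
  have inb: "boxin (pbox \<phi> j) (0, 0, N, N)" if "j \<in> R" for j using f that by (simp add: fits_def)
  have "finite L" using L R finite_subset by (auto simp: valid_def)
  then have G: "finite (ygrid \<phi> N L)" "0 \<in> ygrid \<phi> N L" "N \<in> ygrid \<phi> N L" using finite_ygrid by (auto simp: ygrid_def)
  have y: "0 \<le> corner_y (\<phi> i)" "corner_y (\<phi> i) < N" using inb[OF i] pos[OF i] by (auto simp: pbox_def)
  obtain a b where ab: "grid_row (ygrid \<phi> N L) a b" "a \<le> corner_y (\<phi> i)" "corner_y (\<phi> i) < b"
    using grid_row_of[OF G y] by blast
  have "a < corner_y (\<phi> i) + placed_height \<phi> i" using ab(2) pos[OF i] by linarith
  then have "placed_height \<phi> i \<le> c * (b - a)" using nt ab unfolding reltall_def by (meson not_le)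
  also have "\<dots> \<le> c * N"
    using grid_row_le[OF ab(1)] inb pos L N c by (intro mult_left_mono) auto
  finally show ?thesis .
qed

text \<open>The grid of the empty set has a single row and a single column, both from
  \<open>0\<close> to \<open>N\<close>. The first round therefore collects all items that are large
  in the absolute sense.\<close>

lemma level_1: 
  assumes "i \<in> R" "c * N < placed_width \<phi> i" "c * N < placed_height \<phi> i" "0 < N"
    "boxin (pbox \<phi> i) (0, 0, N, N)" "valid_item i"
  shows "i \<in> level c \<phi> N R 1"
proof -
  have pos: "0 < placed_width \<phi> i" "0 < placed_height \<phi> i" using placed_pos[OF assms(6)] by auto
  have "grid_row (ygrid \<theta> N {}) 0 N" for \<theta> using assms(4) by (auto simp: grid_row_def ygrid_def)
  moreover have "corner_y (\<phi> i) < N" "0 < corner_y (\<phi> i) + placed_height \<phi> i"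
    "corner_x (\<phi> i) < N" "0 < corner_x (\<phi> i) + placed_width \<phi> i"
    using assms(5) pos by (auto simp: pbox_def)
  ultimately have "reltall c \<phi> (ygrid \<phi> N {}) i" "reltall c (flip \<phi>) (ygrid (flip \<phi>) N {}) i"
    unfolding reltall_def using assms(2,3) by (intro exI[of _ 0] exI[of _ N]; simp)+
  then show ?thesis using assms(1) by (simp add: large_items_def)
qed

lemma reltall_antimono:
  assumes "reltall c' \<phi> G i" "c \<le> c'"
  shows "reltall c \<phi> G i"
proof -
  obtain a b where ab: "grid_row G a b" "corner_y (\<phi> i) < b" "a < corner_y (\<phi> i) + placed_height \<phi> i"
    "c' * (b - a) < placed_height \<phi> i" using assms(1) unfolding reltall_def by blast
  have "c * (b - a) \<le> c' * (b - a)" using assms(2) ab(1) by (intro mult_right_mono) (auto simp: grid_row_def)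
  then show ?thesis using ab unfolding reltall_def by (intro exI[of _ a] exI[of _ b]) auto
qed

subsection \<open>The three candidates\<close>

lemma two_thirds_packing:
  fixes \<epsilon> :: real
  assumes \<epsilon>: "0 < \<epsilon>" "\<epsilon> < 1 / 6"
  shows "\<exists>K. \<forall>N R \<phi>. 0 < N \<and> valid R \<and> fits \<phi> R N N \<longrightarrow>
     (\<exists>S\<subseteq>R. cpk \<epsilon> K N N S \<and> profit S \<ge> (2 / 3 - 6 * \<epsilon>) * profit R)"
proof -
  have \<epsilon>': "\<epsilon> \<le> 1 / 6" using \<epsilon> by simp
  define k where "k = nat \<lceil>1 / \<epsilon>\<rceil>"
  have k1: "1 / \<epsilon> \<le> real k" using \<epsilon> by (simp add: k_def)
  have k0: "0 < k" using k1 \<epsilon> by (metis divide_pos_pos gr_zeroI less_numeral_extra(1) not_less of_nat_0)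
  have k\<epsilon>: "1 / real k \<le> \<epsilon>" using k1 k0 \<epsilon> by (simp add: field_simps)
  have "\<exists>E. finite E \<and> E \<noteq> {} \<and> E \<subseteq> {0<..1 / 4} \<and>
      (\<forall>S fs N. valid S \<and> length fs \<le> 6 \<longrightarrow>
       (\<exists>a\<in>E. \<exists>b\<in>E. b \<le> a / (4 * real k) \<and> b < a \<and>
          profit {i \<in> S. \<exists>f\<in>set fs. b * N < f i \<and> f i \<le> a * N} \<le> \<epsilon> * profit S))"
    by (rule scale_gap) (use k0 \<epsilon> in simp_all)
  then obtain E where E: "finite E" "E \<noteq> {}" "E \<subseteq> {0<..1 / 4}"
    and sg: "\<forall>S fs N. valid S \<and> length fs \<le> 6 \<longrightarrow>
       (\<exists>a\<in>E. \<exists>b\<in>E. b \<le> a / (4 * real k) \<and> b < a \<and>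
          profit {i \<in> S. \<exists>f\<in>set fs. b * N < f i \<and> f i \<le> a * N} \<le> \<epsilon> * profit S)"
    by (elim exE conjE) (rule that; assumption)
  \<comment> \<open>\<open>contraction\<close> frees height \<open>2 * es * N\<close> for some
    \<open>es\<close> in \<open>E\<close>, hence at least \<open>2 * z * N\<close>;
    \<open>augmented\<close> is applied to this common bound. \<open>E\<close> was taken below
    \<open>1 / 4\<close> so that \<open>2 * z \<le> 1 / 2\<close>.\<close>
  define z where "z = Min E"
  have zE: "z \<in> E" and zle: "\<And>e. e \<in> E \<Longrightarrow> z \<le> e" using Min_in[OF E(1,2)] E(1) by (auto simp: z_def)
  have z0: "0 < z" "z \<le> 1 / 4" using zE E(3) by auto
  obtain cR KR where cR: "0 < cR" and rows: "\<forall>N \<phi> R L m. 0 < N \<and> valid R \<and> fits \<phi> R N N \<and> L \<subseteq> R \<and> card L \<le> m \<and>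
     (\<forall>i\<in>R - L. \<not> reltall cR \<phi> (ygrid \<phi> N L) i) \<longrightarrow> good \<epsilon> (5 * \<epsilon>) (KR m) N N R"
    using flat_rows[OF \<epsilon>(1) \<epsilon>'] by blast
  have dz: "0 < 2 * z" "2 * z \<le> 1 / 2" using z0 by auto
  obtain KA where aug: "\<forall>N S \<phi>. 0 < N \<and> valid S \<and> fits \<phi> S N ((1 - 2 * z) * N) \<longrightarrow> good \<epsilon> (4 * \<epsilon>) KA N N S"
    using augmented[OF \<epsilon>(1) \<epsilon>' dz] by blast
  \<comment> \<open>\<open>cR\<close> serves \<open>flat_rows\<close>. By \<open>c \<le> z\<close>
    an item higher than \<open>el * N\<close> is tall relative to its row, whichever scale
    \<open>el\<close> is chosen.\<close>
  define c where "c = min cR z"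
  have c0: "0 < c" "c \<le> cR" "c \<le> z" using cR z0 by (auto simp: c_def)
  define m where "m = level_card (nat \<lfloor>1 / c\<rfloor> + 2) k"
  define K where "K = max (KR m) KA"
  have main: "\<exists>S\<subseteq>R. cpk \<epsilon> K N N S \<and> profit S \<ge> (2 / 3 - 6 * \<epsilon>) * profit R"
    if N: "0 < N" and R: "valid R" and f: "fits \<phi> R N N" for N R \<phi>
  proof -
    define P where "P = profit R"
    have P0: "0 \<le> P" unfolding P_def by (rule profit_nonneg[OF R])
    have "length (params \<phi> N) \<le> 6" by (simp add: params_def)
    then obtain el es where els: "el \<in> E" "es \<in> E" "es \<le> el / (4 * real k)" "es < el"
      and pr: "profit {i \<in> R. \<exists>f\<in>set (params \<phi> N). es * N < f i \<and> f i \<le> el * N} \<le> \<epsilon> * profit R"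
      using sg R by blast
    have e0: "0 < el" "el \<le> 1" "0 < es" using els E(3) by auto
    define M where "M = {i \<in> R. \<exists>f\<in>set (params \<phi> N). es * N < f i \<and> f i \<le> el * N}"
    define R0 where "R0 = R - M"
    have R0: "R0 \<subseteq> R" "valid R0" "fits \<phi> R0 N N"
      using valid_subset[OF R] fits_subset[OF f] by (auto simp: R0_def)
    have pR0: "profit R0 \<ge> (1 - \<epsilon>) * P" "profit R0 \<le> P"
    proof -
      have "profit R0 = profit R - profit M" unfolding R0_def
        using R by (intro profit_Diff) (auto simp: valid_def M_def)
      then show "profit R0 \<ge> (1 - \<epsilon>) * P" using pr by (simp add: P_def M_def algebra_simps)
      show "profit R0 \<le> P" unfolding P_def by (rule profit_mono[OF R R0(1)])
    qed
    define Lv where "Lv j = level c \<phi> N R0 j" for j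
    have LvS: "Lv (Suc j) = Lv j \<union> large_items c \<phi> N R0 (Lv j)" for j by (simp add: Lv_def)
    have LvR: "Lv j \<subseteq> R0" for j unfolding Lv_def by (rule level_subset)
    have Lvm: "Lv i \<subseteq> Lv j" if "i \<le> j" for i j unfolding Lv_def using that by (rule level_mono)
    define D where "D j = Lv (Suc j) - Lv j" for j
    \<comment> \<open>The index starts at \<open>Suc t\<close> because the first round must not be
      dropped: \<open>L\<close> has to contain \<open>Lv 1\<close>, where the huge items
      are.\<close>
    have "card {t \<in> {..<k}. i \<in> D (Suc t)} \<le> 1" for i
    proof -
      have no: False if "s < t" "i \<in> D (Suc s)" "i \<in> D (Suc t)" for s t
      proof -
        have "Lv (Suc (Suc s)) \<subseteq> Lv (Suc t)" using that(1) by (intro Lvm) simp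
        then show False using that(2,3) unfolding D_def by blast
      qed
      have "s = t" if "s \<in> {t \<in> {..<k}. i \<in> D (Suc t)}" "t \<in> {t \<in> {..<k}. i \<in> D (Suc t)}" for s t
        using no[of s t] no[of t s] that by (cases s t rule: linorder_cases) auto
      then show ?thesis by (simp add: card_le_Suc0_iff_eq)
    qed
    then obtain t where t: "t < k" "profit {i \<in> R0. i \<in> D (Suc t)} \<le> real 1 / real k * profit R0"
      using cheap_index[OF R0(2) k0, of "\<lambda>t i. i \<in> D (Suc t)" 1] by blast
    define j where "j = Suc t"
    have j: "1 \<le> j" "j \<le> k" using t by (auto simp: j_def)
    have DR: "D j \<subseteq> R0" using LvR by (auto simp: D_def)
    then have "{i \<in> R0. i \<in> D (Suc t)} = D j" by (auto simp: j_def)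
    then have "profit (D j) \<le> 1 / real k * profit R0" using t(2) by simp
    also have "\<dots> \<le> \<epsilon> * profit R0" using k\<epsilon> profit_nonneg[OF R0(2)] by (intro mult_right_mono) auto
    finally have pD: "profit (D j) \<le> \<epsilon> * profit R0" .
    define R1 where "R1 = R0 - D j"
    define L where "L = Lv j"
    have LR1: "L \<subseteq> R1" using LvR by (auto simp: L_def R1_def D_def)
    have R1: "R1 \<subseteq> R0" "R1 \<subseteq> R" "valid R1" "fits \<phi> R1 N N" "finite R1"
      using valid_subset[OF R0(2)] fits_subset[OF R0(3)] R0(1) by (auto simp: R1_def valid_def)
    define P1 where "P1 = profit R1"
    have P1: "P1 \<ge> (1 - 2 * \<epsilon>) * P" "0 \<le> P1"
    proof -
      have "P1 = profit R0 - profit (D j)" unfolding P1_def R1_def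
        using R0 DR by (intro profit_Diff) (auto simp: valid_def)
      then have "P1 \<ge> (1 - \<epsilon>) * profit R0" using pD by (simp add: algebra_simps)
      moreover have "(1 - \<epsilon>) * profit R0 \<ge> (1 - \<epsilon>) * ((1 - \<epsilon>) * P)" using pR0(1) \<epsilon> by (intro mult_left_mono) auto
      moreover have "(1 - \<epsilon>) * ((1 - \<epsilon>) * P) = (1 - 2 * \<epsilon>) * P + \<epsilon> * \<epsilon> * P" by (simp add: algebra_simps)
      moreover have "0 \<le> \<epsilon> * \<epsilon> * P" using P0 by simp
      ultimately show "P1 \<ge> (1 - 2 * \<epsilon>) * P" by linarith
      show "0 \<le> P1" unfolding P1_def by (rule profit_nonneg[OF R1(3)])
    qed
    have cardL: "card L \<le> m"
      using card_level[OF R0(2,3) c0(1), of j] level_card_mono[OF j(2)] unfolding L_def Lv_def m_def by (meson order_trans)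
    define V where "V = {i \<in> R1 - L. reltall c \<phi> (ygrid \<phi> N L) i}"
    define H where "H = {i \<in> R1 - L. reltall c (flip \<phi>) (ygrid (flip \<phi>) N L) i}"
    \<comment> \<open>An item of both sets would be added in the round after \<open>L\<close>, but
      those items form \<open>D j\<close> and are gone.\<close>
    have VH: "V \<inter> H = {}"
    proof (rule ccontr)
      assume "V \<inter> H \<noteq> {}"
      then obtain i where "i \<in> V" "i \<in> H" by blast
      then have "i \<in> large_items c \<phi> N R0 (Lv j)" "i \<notin> Lv j" "i \<notin> D j" using R1(1)
        by (auto simp: V_def H_def large_items_def L_def R1_def)
      then show False by (simp add: D_def LvS)
    qed
    have sub: "V \<subseteq> R1" "H \<subseteq> R1" "L \<inter> V = {}" "L \<inter> H = {}" by (auto simp: V_def H_def)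
    have VHv: "valid V" "valid H" "valid L" using valid_subset[OF R1(3)] sub LR1 by auto
    have fin: "finite V" "finite H" "finite L" using VHv by (auto simp: valid_def)
    have rowcase: "\<exists>S\<subseteq>R. cpk \<epsilon> K N N S \<and> profit S \<ge> (2 / 3 - 6 * \<epsilon>) * profit R"
      if A: "A \<subseteq> R1" "L \<inter> A = {}" "profit A \<le> P1 / 3" and fA: "fits \<theta> R1 N N"
        and nt: "\<And>i. i \<in> R1 - L \<Longrightarrow> i \<notin> A \<Longrightarrow> \<not> reltall c \<theta> (ygrid \<theta> N L) i" for A \<theta>
    proof -
      have "\<forall>i\<in>(R1 - A) - L. \<not> reltall cR \<theta> (ygrid \<theta> N L) i"
      proof
        fix i assume "i \<in> (R1 - A) - L"
        then have "\<not> reltall c \<theta> (ygrid \<theta> N L) i" using nt by simp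
        then show "\<not> reltall cR \<theta> (ygrid \<theta> N L) i" using reltall_antimono c0(2) by blast
      qed
      moreover have "valid (R1 - A)" by (rule valid_subset[OF R1(3)]) auto
      moreover have "fits \<theta> (R1 - A) N N" by (rule fits_subset[OF fA]) auto
      moreover have "L \<subseteq> R1 - A" using LR1 A(2) by blast
      ultimately have "good \<epsilon> (5 * \<epsilon>) (KR m) N N (R1 - A)" using rows N cardL by blast
      then obtain S where S: "S \<subseteq> R1 - A" "cpk \<epsilon> (KR m) N N S" "profit S \<ge> (1 - 5 * \<epsilon>) * profit (R1 - A)"
        unfolding good_def by blast
      have "profit (R1 - A) = P1 - profit A" unfolding P1_def by (rule profit_Diff[OF R1(5) A(1)])
      then have "profit (R1 - A) \<ge> 2 / 3 * P1" using A(3) by simp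
      then have "(1 - 5 * \<epsilon>) * profit (R1 - A) \<ge> (1 - 5 * \<epsilon>) * (2 / 3 * P1)" using \<epsilon> by (intro mult_left_mono) auto
      moreover have "(1 - 5 * \<epsilon>) * (2 / 3 * P1) \<ge> (1 - 5 * \<epsilon>) * (2 / 3 * ((1 - 2 * \<epsilon>) * P))"
        using P1 \<epsilon> by (intro mult_left_mono) auto
      moreover have "(1 - 5 * \<epsilon>) * (2 / 3 * ((1 - 2 * \<epsilon>) * P)) = (2 / 3 - 6 * \<epsilon>) * P + (4 / 3 * (\<epsilon> * P) + 20 / 3 * (\<epsilon> * \<epsilon> * P))"
        by (simp add: field_simps)
      moreover have "0 \<le> \<epsilon> * P" "0 \<le> \<epsilon> * \<epsilon> * P" using P0 \<epsilon> by auto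
      ultimately have "profit S \<ge> (2 / 3 - 6 * \<epsilon>) * P" using S(3) by linarith
      moreover have "cpk \<epsilon> K N N S" using S(2) by (rule cpk_mono) (simp_all add: K_def)
      ultimately show ?thesis using S(1) R1(2) unfolding P_def by blast
    qed
    consider (v) "profit V \<le> P1 / 3" | (h) "profit H \<le> P1 / 3" | (c) "profit V > P1 / 3" "profit H > P1 / 3" by linarith
    then show ?thesis
    proof cases
      case v
      show ?thesis by (rule rowcase[OF sub(1,3) v R1(4)]) (simp add: V_def)
    next
      case h
      show ?thesis by (rule rowcase[OF sub(2,4) h fits_flip[OF R1(4)]]) (simp add: H_def)
    next
      case c
      have cel: "c * N \<le> el * N" using c0(3) zle[OF els(1)] N by (intro mult_right_mono) auto
      have tall: "profit {i \<in> R1. el * N < placed_height \<phi> i} \<le> 2 * (P1 / 3)"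
      proof -
        \<comment> \<open>Being disjoint from \<open>V\<close>, the set \<open>H\<close> has no
          relatively tall items and hence no tall ones. So the tall items avoid \<open>H\<close>,
          which has more than a third of the profit.\<close>
        have "placed_height \<phi> i \<le> el * N" if "i \<in> H" for i
        proof -
          have "i \<in> R1" "\<not> reltall c \<phi> (ygrid \<phi> N L) i" using that VH sub(2) by (auto simp: V_def H_def)
          then have "placed_height \<phi> i \<le> c * N" by (rule not_reltall_height[OF R1(3,4) LR1 N c0(1)])
          then show ?thesis using cel by linarith
        qed
        then have "{i \<in> R1. el * N < placed_height \<phi> i} \<subseteq> R1 - H" by force
        then have "profit {i \<in> R1. el * N < placed_height \<phi> i} \<le> profit (R1 - H)"
          using valid_subset[OF R1(3)] by (intro profit_mono) auto
        also have "\<dots> = P1 - profit H" unfolding P1_def by (rule profit_Diff[OF R1(5) sub(2)])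
        finally show ?thesis using c by linarith
      qed
      have wide: "profit {i \<in> R1. el * N < placed_width \<phi> i} \<le> 2 * (P1 / 3)"
      proof -
        have "placed_width \<phi> i \<le> el * N" if "i \<in> V" for i
        proof -
          have "i \<in> R1" "\<not> reltall c (flip \<phi>) (ygrid (flip \<phi>) N L) i" using that VH sub(1) by (auto simp: V_def H_def)
          then have "placed_height (flip \<phi>) i \<le> c * N" by (rule not_reltall_height[OF R1(3) fits_flip[OF R1(4)] LR1 N c0(1)])
          then show ?thesis using cel by simp
        qed
        then have "{i \<in> R1. el * N < placed_width \<phi> i} \<subseteq> R1 - V" by force
        then have "profit {i \<in> R1. el * N < placed_width \<phi> i} \<le> profit (R1 - V)"
          using valid_subset[OF R1(3)] by (intro profit_mono) auto
        also have "\<dots> = P1 - profit V" unfolding P1_def by (rule profit_Diff[OF R1(5) sub(1)])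
        finally show ?thesis using c by linarith
      qed
      have huge: "item_profit i \<le> P1 / 3" if i: "i \<in> R1" "el * N < placed_width \<phi> i" "el * N < placed_height \<phi> i" for i
      proof -
        have "i \<in> Lv 1" unfolding Lv_def
        proof (rule level_1)
          show "i \<in> R0" using i R1 by auto
          show "boxin (pbox \<phi> i) (0, 0, N, N)" using i R1(4) by (simp add: fits_def)
          show "valid_item i" using i R1(3) by (simp add: valid_def)
        qed (use i cel N in linarith)+
        \<comment> \<open>\<open>L\<close>, \<open>V\<close> and \<open>H\<close> are disjoint, and
          the last two have more than a third each, so every item of \<open>L\<close> is worth less
          than a third.\<close>
        then have iL: "i \<in> L" using Lvm[OF j(1)] by (auto simp: L_def)
        have "profit {i} \<le> profit L" using iL by (intro profit_mono[OF VHv(3)]) simp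
        moreover have "profit (L \<union> (V \<union> H)) = profit L + (profit V + profit H)"
          using fin VH sub(3,4) by (subst profit_Un_disjoint) (auto simp: profit_Un_disjoint)
        moreover have "profit (L \<union> (V \<union> H)) \<le> P1" unfolding P1_def
          using LR1 sub by (intro profit_mono[OF R1(3)]) auto
        ultimately show ?thesis using c by (simp add: profit_def)
      qed
      have sc: "scale_ok \<phi> N R1 es el" 
        unfolding scale_ok_def
      proof (intro ballI)
        fix i f assume i: "i \<in> R1" "f \<in> set (params \<phi> N)"
        then have "i \<in> R" "i \<notin> M" using R1(1) by (auto simp: R0_def)
        then have "\<not> (es * N < f i \<and> f i \<le> el * N)" using i(2) unfolding M_def by blast
        then show "f i \<le> es * N \<or> el * N < f i" by linarith
      qed
      have ek: "4 * es * real k \<le> el" using els(3) k0 by (simp add: field_simps)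
      have "\<exists>S'\<subseteq>R1. (\<exists>\<psi>. fits \<psi> S' N ((1 - 2 * es) * N)) \<and> profit S' \<ge> (1 - 2 / k) * profit R1 - P1 / 3"
        by (rule contraction[OF N R1(3,4) sc e0(3,1) ek k0 e0(2) tall wide huge])
      then obtain S1 \<psi> where S1: "S1 \<subseteq> R1" "fits \<psi> S1 N ((1 - 2 * es) * N)" "profit S1 \<ge> (1 - 2 / k) * profit R1 - P1 / 3"
        by blast
      have vS1: "valid S1" by (rule valid_subset[OF R1(3) S1(1)])
      have "(1 - 2 * es) * N \<le> (1 - 2 * z) * N" using zle[OF els(2)] N by (intro mult_right_mono) auto
      then have "boxin b (0, 0, N, (1 - 2 * es) * N) \<Longrightarrow> boxin b (0, 0, N, (1 - 2 * z) * N)" for b by (cases b) auto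
      then have "fits \<psi> S1 N ((1 - 2 * z) * N)" using S1(2) unfolding fits_def by blast
      then have "good \<epsilon> (4 * \<epsilon>) KA N N S1" using aug N vS1 by blast
      then obtain S where S: "S \<subseteq> S1" "cpk \<epsilon> KA N N S" "profit S \<ge> (1 - 4 * \<epsilon>) * profit S1"
        unfolding good_def by blast
      have "(1 - 2 * \<epsilon>) * P1 \<le> (1 - 2 / k) * P1" using k\<epsilon> P1(2) by (intro mult_right_mono) auto
      moreover have "(2 / 3 - 2 * \<epsilon>) * P1 = (1 - 2 * \<epsilon>) * P1 - P1 / 3" by (simp add: field_simps)
      ultimately have "profit S1 \<ge> (2 / 3 - 2 * \<epsilon>) * P1" using S1(3) unfolding P1_def[symmetric] by linarith
      moreover have "(2 / 3 - 2 * \<epsilon>) * P1 \<ge> (2 / 3 - 2 * \<epsilon>) * ((1 - 2 * \<epsilon>) * P)"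
        using P1(1) \<epsilon> by (intro mult_left_mono) auto
      ultimately have "profit S1 \<ge> (2 / 3 - 2 * \<epsilon>) * ((1 - 2 * \<epsilon>) * P)" by linarith
      then have "(1 - 4 * \<epsilon>) * profit S1 \<ge> (1 - 4 * \<epsilon>) * ((2 / 3 - 2 * \<epsilon>) * ((1 - 2 * \<epsilon>) * P))"
        using \<epsilon> by (intro mult_left_mono) auto
      \<comment> \<open>This case determines the constant: the linear terms are \<open>2\<close>
        from cutting the strip, \<open>8 / 3\<close> from \<open>augmented\<close> and
        \<open>4 / 3\<close> from the dropped scale and round, in total \<open>6\<close>. In
        \<open>rowcase\<close> they amount to \<open>14 / 3\<close>.\<close>
      moreover have "(1 - 4 * \<epsilon>) * ((2 / 3 - 2 * \<epsilon>) * ((1 - 2 * \<epsilon>) * P)) =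
         (2 / 3 - 6 * \<epsilon>) * P + (\<epsilon> * \<epsilon>) * ((52 / 3 - 16 * \<epsilon>) * P)" by (simp add: field_simps)
      moreover have "0 \<le> (\<epsilon> * \<epsilon>) * ((52 / 3 - 16 * \<epsilon>) * P)" using P0 \<epsilon> by (intro mult_nonneg_nonneg) auto
      ultimately have "profit S \<ge> (2 / 3 - 6 * \<epsilon>) * P" using S(3) by linarith
      moreover have "cpk \<epsilon> K N N S" using S(2) by (rule cpk_mono) (simp_all add: K_def)
      ultimately show ?thesis using S(1) S1(1) R1(2) unfolding P_def by blast
    qed
  qed
  show ?thesis by (intro exI[of _ K] allI impI) (elim conjE, rule main; assumption)
qed

theorem theorem5p2:
  "\<exists>(C :: real) (K :: real \<Rightarrow> nat).
     \<forall>\<epsilon>. 0 < \<epsilon> \<and> \<epsilon> < 1 / 6 \<longrightarrow>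
       (\<forall>(N :: real) R.
          0 < N \<and> finite R \<and> (\<forall>i\<in>R. valid_item i) \<and> (\<exists>\<psi>. packing N R \<psi>) \<longrightarrow>
          (\<exists>R' \<phi> \<C>.
             R' \<subseteq> R \<and>
             granular_container_packing \<epsilon> N R' \<phi> \<C> \<and>
             card \<C> \<le> K \<epsilon> \<and>
             profit R' \<ge> (2 / 3 - C * \<epsilon>) * profit R))"
proof -
  \<comment> \<open>The bounds on \<open>\<epsilon>\<close> stand inside the existential quantifier
    so that \<open>choice\<close> yields a function on all reals.\<close>
  have "\<forall>\<epsilon>::real. \<exists>K. 0 < \<epsilon> \<and> \<epsilon> < 1 / 6 \<longrightarrow> (\<forall>N R \<phi>. 0 < N \<and> valid R \<and> fits \<phi> R N N \<longrightarrow>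
     (\<exists>S\<subseteq>R. cpk \<epsilon> K N N S \<and> profit S \<ge> (2 / 3 - 6 * \<epsilon>) * profit R))"
    using two_thirds_packing by blast
  from choice[OF this] obtain K where K: "\<And>\<epsilon> N R \<phi>. 0 < \<epsilon> \<Longrightarrow> \<epsilon> < 1 / 6 \<Longrightarrow> 0 < N \<Longrightarrow> valid R \<Longrightarrow> fits \<phi> R N N \<Longrightarrow>
     \<exists>S\<subseteq>R. cpk \<epsilon> (K \<epsilon>) N N S \<and> profit S \<ge> (2 / 3 - 6 * \<epsilon>) * profit R" by blast
  show ?thesis
  proof (intro exI[of _ 6] exI[of _ K] allI impI)
    fix \<epsilon> N :: real and R
    assume \<epsilon>: "0 < \<epsilon> \<and> \<epsilon> < 1 / 6"
      and R: "0 < N \<and> finite R \<and> (\<forall>i\<in>R. valid_item i) \<and> (\<exists>\<psi>. packing N R \<psi>)"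
    then obtain \<psi> where "packing N R \<psi>" by blast
    moreover have v: "valid R" using R by (simp add: valid_def)
    ultimately have "fits \<psi> R N N" by (rule packing_fits)
    then obtain S where S: "S \<subseteq> R" "cpk \<epsilon> (K \<epsilon>) N N S" "profit S \<ge> (2 / 3 - 6 * \<epsilon>) * profit R"
      using K[of \<epsilon> N R \<psi>] \<epsilon> R v by blast
    then obtain \<phi> \<C> where c: "cpack \<epsilon> (K \<epsilon>) N N S \<phi> \<C>" by (auto simp: cpk_def)
    have "granular_container_packing \<epsilon> N S \<phi> \<C>"
      by (rule cpack_granular[OF c valid_subset[OF v S(1)]])
    moreover have "card \<C> \<le> K \<epsilon>" using c by (simp add: cpack_def)
    ultimately show "\<exists>R' \<phi> \<C>. R' \<subseteq> R \<and> granular_container_packing \<epsilon> N R' \<phi> \<C> \<and> card \<C> \<le> K \<epsilon> \<and>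
       profit R' \<ge> (2 / 3 - 6 * \<epsilon>) * profit R" using S by blast
  qed
qed

end
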